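(* Let $p$ be an odd prime, $n\ge1$, $K$ a field of characteristic zero containing a primitive $p^n$-th root of unity, and $L/K$ a cyclic Galois extension of degree $p^n$ with group $G=\langle\sigma\rangle$. For $0\le r,s<p^{n-1}$, $H_r\cong H_s$ as $K$-algebras if and only if $v_p(r)=v_p(s)$.
   Context: $v_p$ is the $p$-adic valuation (with $v_p(0)=\infty$). Let $N=\langle\eta\rangle$ be cyclic of order $p^n$ and $\delta\in\mathrm{Aut}(N)$ the $(p-1)$-th power of a generator of the cyclic group $\mathrm{Aut}(N)$. Let $\rho(\eta)\in\mathrm{Perm}(N)$ be $x\mapsto x\eta^{-1}$ and $\lambda_N(\nu)(x)=\nu x$. For $0\le s<p^{n-1}$ let $\beta_s:G\to\mathrm{Perm}(N)$ be the homomorphism with $\beta_s(\sigma)=\rho(\eta)\circ\delta^{s}$. Let $b_s:G\to N$, $b_s(g)=\beta_s(g)(1_N)$ (a bijection), and $\alpha_s:N\to\mathrm{Perm}(G)$, $\alpha_s(\nu)=b_s^{-1}\circ\lambda_N(\nu)\circ b_s$. Then $\alpha_s(N)$ is a regular subgroup of $\mathrm{Perm}(G)$ normalized by the left regular representation $\lambda(G)$, and $H_s=L[\alpha_s(N)]^G$, where $G$ acts on $L$ as Galois automorphisms and on $\alpha_s(N)$ by $g\ast\nu=\lambda(g)\nu\lambda(g)^{-1}$. *)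

theory Defs
  imports
    "HOL-Computational_Algebra.Primes"
    "HOL-Library.Extended_Nat"
    "HOL-Algebra.Algebra"
begin

definition vp :: "nat \<Rightarrow> nat \<Rightarrow> enat" where
  "vp p m = (if m = 0 then \<infinity> else enat (multiplicity p m))"


section \<open>Galois extensions\<close>

text \<open>As with \<^const>\<open>AutoGroup\<close>, automorphisms are extensional functions on the carrier, so that
  equality of automorphisms is equality of functions.\<close>

definition galois_group :: "('a, 'b) ring_scheme \<Rightarrow> 'a set \<Rightarrow> ('a \<Rightarrow> 'a) monoid" where
  "galois_group L K = BijGroup (carrier L)
     \<lparr>carrier := {g \<in> ring_iso L L \<inter> extensional (carrier L). \<forall>x\<in>K. g x = x}\<rparr>"

definition galois_extension :: "('a, 'b) ring_scheme \<Rightarrow> 'a set \<Rightarrow> bool" where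
  "galois_extension L K \<longleftrightarrow>
     field L \<and> subfield K L \<and> ring.finite_dimension L K (carrier L) \<and>
     {x \<in> carrier L. \<forall>g\<in>carrier (galois_group L K). g x = x} = K"

definition char_zero :: "('a, 'b) ring_scheme \<Rightarrow> bool" where
  "char_zero R \<longleftrightarrow> (\<forall>m::nat. m > 0 \<longrightarrow> add_pow R m \<one>\<^bsub>R\<^esub> \<noteq> \<zero>\<^bsub>R\<^esub>)"

definition primitive_root_of_unity :: "('a, 'b) ring_scheme \<Rightarrow> nat \<Rightarrow> 'a \<Rightarrow> bool" where
  "primitive_root_of_unity R m z \<longleftrightarrow>
     z \<in> carrier R \<and> z [^]\<^bsub>R\<^esub> m = \<one>\<^bsub>R\<^esub> \<and>
     (\<forall>j::nat. 0 < j \<and> j < m \<longrightarrow> z [^]\<^bsub>R\<^esub> j \<noteq> \<one>\<^bsub>R\<^esub>)"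


section \<open>Group algebras of finite groups and their fixed subalgebras\<close>

text \<open>The element \<open>\<Sum>a\<in>A. x(a) a\<close> of \<open>R[A]\<close> is represented by its coefficient function \<open>x\<close>.
  There is no finite-support condition, so this is the group algebra for finite \<open>A\<close> only.\<close>

definition group_algebra ::
    "('a, 'b) ring_scheme \<Rightarrow> ('g, 'c) monoid_scheme \<Rightarrow> ('a, 'g \<Rightarrow> 'a) module" where
  "group_algebra R A =
    \<lparr>carrier = carrier A \<rightarrow>\<^sub>E carrier R,
     monoid.mult = (\<lambda>x y. \<lambda>c\<in>carrier A.
       \<Oplus>\<^bsub>R\<^esub>q\<in>{(a, b). a \<in> carrier A \<and> b \<in> carrier A \<and> a \<otimes>\<^bsub>A\<^esub> b = c}.
         x (fst q) \<otimes>\<^bsub>R\<^esub> y (snd q)),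
     monoid.one = (\<lambda>c\<in>carrier A. if c = \<one>\<^bsub>A\<^esub> then \<one>\<^bsub>R\<^esub> else \<zero>\<^bsub>R\<^esub>),
     ring.zero = (\<lambda>c\<in>carrier A. \<zero>\<^bsub>R\<^esub>),
     ring.add = (\<lambda>x y. \<lambda>c\<in>carrier A. x c \<oplus>\<^bsub>R\<^esub> y c),
     module.smult = (\<lambda>k x. \<lambda>c\<in>carrier A. k \<otimes>\<^bsub>R\<^esub> x c)\<rparr>"

definition left_regular :: "('g, 'c) monoid_scheme \<Rightarrow> 'g \<Rightarrow> 'g \<Rightarrow> 'g" where
  "left_regular G g = (\<lambda>x\<in>carrier G. g \<otimes>\<^bsub>G\<^esub> x)"

definition conj_action :: "('g, 'c) monoid_scheme \<Rightarrow> 'g \<Rightarrow> ('g \<Rightarrow> 'g) \<Rightarrow> 'g \<Rightarrow> 'g" where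
  "conj_action G g \<nu> =
     left_regular G g \<otimes>\<^bsub>BijGroup (carrier G)\<^esub> \<nu>
       \<otimes>\<^bsub>BijGroup (carrier G)\<^esub> inv\<^bsub>BijGroup (carrier G)\<^esub> (left_regular G g)"

text \<open>For \<open>G = Gal(L/K)\<close> and a subgroup \<open>A\<close> of \<open>Perm(G)\<close> normalized by \<open>\<lambda>(G)\<close>, the coefficient
  of \<open>\<mu>\<close> in \<open>g \<cdot> (\<Sum>\<nu>\<in>A. x(\<nu>) \<nu>) = \<Sum>\<nu>\<in>A. g(x(\<nu>)) (g \<ast> \<nu>)\<close> is \<open>g (x (inv g \<ast> \<mu>))\<close>.\<close>

definition galois_action ::
    "('a, 'b) ring_scheme \<Rightarrow> 'a set \<Rightarrow> (('a \<Rightarrow> 'a) \<Rightarrow> ('a \<Rightarrow> 'a)) set \<Rightarrow> ('a \<Rightarrow> 'a) \<Rightarrow>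
     ((('a \<Rightarrow> 'a) \<Rightarrow> ('a \<Rightarrow> 'a)) \<Rightarrow> 'a) \<Rightarrow> (('a \<Rightarrow> 'a) \<Rightarrow> ('a \<Rightarrow> 'a)) \<Rightarrow> 'a" where
  "galois_action L K A g x =
     (\<lambda>\<mu>\<in>A. g (x (conj_action (galois_group L K) (inv\<^bsub>galois_group L K\<^esub> g) \<mu>)))"

text \<open>The ring \<open>L[A]\<^sup>G\<close>. The scalar multiplication is inherited from \<open>L[A]\<close>; only scalars in \<open>K\<close>
  preserve the carrier.\<close>

definition fixed_algebra ::
    "('a, 'b) ring_scheme \<Rightarrow> 'a set \<Rightarrow> (('a \<Rightarrow> 'a) \<Rightarrow> ('a \<Rightarrow> 'a)) set \<Rightarrow>
     ('a, (('a \<Rightarrow> 'a) \<Rightarrow> ('a \<Rightarrow> 'a)) \<Rightarrow> 'a) module" where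
  "fixed_algebra L K A =
    (let LA = group_algebra L (BijGroup (carrier (galois_group L K)) \<lparr>carrier := A\<rparr>)
     in LA \<lparr>carrier := {x \<in> carrier LA.
                  \<forall>g\<in>carrier (galois_group L K). galois_action L K A g x = x}\<rparr>)"

definition algebra_isomorphic ::
    "'k set \<Rightarrow> ('k, 'a, 'm) module_scheme \<Rightarrow> ('k, 'b, 'n) module_scheme \<Rightarrow> bool" where
  "algebra_isomorphic K A B \<longleftrightarrow>
     (\<exists>\<phi>\<in>ring_iso A B. \<forall>k\<in>K. \<forall>x\<in>carrier A. \<phi> (k \<odot>\<^bsub>A\<^esub> x) = k \<odot>\<^bsub>B\<^esub> \<phi> x)"


section \<open>The Hopf algebras \<open>H\<^sub>s\<close>\<close>

definition right_regular :: "('n, 'c) monoid_scheme \<Rightarrow> 'n \<Rightarrow> 'n \<Rightarrow> 'n" where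
  "right_regular N \<nu> = (\<lambda>x\<in>carrier N. x \<otimes>\<^bsub>N\<^esub> inv\<^bsub>N\<^esub> \<nu>)"

text \<open>Below, \<open>G\<close> is generated by \<open>\<sigma>\<close>, so a homomorphism on \<open>G\<close> is determined by its value at \<open>\<sigma>\<close>;
  extensionality makes it unique also as a HOL function.\<close>

definition beta ::
    "('g, 'b) monoid_scheme \<Rightarrow> 'g \<Rightarrow> ('n, 'c) monoid_scheme \<Rightarrow> 'n \<Rightarrow> ('n \<Rightarrow> 'n) \<Rightarrow> nat \<Rightarrow>
     'g \<Rightarrow> 'n \<Rightarrow> 'n" where
  "beta G \<sigma> N \<eta> \<delta> s =
    (THE h. h \<in> hom G (BijGroup (carrier N)) \<and> h \<in> extensional (carrier G) \<and>
       h \<sigma> = right_regular N \<eta> \<otimes>\<^bsub>BijGroup (carrier N)\<^esub> (\<delta> [^]\<^bsub>AutoGroup N\<^esub> s))"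

definition b_map ::
    "('g, 'b) monoid_scheme \<Rightarrow> 'g \<Rightarrow> ('n, 'c) monoid_scheme \<Rightarrow> 'n \<Rightarrow> ('n \<Rightarrow> 'n) \<Rightarrow> nat \<Rightarrow>
     'g \<Rightarrow> 'n" where
  "b_map G \<sigma> N \<eta> \<delta> s g = beta G \<sigma> N \<eta> \<delta> s g \<one>\<^bsub>N\<^esub>"

definition alpha ::
    "('g, 'b) monoid_scheme \<Rightarrow> 'g \<Rightarrow> ('n, 'c) monoid_scheme \<Rightarrow> 'n \<Rightarrow> ('n \<Rightarrow> 'n) \<Rightarrow> nat \<Rightarrow>
     'n \<Rightarrow> 'g \<Rightarrow> 'g" where
  "alpha G \<sigma> N \<eta> \<delta> s \<nu> =
    (\<lambda>g\<in>carrier G. inv_into (carrier G) (b_map G \<sigma> N \<eta> \<delta> s)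
       (left_regular N \<nu> (b_map G \<sigma> N \<eta> \<delta> s g)))"

definition hopf_alg ::
    "('a, 'b) ring_scheme \<Rightarrow> 'a set \<Rightarrow> ('a \<Rightarrow> 'a) \<Rightarrow> ('n, 'c) monoid_scheme \<Rightarrow> 'n \<Rightarrow> ('n \<Rightarrow> 'n) \<Rightarrow>
     nat \<Rightarrow> ('a, (('a \<Rightarrow> 'a) \<Rightarrow> ('a \<Rightarrow> 'a)) \<Rightarrow> 'a) module" where
  "hopf_alg L K \<sigma> N \<eta> \<delta> s =
     fixed_algebra L K (alpha (galois_group L K) \<sigma> N \<eta> \<delta> s ` carrier N)"

end

theory Submission
  imports Defs "HOL-Number_Theory.Residues"
begin

text \<open>
  Write \<open>q = p\<^sup>n\<close> and \<open>\<delta>(\<eta>) = \<eta>\<^sup>d\<close>. Under \<open>\<alpha>\<^sub>s\<close> the conjugation action of \<open>\<sigma>\<close> on \<open>\<alpha>\<^sub>s(N)\<close> becomes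
  multiplication by \<open>u = d\<^sup>s\<close> on \<open>\<int>/q\<close>. Since \<open>K\<close> contains a primitive \<open>q\<close>-th root of unity, the Fourier
  transform identifies \<open>H\<^sub>s\<close> with the algebra \<open>T\<^sub>u\<close> of functions \<open>f : \<int>/q \<rightarrow> L\<close> with
  \<open>\<sigma>(f(u j)) = f(j)\<close>, a product of subextensions of \<open>L/K\<close> indexed by the orbits of \<open>u\<close>.
  If \<open>v\<^sub>p(r) = v\<^sub>p(s)\<close>, then \<open>d\<^sup>r\<close> and \<open>d\<^sup>s\<close> are powers of each other, hence have the same orbits, and a
  permutation of \<open>\<int>/q\<close> intertwining them gives an isomorphism. Conversely, the number of factors
  isomorphic to \<open>K\<close> is the number of fixed points of \<open>u\<close>, which is \<open>p\<^sup>v\<^sup>+\<^sup>1\<close> with \<open>v = v\<^sub>p(s)\<close> for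
  \<open>s \<noteq> 0\<close> and \<open>q\<close> for \<open>s = 0\<close>, because \<open>d - 1\<close> is divisible by \<open>p\<close> exactly once when \<open>n \<ge> 2\<close>.
\<close>

section \<open>Geometric sums modulo prime powers\<close>

text \<open>The arithmetic rests on one equivalence: for u = 1 modulo an odd prime p, a power of p
  divides 1 + u + ... + u^(k-1) exactly when it divides k. On exponents of \<eta>, the permutation
  \<beta>_s(\<sigma>) is x \<mapsto> u x - 1, so its iterates at 1 are such sums; the equivalence
  yields the existence of \<beta>_s, the bijectivity of b_s and, through d^s - 1 = (d - 1)(1 + ... +
  d^(s-1)), the fixed point count. Oddness of p enters there. A Galois extension is defined here by
  finite degree and fixed field, so the order of G has to be shown equal to q. An orbit of length l
  contributes the fixed field of \<sigma>^l, of degree l over K; this is why fixed points correspond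
  to copies of K. They are counted by idempotents e with e A = K e, a condition visibly invariant
  under isomorphism. That p divides d - 1 only once comes from \<gamma> generating Aut(N): the
  automorphism x \<mapsto> x^(1+p) must be a power of \<gamma>, which fails if g^(p-1) = 1 modulo
  p^2, where \<gamma>(\<eta>) = \<eta>^g. For n = 1 only r = s = 0 is allowed.\<close>

lemma geometric_sum_add:
  "(\<Sum>i<k + l. u ^ i) = (\<Sum>i<k. u ^ i) + u ^ k * (\<Sum>i<l. u ^ i)" for u :: nat
  by (induction l) (auto simp: algebra_simps power_add)

lemma geometric_sum_mult:
  "(\<Sum>i<k * l. u ^ i) = (\<Sum>i<k. u ^ i) * (\<Sum>i<l. (u ^ k) ^ i)" for u :: nat
proof (induction l)
  case (Suc l)
  have "(\<Sum>i<k * Suc l. u ^ i) = (\<Sum>i<k * l. u ^ i) + u ^ (k * l) * (\<Sum>i<k. u ^ i)"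
    by (simp add: add.commute[of k] geometric_sum_add)
  with Suc show ?case by (simp add: algebra_simps power_mult)
qed simp

lemma geometric_sum_cong_length:
  fixes u p :: nat
  assumes "[u = 1] (mod p)"
  shows "[(\<Sum>i<k. u ^ i) = k] (mod p)"
proof -
  have "[(\<Sum>i<k. u ^ i) = (\<Sum>i<k. 1 ^ i)] (mod p)"
    by (intro cong_sum cong_pow assms)
  then show ?thesis by simp
qed

text \<open>With u = 1 + p w one has u^i = 1 + i p w modulo p^2, so the sum is p + (0 + ... + (p -
  1)) p w. For odd p the inner sum is a multiple of p, and only p remains modulo p^2.\<close>

lemma geometric_sum_prime_exponent:
  fixes u p :: nat
  assumes "Factorial_Ring.prime p" "odd p" "[u = 1] (mod p)"
  obtains c where "(\<Sum>i<p. u ^ i) = p * c" "\<not> p dvd c"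
proof -
  have p1: "p > 1" using assms(1) by (rule prime_gt_1_nat)
  have "u \<noteq> 0"
  proof
    assume "u = 0"
    with assms(3) p1 show False by (simp add: cong_def)
  qed
  then have "p dvd u - 1"
    using assms(3) by (metis One_nat_def Suc_leI cong_altdef_nat neq0_conv)
  with \<open>u \<noteq> 0\<close> obtain w where w: "u = 1 + p * w"
    by (metis Suc_pred' dvdE neq0_conv plus_1_eq_Suc)
  have pow: "[u ^ i = 1 + i * (p * w)] (mod p * p)" for i
  proof (induction i)
    case (Suc i)
    have "[u ^ Suc i = u * (1 + i * (p * w))] (mod p * p)"
      using cong_mult[OF cong_refl Suc] by simp
    also have "u * (1 + i * (p * w)) = 1 + Suc i * (p * w) + (p * p) * (i * w * w)"
      by (simp add: w algebra_simps)
    also have "[\<dots> = 1 + Suc i * (p * w)] (mod p * p)"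
      by (simp add: cong_def)
    finally show ?case .
  qed simp
  \<comment> \<open>Here oddness is essential: for p = 2 and u = 3 the sum is 4, and
    \<open>c\<close> would be even.\<close>
  obtain h where h: "p = 2 * h + 1" using assms(2) by (elim oddE)
  have gauss: "(\<Sum>i<2 * h + 1. i) = (2 * h + 1) * h"
    by (induction h) (auto simp: algebra_simps)
  have "[(\<Sum>i<p. u ^ i) = (\<Sum>i<p. 1 + i * (p * w))] (mod p * p)"
    by (intro cong_sum pow)
  also have "(\<Sum>i<p. 1 + i * (p * w)) = p + (\<Sum>i<p. i) * (p * w)"
    unfolding sum.distrib sum_distrib_right by simp
  also have "(\<Sum>i<p. i) = p * h" using gauss h by simp
  also have "p + p * h * (p * w) = p + (p * p) * (h * w)"
    by (simp add: algebra_simps)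
  also have "[\<dots> = p] (mod p * p)" by (simp add: cong_def)
  finally have *: "[(\<Sum>i<p. u ^ i) = p] (mod p * p)" .
  have "p dvd (\<Sum>i<p. u ^ i)"
    using geometric_sum_cong_length[OF assms(3), of p] by (simp add: cong_def dvd_eq_mod_eq_0)
  then obtain c where c: "(\<Sum>i<p. u ^ i) = p * c" by blast
  then have "[c = 1] (mod p)"
    using * p1 by (auto simp: cong_def)
  then have "\<not> p dvd c"
    using p1 cong_dvd_iff by fastforce
  with c show thesis by (rule that)
qed

text \<open>Lifting the exponent. If p does not divide k, the sum is k modulo p, hence prime to p.
  If k = p k', the sum splits into the one of length p, which contains p exactly once, and the one
  of length k' for u^p; this change of base is why \<open>u\<close> is generalized in the
  induction.\<close>

lemma prime_power_dvd_geometric_sum_iff: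
  fixes u p k :: nat
  assumes "Factorial_Ring.prime p" "odd p" "[u = 1] (mod p)"
  shows "p ^ j dvd (\<Sum>i<k. u ^ i) \<longleftrightarrow> p ^ j dvd k"
  using assms(3)
proof (induction k arbitrary: u j rule: less_induct)
  case (less k)
  have p1: "p > 1" using assms(1) by (rule prime_gt_1_nat)
  show ?case
  proof (cases "p dvd k \<and> k > 0")
    case False
    show ?thesis
    proof (cases "k = 0 \<or> j = 0")
      case False
      with \<open>\<not> (p dvd k \<and> k > 0)\<close> have "\<not> p dvd k" by simp
      moreover have "\<not> p dvd (\<Sum>i<k. u ^ i)"
        using geometric_sum_cong_length[OF less.prems, of k] \<open>\<not> p dvd k\<close> cong_dvd_iff by blast
      ultimately show ?thesis
        using False dvd_power[of j p] dvd_trans by blast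
    qed auto
  next
    case True
    then obtain k' where k': "k = p * k'" by blast
    with True p1 have lt: "k' < k" by auto
    obtain c where c: "(\<Sum>i<p. u ^ i) = p * c" "\<not> p dvd c"
      using geometric_sum_prime_exponent[OF assms(1,2) less.prems] .
    have up: "[u ^ p = 1] (mod p)"
      using less.prems cong_pow[of u 1 p p] by simp
    show ?thesis
    proof (cases j)
      case (Suc i)
      have "coprime (p ^ i) c"
        using c(2) assms(1) prime_imp_coprime by (metis coprime_power_left_iff)
      then have "p ^ j dvd (\<Sum>i<k. u ^ i) \<longleftrightarrow> p ^ i dvd (\<Sum>i<k'. (u ^ p) ^ i)"
        using p1 by (simp add: k' geometric_sum_mult c(1) Suc mult.assoc coprime_dvd_mult_right_iff)
      also have "\<dots> \<longleftrightarrow> p ^ i dvd k'" by (rule less.IH[OF lt up])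
      also have "\<dots> \<longleftrightarrow> p ^ j dvd k" using p1 by (simp add: k' Suc)
      finally show ?thesis .
    qed simp
  qed
qed

lemma power_minus_one_geometric_sum:
  "u ^ k - 1 = (u - 1) * (\<Sum>i<k. u ^ i)" if pos: "u > 0" for u :: nat
proof -
  obtain w where "u = Suc w" using pos by (cases u) auto
  have "Suc w ^ k = 1 + w * (\<Sum>i<k. Suc w ^ i)"
    by (induction k) (auto simp: algebra_simps)
  with \<open>u = Suc w\<close> have "u ^ k = 1 + (u - 1) * (\<Sum>i<k. u ^ i)" by simp
  then show ?thesis by simp
qed

section \<open>Linear systems over a field and independence of characters\<close>

lemma (in abelian_monoid) finsum_Sigma:
  assumes "finite A" "\<And>a. a \<in> A \<Longrightarrow> finite (B a)"
    and "\<And>a b. a \<in> A \<Longrightarrow> b \<in> B a \<Longrightarrow> f a b \<in> carrier G"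
  shows "(\<Oplus>x\<in>Sigma A B. f (fst x) (snd x)) = (\<Oplus>a\<in>A. \<Oplus>b\<in>B a. f a b)"
proof -
  have "Sigma A B = (\<Union>a\<in>A. Pair a ` B a)" by auto
  then have "(\<Oplus>x\<in>Sigma A B. f (fst x) (snd x)) = (\<Oplus>a\<in>A. \<Oplus>x\<in>Pair a ` B a. f (fst x) (snd x))"
    using assms by (auto intro!: add.finprod_UN_disjoint simp: pairwise_def disjnt_def)
  also have "\<dots> = (\<Oplus>a\<in>A. \<Oplus>b\<in>B a. f a b)"
  proof (rule add.finprod_cong')
    fix a assume "a \<in> A"
    then show "(\<Oplus>x\<in>Pair a ` B a. f (fst x) (snd x)) = (\<Oplus>b\<in>B a. f a b)"
      using assms(3) by (subst finsum_reindex) (auto simp: inj_on_def)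
  qed (use assms in auto)
  finally show ?thesis .
qed

lemma (in abelian_monoid) finsum_swap:
  assumes "finite A" "finite B"
    and "\<And>a b. a \<in> A \<Longrightarrow> b \<in> B \<Longrightarrow> f a b \<in> carrier G"
  shows "(\<Oplus>a\<in>A. \<Oplus>b\<in>B. f a b) = (\<Oplus>b\<in>B. \<Oplus>a\<in>A. f a b)"
  using assms(1,3)
proof (induction A rule: finite_induct)
  case empty
  then show ?case by simp
next
  case (insert x F)
  have "(\<Oplus>b\<in>B. \<Oplus>a\<in>insert x F. f a b) = (\<Oplus>b\<in>B. f x b \<oplus> (\<Oplus>a\<in>F. f a b))"
    using insert by (intro add.finprod_cong') auto
  with insert show ?case by (simp add: Pi_def)
qed

lemma (in field) homogeneous_system_nontrivial_solution:
  fixes A :: "nat \<Rightarrow> 'c \<Rightarrow> 'a"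
  assumes "finite J" "n < card J" "\<And>i j. i < n \<Longrightarrow> j \<in> J \<Longrightarrow> A i j \<in> carrier R"
  obtains x where "\<And>j. j \<in> J \<Longrightarrow> x j \<in> carrier R" "\<exists>j\<in>J. x j \<noteq> \<zero>"
    "\<And>i. i < n \<Longrightarrow> (\<Oplus>j\<in>J. A i j \<otimes> x j) = \<zero>"
proof -
  have "\<exists>x. (\<forall>j\<in>J. x j \<in> carrier R) \<and> (\<exists>j\<in>J. x j \<noteq> \<zero>) \<and> (\<forall>i<n. (\<Oplus>j\<in>J. A i j \<otimes> x j) = \<zero>)"
    using assms
  proof (induction n arbitrary: A J)
    case 0
    then have "J \<noteq> {}" by auto
    then show ?case by (intro exI[of _ "\<lambda>_. \<one>"]) auto
  next
    case (Suc n)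
    show ?case
    proof (cases "\<forall>j\<in>J. A n j = \<zero>")
      case True
      obtain x where x: "\<forall>j\<in>J. x j \<in> carrier R" "\<exists>j\<in>J. x j \<noteq> \<zero>"
        "\<forall>i<n. (\<Oplus>j\<in>J. A i j \<otimes> x j) = \<zero>"
        using Suc.IH[of J A] Suc.prems by auto
      have "(\<Oplus>j\<in>J. A n j \<otimes> x j) = \<zero>"
        using True x(1) by (intro add.finprod_one_eqI) auto
      with x show ?thesis by (intro exI[of _ x]) (auto simp: less_Suc_eq)
    next
      case False
      then obtain k where k: "k \<in> J" "A n k \<noteq> \<zero>" by blast
      define J' where "J' = J - {k}"
      have J': "finite J'" "k \<notin> J'" "J = insert k J'" "n < card J'"
        using Suc.prems k by (auto simp: J'_def)
      define t where "t = inv (A n k)"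
      have Ac: "A i j \<in> carrier R" if "i < Suc n" "j \<in> J" for i j using Suc.prems that by blast
      have t: "t \<in> carrier R" "A n k \<otimes> t = \<one>"
        using k Ac by (auto simp: t_def field_Units)
      have Ak: "A i k \<in> carrier R" if "i < Suc n" for i using Ac k that by blast
      have AJ': "A i j \<in> carrier R" if "i < Suc n" "j \<in> J'" for i j using Ac J'(3) that by blast
      \<comment> \<open>Row \<open>i\<close> minus the multiple of row \<open>n\<close> that cancels
        the pivot variable \<open>k\<close>.\<close>
      define B where "B = (\<lambda>i j. A i j \<ominus> A i k \<otimes> t \<otimes> A n j)"
      obtain x where x: "\<forall>j\<in>J'. x j \<in> carrier R" "\<exists>j\<in>J'. x j \<noteq> \<zero>"
        "\<forall>i<n. (\<Oplus>j\<in>J'. B i j \<otimes> x j) = \<zero>"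
        using Suc.IH[of J' B] J' AJ' Ak t by (auto simp: B_def)
      \<comment> \<open>The value at \<open>k\<close> is what row \<open>n\<close> dictates; the
        other rows then reduce to the system \<open>B\<close>.\<close>
      define y where "y = x(k := \<ominus> (t \<otimes> (\<Oplus>j\<in>J'. A n j \<otimes> x j)))"
      have s: "(\<Oplus>j\<in>J'. A i j \<otimes> x j) \<in> carrier R" if "i < Suc n" for i
        using x AJ' that by auto
      have yJ': "y j = x j" if "j \<in> J'" for j using that J' by (auto simp: y_def)
      have yk: "y k = \<ominus> (t \<otimes> (\<Oplus>j\<in>J'. A n j \<otimes> x j))" by (simp add: y_def)
      have yc: "y j \<in> carrier R" if "j \<in> J" for j
        using that J' x s t by (auto simp: y_def)
      have row: "(\<Oplus>j\<in>J. A i j \<otimes> y j) =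
          \<ominus> (A i k \<otimes> t \<otimes> (\<Oplus>j\<in>J'. A n j \<otimes> x j)) \<oplus> (\<Oplus>j\<in>J'. A i j \<otimes> x j)" if "i < Suc n" for i
      proof -
        have "(\<Oplus>j\<in>J. A i j \<otimes> y j) = A i k \<otimes> y k \<oplus> (\<Oplus>j\<in>J'. A i j \<otimes> y j)"
          using J' Ak AJ' yc that by (simp add: Pi_def)
        also have "(\<Oplus>j\<in>J'. A i j \<otimes> y j) = (\<Oplus>j\<in>J'. A i j \<otimes> x j)"
          using x AJ' that by (intro add.finprod_cong') (auto simp: yJ')
        finally show ?thesis using Ak t s that by (simp add: yk r_minus m_assoc)
      qed
      have "(\<Oplus>j\<in>J. A i j \<otimes> y j) = \<zero>" if "i < n" for i
      proof -
        have "\<zero> = (\<Oplus>j\<in>J'. B i j \<otimes> x j)" using x that by simp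
        also have "\<dots> = (\<Oplus>j\<in>J'. (\<ominus> (A i k \<otimes> t)) \<otimes> (A n j \<otimes> x j) \<oplus> A i j \<otimes> x j)"
          using x(1) AJ' Ak t that
          by (intro add.finprod_cong') (auto simp: B_def minus_eq l_distr l_minus a_comm m_assoc)
        also have "\<dots> = (\<ominus> (A i k \<otimes> t)) \<otimes> (\<Oplus>j\<in>J'. A n j \<otimes> x j) \<oplus> (\<Oplus>j\<in>J'. A i j \<otimes> x j)"
          using x(1) AJ' Ak t J'(1) that by (subst finsum_addf) (auto simp: finsum_rdistr Pi_def)
        also have "\<dots> = (\<Oplus>j\<in>J. A i j \<otimes> y j)"
          using row[of i] Ak t s that by (simp add: l_minus)
        finally show ?thesis by simp
      qed
      moreover have "(\<Oplus>j\<in>J. A n j \<otimes> y j) = \<zero>"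
        using row[of n] t s by (simp add: l_neg)
      moreover have "\<exists>j\<in>J. y j \<noteq> \<zero>" using x(2) yJ' J'(3) by auto
      ultimately show ?thesis using yc by (intro exI[of _ y]) (auto simp: less_Suc_eq)
    qed
  qed
  then show thesis using that by blast
qed

text \<open>Induction on the index set. Subtracting \<phi>_g(y) times the relation at x from the
  relation at y x removes the term of \<open>g\<close>. The characters form an indexed family
  compared on the carrier only, which suits iterates of an automorphism.\<close>

lemma (in domain) dedekind_independence:
  assumes "finite I"
    and "\<And>i x. i \<in> I \<Longrightarrow> x \<in> carrier R \<Longrightarrow> \<phi> i x \<in> carrier R"
    and "\<And>i x y. i \<in> I \<Longrightarrow> x \<in> carrier R \<Longrightarrow> y \<in> carrier R \<Longrightarrow> \<phi> i (x \<otimes> y) = \<phi> i x \<otimes> \<phi> i y"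
    and "\<And>i. i \<in> I \<Longrightarrow> \<phi> i \<one> = \<one>"
    and "\<And>i j. i \<in> I \<Longrightarrow> j \<in> I \<Longrightarrow> i \<noteq> j \<Longrightarrow> \<exists>x\<in>carrier R. \<phi> i x \<noteq> \<phi> j x"
    and "\<And>i. i \<in> I \<Longrightarrow> c i \<in> carrier R"
    and "\<And>x. x \<in> carrier R \<Longrightarrow> (\<Oplus>i\<in>I. c i \<otimes> \<phi> i x) = \<zero>"
    and "i \<in> I"
  shows "c i = \<zero>"
  using assms
proof (induction I arbitrary: c i rule: finite_induct)
  case empty
  then show ?case by simp
next
  case (insert g F)
  note hom = insert.prems(1,2)
  have zeroF: "c f = \<zero>" if "f \<in> F" for f
  proof -
    obtain y where y: "y \<in> carrier R" "\<phi> f y \<noteq> \<phi> g y"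
      using insert.prems(4)[of f g] insert.hyps \<open>f \<in> F\<close> by auto
    have sum0: "(\<Oplus>i\<in>F. c i \<otimes> \<phi> i x) = \<ominus> (c g \<otimes> \<phi> g x)" if "x \<in> carrier R" for x
    proof -
      have "c g \<otimes> \<phi> g x \<oplus> (\<Oplus>i\<in>F. c i \<otimes> \<phi> i x) = \<zero>"
        using insert.prems(6)[OF that] insert.hyps insert.prems(5) hom(1) that by (simp add: Pi_def)
      moreover have "(\<Oplus>i\<in>F. c i \<otimes> \<phi> i x) \<in> carrier R"
        using insert.prems(5) hom(1) that by auto
      ultimately show ?thesis
        using insert.prems(5) hom(1) that by (metis insertI1 m_closed minus_equality a_comm)
    qed
    have "c f \<otimes> (\<phi> f y \<ominus> \<phi> g y) = \<zero>"
    \<comment> \<open>The shortened relation has these coefficients; at \<open>f\<close> the second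
      factor is nonzero by the choice of \<open>y\<close>.\<close>
    proof (rule insert.IH[of "\<lambda>i. c i \<otimes> (\<phi> i y \<ominus> \<phi> g y)"])
      fix x assume x: "x \<in> carrier R"
      have "(\<Oplus>i\<in>F. c i \<otimes> (\<phi> i y \<ominus> \<phi> g y) \<otimes> \<phi> i x) =
          (\<Oplus>i\<in>F. c i \<otimes> \<phi> i (y \<otimes> x) \<oplus> (\<ominus> \<phi> g y) \<otimes> (c i \<otimes> \<phi> i x))"
      proof (rule add.finprod_cong'[OF refl])
        fix i assume i: "i \<in> F"
        have c: "c i \<in> carrier R" "\<phi> i y \<in> carrier R" "\<phi> g y \<in> carrier R" "\<phi> i x \<in> carrier R"
          using i insert.prems(5) hom(1) x y by auto
        have m: "\<phi> i (y \<otimes> x) = \<phi> i y \<otimes> \<phi> i x" using hom(2)[of i] i x y by simp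
        show "c i \<otimes> (\<phi> i y \<ominus> \<phi> g y) \<otimes> \<phi> i x = c i \<otimes> \<phi> i (y \<otimes> x) \<oplus> (\<ominus> \<phi> g y) \<otimes> (c i \<otimes> \<phi> i x)"
          unfolding m using c by algebra
      qed (use insert.prems(5) hom x y in auto)
      also have "\<dots> = (\<Oplus>i\<in>F. c i \<otimes> \<phi> i (y \<otimes> x)) \<oplus> (\<ominus> \<phi> g y) \<otimes> (\<Oplus>i\<in>F. c i \<otimes> \<phi> i x)"
        using insert.prems(5) hom(1) x y insert.hyps(1)
        by (subst finsum_addf) (auto simp: finsum_rdistr Pi_def)
      also have "\<dots> = \<ominus> (c g \<otimes> (\<phi> g y \<otimes> \<phi> g x)) \<oplus> (\<ominus> \<phi> g y) \<otimes> (\<ominus> (c g \<otimes> \<phi> g x))"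
        using x y hom(2)[of g y x] by (simp add: sum0)
      also have "\<dots> = \<zero>"
      proof -
        have c: "c g \<in> carrier R" "\<phi> g y \<in> carrier R" "\<phi> g x \<in> carrier R"
          using insert.prems(5) hom(1) x y by auto
        then show ?thesis by algebra
      qed
      finally show "(\<Oplus>i\<in>F. c i \<otimes> (\<phi> i y \<ominus> \<phi> g y) \<otimes> \<phi> i x) = \<zero>" .
    qed (use insert.prems hom y that in auto)
    moreover have "\<phi> f y \<ominus> \<phi> g y \<noteq> \<zero>"
      using y hom(1)[of _ y] that by (auto simp: r_right_minus_eq)
    ultimately show ?thesis
      using integral[of "c f" "\<phi> f y \<ominus> \<phi> g y"] insert.prems(5) hom(1) y that by auto
  qed
  have "(\<Oplus>i\<in>F. c i \<otimes> \<phi> i \<one>) = \<zero>"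
    using zeroF hom(1) by (intro add.finprod_one_eqI) auto
  then have "c g = \<zero>"
    using insert.prems(6)[of \<one>] insert.hyps insert.prems(3,5) hom(1) by (simp add: Pi_def)
  with zeroF insert.prems(7) show ?case by auto
qed

section \<open>Cyclic Galois extensions\<close>

lemma galois_group_subgroup:
  assumes "ring L" "K \<subseteq> carrier L"
  shows "subgroup {g \<in> ring_iso L L \<inter> extensional (carrier L). \<forall>x\<in>K. g x = x} (BijGroup (carrier L))"
    (is "subgroup ?H _")
proof -
  interpret L: ring L by fact
  interpret B: group "BijGroup (carrier L)" by (rule group_BijGroup)
  have Bij: "g \<in> Bij (carrier L)" if "g \<in> ?H" for g
    using that by (auto simp: Bij_def ring_iso_def)
  show ?thesis
  proof
    show "?H \<subseteq> carrier (BijGroup (carrier L))"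
      using Bij by (auto simp: BijGroup_def)
  next
    fix x y assume xy: "x \<in> ?H" "y \<in> ?H"
    have "x \<circ> y \<in> ring_iso L L"
      by (rule ring_iso_set_trans) (use xy in auto)
    then have "compose (carrier L) x y \<in> ring_iso L L"
      by (rule L.ring_iso_restrict) (simp add: compose_def)
    then show "x \<otimes>\<^bsub>BijGroup (carrier L)\<^esub> y \<in> ?H"
      using xy Bij assms(2) by (auto simp: BijGroup_def compose_def)
  next
    show "\<one>\<^bsub>BijGroup (carrier L)\<^esub> \<in> ?H"
      using assms(2) L.ring_iso_restrict[OF ring_iso_set_refl, of "\<lambda>x\<in>carrier L. x"]
      by (auto simp: BijGroup_def)
  next
    fix x assume x: "x \<in> ?H"
    have inj: "inj_on x (carrier L)" using x by (auto simp: ring_iso_def bij_betw_def)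
    have "inv_into (carrier L) x \<in> ring_iso L L"
      by (rule ring_iso_set_sym[OF assms(1)]) (use x in auto)
    then have "restrict (inv_into (carrier L) x) (carrier L) \<in> ring_iso L L"
      by (rule L.ring_iso_restrict) simp
    moreover have "inv_into (carrier L) x k = k" if "k \<in> K" for k
      by (rule inv_into_f_eq[OF inj]) (use x that assms(2) in auto)
    ultimately show "inv\<^bsub>BijGroup (carrier L)\<^esub> x \<in> ?H"
      using assms(2) unfolding inv_BijGroup[OF Bij[OF x]] by (simp add: subset_iff)
  qed
qed

section \<open>Group powers of permutations as iterates\<close>

lemma mult_BijGroup: "f \<in> Bij S \<Longrightarrow> g \<in> Bij S \<Longrightarrow> f \<otimes>\<^bsub>BijGroup S\<^esub> g = compose S f g"
  by (simp add: BijGroup_def)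

lemma carrier_BijGroup: "carrier (BijGroup S) = Bij S"
  by (simp add: BijGroup_def)

lemma mult_BijGroup_apply:
  "f \<in> Bij S \<Longrightarrow> g \<in> Bij S \<Longrightarrow> x \<in> S \<Longrightarrow> (f \<otimes>\<^bsub>BijGroup S\<^esub> g) x = f (g x)"
  by (simp add: BijGroup_def compose_def)

lemma nat_pow_carrier_update: "x [^]\<^bsub>G\<lparr>carrier := A\<rparr>\<^esub> (k::nat) = x [^]\<^bsub>G\<^esub> k"
  by (simp add: nat_pow_def)

text \<open>The restriction is needed because elements of \<open>BijGroup\<close> are extensional
  while the iterate of an extensional function need not be, already for exponent 0.\<close>

lemma nat_pow_BijGroup:
  assumes "f \<in> Bij S"
  shows "f [^]\<^bsub>BijGroup S\<^esub> (k::nat) = restrict (f ^^ k) S"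
proof (induction k)
  case 0
  show ?case by (simp add: BijGroup_def restrict_def)
next
  case (Suc k)
  interpret group "BijGroup S" by (rule group_BijGroup)
  have f: "f \<in> carrier (BijGroup S)" using assms by (simp only: carrier_BijGroup)
  have "f [^]\<^bsub>BijGroup S\<^esub> k \<in> Bij S"
    using nat_pow_closed[OF f] by (simp only: carrier_BijGroup)
  then have "f [^]\<^bsub>BijGroup S\<^esub> Suc k = compose S (f [^]\<^bsub>BijGroup S\<^esub> k) f"
    unfolding nat_pow_Suc using assms by (rule mult_BijGroup)
  also note Suc
  finally have "f [^]\<^bsub>BijGroup S\<^esub> Suc k = compose S (restrict (f ^^ k) S) f" .
  moreover have "f x \<in> S" if "x \<in> S" for x
    using assms that Bij_imp_funcset by blast
  ultimately show ?case
    by (auto simp: compose_def fun_eq_iff funpow_Suc_right simp del: funpow.simps)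
qed

text \<open>Here \<open>q\<close> is only the degree of L over K, with no primality;
  \<open>ord_generator\<close> identifies it with the order of \<sigma>.\<close>

locale cyclic_galois_extension = field L for L :: "('a, 'b) ring_scheme" (structure) +
  fixes K :: "'a set" and \<sigma> :: "'a \<Rightarrow> 'a" and q :: nat
  assumes galois: "galois_extension L K"
    and char_zero: "char_zero (L\<lparr>carrier := K\<rparr>)"
    and dimension: "ring.dimension L q K (carrier L)"
    and generator: "\<sigma> \<in> carrier (galois_group L K)"
      "generate (galois_group L K) {\<sigma>} = carrier (galois_group L K)"
begin

lemma subfield_K: "subfield K L"
  using galois by (simp add: galois_extension_def)

lemma K_subset: "K \<subseteq> carrier L"
  using subfield_K by (rule subfieldE(3))

lemma group_galois_group: "group (galois_group L K)"
  unfolding galois_group_def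
  by (rule subgroup.subgroup_is_group[OF galois_group_subgroup[OF ring_axioms K_subset] group_BijGroup])

lemma carrier_galois_groupD:
  assumes "g \<in> carrier (galois_group L K)"
  shows "g \<in> Bij (carrier L)" "g \<in> ring_iso L L" "\<And>k. k \<in> K \<Longrightarrow> g k = k"
  using assms by (auto simp: galois_group_def Bij_def ring_iso_def)

lemma galois_group_mult_apply:
  assumes "g \<in> carrier (galois_group L K)" "h \<in> carrier (galois_group L K)" "x \<in> carrier L"
  shows "(g \<otimes>\<^bsub>galois_group L K\<^esub> h) x = g (h x)"
  using assms carrier_galois_groupD(1) mult_BijGroup_apply[of g "carrier L" h x]
  by (simp add: galois_group_def)

lemma galois_group_one_apply:
  "x \<in> carrier L \<Longrightarrow> \<one>\<^bsub>galois_group L K\<^esub> x = x"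
  by (simp add: galois_group_def BijGroup_def)

lemma pow_galois_group:
  assumes "g \<in> carrier (galois_group L K)"
  shows "g [^]\<^bsub>galois_group L K\<^esub> (k::nat) = restrict (g ^^ k) (carrier L)"
  using nat_pow_BijGroup[OF carrier_galois_groupD(1)[OF assms]]
  by (simp add: galois_group_def nat_pow_carrier_update)

lemma generator_closed [simp]: "x \<in> carrier L \<Longrightarrow> \<sigma> x \<in> carrier L"
  using carrier_galois_groupD(1)[OF generator(1)] Bij_imp_funcset by blast

lemma funpow_closed [simp]: "x \<in> carrier L \<Longrightarrow> (\<sigma> ^^ k) x \<in> carrier L"
  by (induction k) auto

lemma generator_mult [simp]: "x \<in> carrier L \<Longrightarrow> y \<in> carrier L \<Longrightarrow> \<sigma> (x \<otimes> y) = \<sigma> x \<otimes> \<sigma> y"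
  using carrier_galois_groupD(2)[OF generator(1)] by (auto simp: ring_iso_def ring_hom_mult)

lemma generator_add [simp]: "x \<in> carrier L \<Longrightarrow> y \<in> carrier L \<Longrightarrow> \<sigma> (x \<oplus> y) = \<sigma> x \<oplus> \<sigma> y"
  using carrier_galois_groupD(2)[OF generator(1)] by (auto simp: ring_iso_def ring_hom_add)

lemma generator_one [simp]: "\<sigma> \<one> = \<one>"
  using carrier_galois_groupD(2)[OF generator(1)] by (auto simp: ring_iso_def ring_hom_one)

lemma generator_K [simp]: "k \<in> K \<Longrightarrow> \<sigma> k = k"
  using carrier_galois_groupD(3)[OF generator(1)] .

lemma generator_zero [simp]: "\<sigma> \<zero> = \<zero>"
  using generator_K subfield_K by (simp add: subringE(2) subfieldE(1))

lemma generator_inj: "inj_on \<sigma> (carrier L)"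
  using carrier_galois_groupD(1)[OF generator(1)] by (auto simp: Bij_def bij_betw_def)

lemma funpow_mult [simp]: "x \<in> carrier L \<Longrightarrow> y \<in> carrier L \<Longrightarrow> (\<sigma> ^^ k) (x \<otimes> y) = (\<sigma> ^^ k) x \<otimes> (\<sigma> ^^ k) y"
  by (induction k) auto

lemma funpow_add_hom [simp]: "x \<in> carrier L \<Longrightarrow> y \<in> carrier L \<Longrightarrow> (\<sigma> ^^ k) (x \<oplus> y) = (\<sigma> ^^ k) x \<oplus> (\<sigma> ^^ k) y"
  by (induction k) auto

lemma funpow_one [simp]: "(\<sigma> ^^ k) \<one> = \<one>"
  by (induction k) auto

lemma funpow_K [simp]: "a \<in> K \<Longrightarrow> (\<sigma> ^^ k) a = a"
  by (induction k) auto

lemma funpow_zero [simp]: "(\<sigma> ^^ k) \<zero> = \<zero>"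
  by (induction k) auto

lemma funpow_finsum:
  assumes "\<And>i. i \<in> I \<Longrightarrow> f i \<in> carrier L"
  shows "(\<sigma> ^^ k) (\<Oplus>i\<in>I. f i) = (\<Oplus>i\<in>I. (\<sigma> ^^ k) (f i))"
  using assms by (induction I rule: infinite_finite_induct) (auto simp: Pi_def)

text \<open>Translates distinctness of group powers into distinctness of characters on the carrier,
  as independence requires.\<close>

lemma funpow_cong_generator_pow:
  "(\<forall>x\<in>carrier L. (\<sigma> ^^ i) x = (\<sigma> ^^ j) x) \<longleftrightarrow>
    \<sigma> [^]\<^bsub>galois_group L K\<^esub> i = \<sigma> [^]\<^bsub>galois_group L K\<^esub> j"
  unfolding pow_galois_group[OF generator(1)] by (auto simp: fun_eq_iff restrict_def)

lemma dedekind_funpow: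
  assumes "finite I" and inj: "inj_on (\<lambda>i. \<sigma> [^]\<^bsub>galois_group L K\<^esub> i) I"
    and "\<And>i. i \<in> I \<Longrightarrow> c i \<in> carrier L"
    and "\<And>x. x \<in> carrier L \<Longrightarrow> (\<Oplus>i\<in>I. c i \<otimes> (\<sigma> ^^ i) x) = \<zero>"
    and "i \<in> I"
  shows "c i = \<zero>"
proof (rule dedekind_independence[where \<phi> = "\<lambda>i. \<sigma> ^^ i", OF assms(1)])
  fix i j assume "i \<in> I" "j \<in> I" "i \<noteq> j"
  then show "\<exists>x\<in>carrier L. (\<sigma> ^^ i) x \<noteq> (\<sigma> ^^ j) x"
    using inj funpow_cong_generator_pow[of i j] by (auto simp: inj_on_def)
qed (use assms in auto)

text \<open>The stabilizer of \<open>x\<close> is a subgroup containing the generator, hence all of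
  G, and the fixed field of G is K.\<close>

lemma fixed_in_K:
  assumes "x \<in> carrier L" "\<sigma> x = x"
  shows "x \<in> K"
proof -
  interpret G: group "galois_group L K" by (rule group_galois_group)
  have "subgroup {g \<in> carrier (galois_group L K). g x = x} (galois_group L K)" (is "subgroup ?S _")
  proof
    fix g h assume "g \<in> ?S" "h \<in> ?S"
    then show "g \<otimes>\<^bsub>galois_group L K\<^esub> h \<in> ?S"
      using assms by (simp add: galois_group_mult_apply)
  next
    show "\<one>\<^bsub>galois_group L K\<^esub> \<in> ?S"
      using assms by (simp add: galois_group_one_apply)
  next
    fix g assume g: "g \<in> ?S"
    then have "(inv\<^bsub>galois_group L K\<^esub> g) x = (inv\<^bsub>galois_group L K\<^esub> g \<otimes>\<^bsub>galois_group L K\<^esub> g) x"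
      using assms by (subst galois_group_mult_apply) auto
    also have "\<dots> = x"
      using g assms by (simp add: galois_group_one_apply)
    finally show "inv\<^bsub>galois_group L K\<^esub> g \<in> ?S" using g by simp
  qed auto
  then have "generate (galois_group L K) {\<sigma>} \<subseteq> {g \<in> carrier (galois_group L K). g x = x}"
    using assms generator(1) by (intro G.generate_subgroup_incl) auto
  then show ?thesis
    using galois assms(1) unfolding galois_extension_def generator(2) by blast
qed


section \<open>The order of the generator equals the degree\<close>

lemma Span_induct_pred:
  assumes "set Us \<subseteq> carrier L" "P \<zero>" "\<And>x y. x \<in> carrier L \<Longrightarrow> y \<in> carrier L \<Longrightarrow> P x \<Longrightarrow> P y \<Longrightarrow> P (x \<oplus> y)"
    and "\<And>k u. k \<in> K \<Longrightarrow> u \<in> set Us \<Longrightarrow> P (k \<otimes> u)"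
    and "x \<in> Span K Us"
  shows "P x"
  using assms(1,4,5)
proof (induction Us arbitrary: x)
  case Nil
  then show ?case using assms(2) by simp
next
  case (Cons u Us)
  obtain k v where kv: "k \<in> K" "v \<in> Span K Us" "x = k \<otimes> u \<oplus> v"
    using Cons.prems(3) by (auto simp: line_extension_mem_iff)
  have "v \<in> carrier L"
    using kv(2) Cons.prems(1) Span_subgroup_props(1)[OF subfield_K, of Us] by auto
  moreover have "P v" using Cons kv(2) by simp
  ultimately show ?case
    using kv Cons.prems(1,2) K_subset by (auto intro!: assms(3))
qed

text \<open>Bridge from list-based linear combinations, in which linear independence is phrased, to
  indexed sums.\<close>

lemma combine_map_upt:
  assumes "set Us \<subseteq> carrier L" "\<And>j. f j \<in> carrier L"
  shows "combine (map f [0..<length Us]) Us = (\<Oplus>j\<in>{..<length Us}. f j \<otimes> Us ! j)"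
  using assms
proof (induction Us arbitrary: f)
  case Nil
  then show ?case by simp
next
  case (Cons u Us)
  have c: "Us ! j \<in> carrier L" if "j < length Us" for j
    using Cons.prems that by auto
  have set: "{..<length (u # Us)} = insert 0 (Suc ` {..<length Us})"
    by (simp add: lessThan_Suc_eq_insert_0)
  have "(\<Oplus>j\<in>{..<length (u # Us)}. f j \<otimes> (u # Us) ! j) =
      f 0 \<otimes> u \<oplus> (\<Oplus>j\<in>Suc ` {..<length Us}. f j \<otimes> (u # Us) ! j)"
    unfolding set using Cons.prems c by (subst finsum_insert) auto
  also have "(\<Oplus>j\<in>Suc ` {..<length Us}. f j \<otimes> (u # Us) ! j) = (\<Oplus>j\<in>{..<length Us}. f (Suc j) \<otimes> Us ! j)"
    using Cons.prems c by (subst finsum_reindex) auto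
  also have "\<dots> = combine (map (\<lambda>j. f (Suc j)) [0..<length Us]) Us"
    using Cons by simp
  also have "f 0 \<otimes> u \<oplus> \<dots> = combine (map f [0..<length (u # Us)]) (u # Us)"
    by (simp add: upt_conv_Cons map_Suc_upt[symmetric] comp_def del: upt_Suc)
  finally show ?case by simp
qed

text \<open>With more than \<open>q\<close> distinct powers, the \<open>q\<close> equations obtained
  from a basis have a nontrivial solution \<open>c\<close>. By K-linearity of \<sigma> the relation
  extends from the basis to L, against independence of characters.\<close>

lemma distinct_powers_le_dimension:
  assumes "inj_on (\<lambda>i::nat. \<sigma> [^]\<^bsub>galois_group L K\<^esub> i) {..<k}"
  shows "k \<le> q"
proof (rule ccontr)
  assume "\<not> k \<le> q"
  obtain Vs where Vs: "set Vs \<subseteq> carrier L" "length Vs = q" "Span K Vs = carrier L"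
    using exists_base[OF subfield_K dimension] by blast
  have Vsc: "Vs ! i \<in> carrier L" if "i < q" for i
    using Vs(1,2) that by auto
  obtain c where c: "\<And>j. j \<in> {..<k} \<Longrightarrow> c j \<in> carrier L" "\<exists>j\<in>{..<k}. c j \<noteq> \<zero>"
    "\<And>i. i < q \<Longrightarrow> (\<Oplus>j\<in>{..<k}. (\<sigma> ^^ j) (Vs ! i) \<otimes> c j) = \<zero>"
    using \<open>\<not> k \<le> q\<close> Vsc
    by (rule_tac homogeneous_system_nontrivial_solution[of "{..<k}" q "\<lambda>i j. (\<sigma> ^^ j) (Vs ! i)"]) auto
  have rel: "(\<Oplus>j\<in>{..<k}. c j \<otimes> (\<sigma> ^^ j) x) = \<zero>" if "x \<in> carrier L" for x
  proof (rule Span_induct_pred[where Us = Vs and P = "\<lambda>x. (\<Oplus>j\<in>{..<k}. c j \<otimes> (\<sigma> ^^ j) x) = \<zero>"])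
    show "(\<Oplus>j\<in>{..<k}. c j \<otimes> (\<sigma> ^^ j) \<zero>) = \<zero>"
      using c(1) by (intro add.finprod_one_eqI) auto
  next
    fix x y assume xy: "x \<in> carrier L" "y \<in> carrier L"
      "(\<Oplus>j\<in>{..<k}. c j \<otimes> (\<sigma> ^^ j) x) = \<zero>" "(\<Oplus>j\<in>{..<k}. c j \<otimes> (\<sigma> ^^ j) y) = \<zero>"
    have "(\<Oplus>j\<in>{..<k}. c j \<otimes> (\<sigma> ^^ j) (x \<oplus> y)) =
        (\<Oplus>j\<in>{..<k}. c j \<otimes> (\<sigma> ^^ j) x \<oplus> c j \<otimes> (\<sigma> ^^ j) y)"
      using c(1) xy by (intro add.finprod_cong') (auto simp: r_distr)
    also have "\<dots> = \<zero>"
      using c(1) xy by (subst finsum_addf) auto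
    finally show "(\<Oplus>j\<in>{..<k}. c j \<otimes> (\<sigma> ^^ j) (x \<oplus> y)) = \<zero>" .
  next
    fix a u assume a: "a \<in> K" and "u \<in> set Vs"
    then obtain i where i: "i < q" "u = Vs ! i" using Vs(2) by (metis in_set_conv_nth)
    have u: "u \<in> carrier L" "a \<in> carrier L" using a \<open>u \<in> set Vs\<close> Vs(1) K_subset by auto
    have "(\<Oplus>j\<in>{..<k}. c j \<otimes> (\<sigma> ^^ j) (a \<otimes> u)) = (\<Oplus>j\<in>{..<k}. a \<otimes> ((\<sigma> ^^ j) u \<otimes> c j))"
      using c(1) u a by (intro add.finprod_cong') (auto simp: m_ac)
    also have "\<dots> = a \<otimes> (\<Oplus>j\<in>{..<k}. (\<sigma> ^^ j) u \<otimes> c j)"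
      using c(1) u by (subst finsum_rdistr) auto
    also have "\<dots> = \<zero>" using c(3)[of i] i u by simp
    finally show "(\<Oplus>j\<in>{..<k}. c j \<otimes> (\<sigma> ^^ j) (a \<otimes> u)) = \<zero>" .
  qed (use Vs that in auto)
  have "c j = \<zero>" if "j \<in> {..<k}" for j
    by (rule dedekind_funpow[OF _ assms _ rel]) (use c(1) that in auto)
  with c(2) show False by blast
qed

end

lemma (in abelian_monoid) finsum_reindex_bij:
  assumes "bij_betw h A B" "\<And>b. b \<in> B \<Longrightarrow> f b \<in> carrier G"
  shows "(\<Oplus>a\<in>A. f (h a)) = (\<Oplus>b\<in>B. f b)"
  using assms finsum_reindex[of f h A] by (auto simp: bij_betw_def Pi_def)

lemma bij_betw_Suc_mod: "bij_betw (\<lambda>i. Suc i mod m) {..<m} {..<m}"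
proof (cases "m = 0")
  case False
  have "inj_on (\<lambda>i. Suc i mod m) {..<m}"
    by (auto simp: inj_on_def mod_Suc split: if_splits)
  moreover have "(\<lambda>i. Suc i mod m) ` {..<m} \<subseteq> {..<m}" using False by auto
  ultimately show ?thesis
    by (simp add: bij_betw_def endo_inj_surj)
qed auto

context cyclic_galois_extension
begin

lemma of_nat_neq_zero:
  assumes "(m::nat) > 0"
  shows "add_pow L m \<one> \<noteq> \<zero>"
  using char_zero assms unfolding char_zero_def add_pow_def nat_pow_def by simp

text \<open>The value 0 of \<open>ord\<close> encodes infinite order, which would give more than
  \<open>q\<close> distinct powers.\<close>

lemma ord_generator_pos: "group.ord (galois_group L K) \<sigma> \<noteq> 0"
proof
  interpret G: group "galois_group L K" by (rule group_galois_group)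
  assume "G.ord \<sigma> = 0"
  then have "inj_on (\<lambda>i::nat. \<sigma> [^]\<^bsub>galois_group L K\<^esub> i) {..<Suc q}"
    using G.ord_eq_0[OF generator(1)] G.pow_eq_div2[OF generator(1)]
    by (intro linorder_inj_onI') (metis nat_less_le zero_less_diff)
  from distinct_powers_le_dimension[OF this] show False by simp
qed

text \<open>Artin's argument: a relation with some coefficient \<open>1\<close> among all conjugates of a basis can be
  averaged to one over \<open>K\<close>, and the trace of \<open>1\<close> does not vanish in characteristic zero.\<close>

lemma dimension_le_ord_generator: "q \<le> group.ord (galois_group L K) \<sigma>"
proof (rule ccontr)
  interpret G: group "galois_group L K" by (rule group_galois_group)
  define m where "m = G.ord \<sigma>"
  assume "\<not> q \<le> G.ord \<sigma>"
  then have mq: "m < q" by (simp add: m_def)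
  have m0: "m > 0" using ord_generator_pos by (simp add: m_def)
  have per: "(\<sigma> ^^ m) x = x" if "x \<in> carrier L" for x
    using funpow_cong_generator_pow[of m 0] G.pow_ord_eq_1[OF generator(1)] that by (simp add: m_def)
  obtain Vs where Vs: "set Vs \<subseteq> carrier L" "independent K Vs" "length Vs = q"
    using exists_base[OF subfield_K dimension] by blast
  have Vsc: "Vs ! i \<in> carrier L" if "i < q" for i
    using Vs(1,3) that by auto
  \<comment> \<open>The exponents \<open>m - i\<close> are chosen so that applying \<sigma>^i to
    equation \<open>i\<close> returns the basis vectors to themselves (\<sigma>^m is the identity)
    and moves \<sigma>^i onto the coefficients.\<close>
  obtain x where x: "\<And>j. j \<in> {..<q} \<Longrightarrow> x j \<in> carrier L" "\<exists>j\<in>{..<q}. x j \<noteq> \<zero>"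
    "\<And>i. i < m \<Longrightarrow> (\<Oplus>j\<in>{..<q}. (\<sigma> ^^ (m - i)) (Vs ! j) \<otimes> x j) = \<zero>"
    using mq Vsc
    by (rule_tac homogeneous_system_nontrivial_solution[of "{..<q}" m "\<lambda>i j. (\<sigma> ^^ (m - i)) (Vs ! j)"]) auto
  obtain l where l: "l < q" "x l \<noteq> \<zero>" using x(2) by auto
  \<comment> \<open>Scaling makes the coefficient at \<open>l\<close> equal to 1, whose trace is m
    times 1. The value 0 beyond \<open>q\<close> keeps \<open>y\<close> inside the carrier for every
    index.\<close>
  define y where "y = (\<lambda>j. if j < q then inv (x l) \<otimes> x j else \<zero>)"
  have il: "inv (x l) \<in> carrier L" "inv (x l) \<otimes> x l = \<one>"
    using l x(1) by (auto simp: field_Units)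
  have yc: "y j \<in> carrier L" for j using x(1) il by (auto simp: y_def)
  have yl: "y l = \<one>" using il l by (simp add: y_def)
  have rel: "(\<Oplus>j\<in>{..<q}. (\<sigma> ^^ i) (y j) \<otimes> Vs ! j) = \<zero>" if "i < m" for i
  proof -
    have "(\<Oplus>j\<in>{..<q}. (\<sigma> ^^ (m - i)) (Vs ! j) \<otimes> y j) =
        (\<Oplus>j\<in>{..<q}. inv (x l) \<otimes> ((\<sigma> ^^ (m - i)) (Vs ! j) \<otimes> x j))"
      using x(1) il Vsc by (intro add.finprod_cong') (auto simp: y_def m_lcomm)
    also have "\<dots> = inv (x l) \<otimes> (\<Oplus>j\<in>{..<q}. (\<sigma> ^^ (m - i)) (Vs ! j) \<otimes> x j)"
      using x(1) il Vsc by (subst finsum_rdistr) auto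
    also have "\<dots> = \<zero>" using x(3)[OF that] il by simp
    finally have "\<zero> = (\<sigma> ^^ i) (\<Oplus>j\<in>{..<q}. (\<sigma> ^^ (m - i)) (Vs ! j) \<otimes> y j)" by simp
    also have "\<dots> = (\<Oplus>j\<in>{..<q}. (\<sigma> ^^ i) ((\<sigma> ^^ (m - i)) (Vs ! j) \<otimes> y j))"
      using yc Vsc by (intro funpow_finsum) auto
    also have "\<dots> = (\<Oplus>j\<in>{..<q}. (\<sigma> ^^ i) (y j) \<otimes> Vs ! j)"
    proof (intro add.finprod_cong' refl)
      fix j assume "j \<in> {..<q}"
      then have c: "Vs ! j \<in> carrier L" using Vsc by simp
      have "(\<sigma> ^^ i) ((\<sigma> ^^ (m - i)) (Vs ! j)) = (\<sigma> ^^ (i + (m - i))) (Vs ! j)"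
        by (simp only: funpow_add comp_apply)
      then have "(\<sigma> ^^ i) ((\<sigma> ^^ (m - i)) (Vs ! j)) = (\<sigma> ^^ m) (Vs ! j)"
        using that by simp
      then show "(\<sigma> ^^ i) ((\<sigma> ^^ (m - i)) (Vs ! j) \<otimes> y j) = (\<sigma> ^^ i) (y j) \<otimes> Vs ! j"
        using c yc[of j] per by (simp add: m_comm)
    qed (use yc Vsc in auto)
    finally show ?thesis by simp
  qed
  define tr where "tr = (\<lambda>z. \<Oplus>i\<in>{..<m}. (\<sigma> ^^ i) z)"
  have trK: "tr (y j) \<in> K" for j
  proof (rule fixed_in_K)
    have "\<sigma> (tr (y j)) = (\<sigma> ^^ 1) (tr (y j))" by simp
    also have "\<dots> = (\<Oplus>i\<in>{..<m}. (\<sigma> ^^ 1) ((\<sigma> ^^ i) (y j)))"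
      unfolding tr_def using yc by (intro funpow_finsum) auto
    also have "\<dots> = (\<Oplus>i\<in>{..<m}. (\<sigma> ^^ (Suc i mod m)) (y j))"
      using yc[of j] per[OF yc[of j]] by (intro add.finprod_cong') (auto simp: mod_Suc)
    also have "\<dots> = tr (y j)"
      unfolding tr_def using yc by (intro finsum_reindex_bij bij_betw_Suc_mod) auto
    finally show "\<sigma> (tr (y j)) = tr (y j)" .
  qed (use yc in \<open>auto simp: tr_def\<close>)
  have "\<zero> = (\<Oplus>i\<in>{..<m}. \<Oplus>j\<in>{..<q}. (\<sigma> ^^ i) (y j) \<otimes> Vs ! j)"
    using rel by (intro add.finprod_one_eqI[symmetric]) auto
  also have "\<dots> = (\<Oplus>j\<in>{..<q}. \<Oplus>i\<in>{..<m}. (\<sigma> ^^ i) (y j) \<otimes> Vs ! j)"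
    using yc Vsc by (intro finsum_swap) auto
  also have "\<dots> = (\<Oplus>j\<in>{..<q}. tr (y j) \<otimes> Vs ! j)"
    unfolding tr_def using yc Vsc by (intro add.finprod_cong') (auto simp: finsum_ldistr)
  also have "\<dots> = combine (map (\<lambda>j. tr (y j)) [0..<q]) Vs"
    using combine_map_upt[OF Vs(1), of "\<lambda>j. tr (y j)"] subsetD[OF K_subset trK] Vs(3) by simp
  finally have "set (take (length Vs) (map (\<lambda>j. tr (y j)) [0..<q])) \<subseteq> {\<zero>}"
    using trK by (intro independent_imp_trivial_combine[OF subfield_K Vs(2)]) auto
  then have "tr (y l) = \<zero>" using l Vs(3) by (auto simp: image_subset_iff)
  moreover have "tr (y l) = add_pow L m \<one>"
    by (simp add: tr_def yl add.finprod_const)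
  ultimately show False using of_nat_neq_zero[OF m0] by simp
qed

lemma ord_generator: "group.ord (galois_group L K) \<sigma> = q"
proof (rule antisym)
  interpret G: group "galois_group L K" by (rule group_galois_group)
  have "inj_on (\<lambda>i::nat. \<sigma> [^]\<^bsub>galois_group L K\<^esub> i) {..<G.ord \<sigma>}"
    using G.ord_inj[OF generator(1)] by (rule inj_on_subset) auto
  then show "G.ord \<sigma> \<le> q" by (rule distinct_powers_le_dimension)
qed (rule dimension_le_ord_generator)

lemma q_pos: "q > 0"
  using ord_generator ord_generator_pos by simp

lemma carrier_galois_group_eq: "carrier (galois_group L K) = {\<sigma> [^]\<^bsub>galois_group L K\<^esub> k | k::nat. True}"
proof -
  interpret G: group "galois_group L K" by (rule group_galois_group)
  show ?thesis
    using G.generate_pow_nat[OF generator(1) ord_generator_pos] generator(2) by simp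
qed

lemma funpow_period: "x \<in> carrier L \<Longrightarrow> (\<sigma> ^^ q) x = x"
proof -
  interpret G: group "galois_group L K" by (rule group_galois_group)
  show "x \<in> carrier L \<Longrightarrow> (\<sigma> ^^ q) x = x"
    using funpow_cong_generator_pow[of q 0] G.pow_ord_eq_1[OF generator(1)] by (simp add: ord_generator)
qed

lemma dedekind_generator:
  assumes "\<And>i. i < q \<Longrightarrow> c i \<in> carrier L"
    and "\<And>x. x \<in> carrier L \<Longrightarrow> (\<Oplus>i\<in>{..<q}. c i \<otimes> (\<sigma> ^^ i) x) = \<zero>"
    and "i < q"
  shows "c i = \<zero>"
proof (rule dedekind_funpow)
  interpret G: group "galois_group L K" by (rule group_galois_group)
  show "inj_on (\<lambda>i::nat. \<sigma> [^]\<^bsub>galois_group L K\<^esub> i) {..<q}"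
    using G.ord_inj[OF generator(1)] unfolding ord_generator by (rule inj_on_subset) auto
qed (use assms in auto)

end

section \<open>Twisted function algebras\<close>

text \<open>Since \<open>y\<close> may be a zero divisor modulo \<open>q\<close>, it cannot be
  cancelled. Instead the factors u^i are exchanged for u^k one at a time, each exchange using the
  copy of \<open>y\<close> in the product.\<close>

lemma cong_power_power_mult:
  fixes u q :: nat
  assumes "[u ^ i * y = u ^ k * y] (mod q)"
  shows "[(u ^ t) ^ i * y = (u ^ t) ^ k * y] (mod q)"
proof -
  have "[(u ^ i) ^ t * y = (u ^ k) ^ t * y] (mod q)"
  proof (induction t)
    case (Suc t)
    have "[(u ^ i) ^ t * (u ^ i * y) = (u ^ i) ^ t * (u ^ k * y)] (mod q)"
      using assms by (rule cong_scalar_left)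
    also have "(u ^ i) ^ t * (u ^ k * y) = u ^ k * ((u ^ i) ^ t * y)" by (simp add: ac_simps)
    also have "[\<dots> = u ^ k * ((u ^ k) ^ t * y)] (mod q)"
      using Suc by (rule cong_scalar_left)
    finally show ?case by (simp add: ac_simps)
  qed simp
  then show ?thesis by (simp add: mult.commute flip: power_mult)
qed

text \<open>If \<open>v\<close> is a power of \<open>u\<close>, then v^i y depends only on the
  residue of u^i y. This makes the permutation below independent of the chosen exponents, and the
  symmetric use gives injectivity.\<close>

lemma cong_power_power_mult':
  fixes u q :: nat
  assumes "[u ^ i * y = u ^ k * y] (mod q)" "[v = u ^ t] (mod q)"
  shows "[v ^ i * y = v ^ k * y] (mod q)"
proof -
  have *: "[v ^ i * y = (u ^ t) ^ i * y] (mod q)" for i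
    using assms(2) by (intro cong_mult cong_pow cong_refl)
  from cong_trans[OF *[of i] cong_trans[OF cong_power_power_mult[OF assms(1)] cong_sym[OF *[of k]]]]
  show ?thesis .
qed

text \<open>Multiplication by \<open>u\<close> and by \<open>v\<close> have the same orbits on the residues modulo \<open>q\<close>, and
  \<open>\<pi>\<close> sends \<open>u\<^sup>i y\<close> to \<open>v\<^sup>i y\<close> for a fixed representative \<open>y\<close> of each orbit.\<close>

lemma intertwining_permutation:
  fixes u v q t t' m :: nat
  assumes q: "q > 0" and vu: "[v = u ^ t] (mod q)" and uv: "[u = v ^ t'] (mod q)"
    and m: "[u ^ Suc m = 1] (mod q)"
  obtains \<pi> where "bij_betw \<pi> {..<q} {..<q}" "\<And>j. \<pi> (j mod q) = \<pi> j"
    "\<And>j. [\<pi> (u * j) = v * \<pi> j] (mod q)"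
proof -
  define orb where "orb = (\<lambda>x. {y. \<exists>i. [y = u ^ i * x] (mod q)})"
  have orb_cong: "orb x = orb y" if "[x = y] (mod q)" for x y
    unfolding orb_def using that cong_scalar_left cong_sym cong_trans by (metis (no_types, lifting))
  have orb_step: "orb (u * x) = orb x" for x
  proof -
    have "y \<in> orb x" if y: "y \<in> orb (u * x)" for y
    proof -
      obtain i where "[y = u ^ i * (u * x)] (mod q)" using y by (auto simp: orb_def)
      then have "[y = u ^ Suc i * x] (mod q)" by (simp add: ac_simps)
      then show ?thesis by (auto simp: orb_def simp del: power_Suc)
    qed
    moreover have "y \<in> orb (u * x)" if y: "y \<in> orb x" for y
    proof -
      obtain i where i: "[y = u ^ i * x] (mod q)" using y by (auto simp: orb_def)
      \<comment> \<open>The power u^m is inverse to \<open>u\<close>, so forward orbits are closed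
        under going back.\<close>
      have "[u ^ (i + m) * (u * x) = u ^ i * x] (mod q)"
        using cong_scalar_right[OF m, of "u ^ i * x"] by (simp add: power_add ac_simps)
      with i have "[y = u ^ (i + m) * (u * x)] (mod q)" using cong_sym cong_trans by blast
      then show ?thesis by (auto simp: orb_def)
    qed
    ultimately show ?thesis by blast
  qed
  have orb_pow: "orb (u ^ i * x) = orb x" for i x
    by (induction i) (auto simp: orb_step mult.assoc)
  have orb_eq: "orb y = orb x" if y: "y \<in> orb x" for x y
  proof -
    obtain i where "[y = u ^ i * x] (mod q)" using y by (auto simp: orb_def)
    then show ?thesis using orb_cong orb_pow by metis
  qed
  have orb_self: "x \<in> orb x" for x
    unfolding orb_def by (rule CollectI, rule exI[of _ 0]) simp
  define rep where "rep = (\<lambda>x. LEAST y. y \<in> orb x)"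
  have rep: "rep x \<in> orb x" for x
    unfolding rep_def using orb_self[of x] by (rule LeastI)
  have "\<exists>i. [x = u ^ i * rep x] (mod q)" for x
    using orb_self[of x] orb_eq[OF rep[of x]] by (auto simp: orb_def)
  then obtain idx0 where idx0: "\<And>x. [x = u ^ idx0 x * rep x] (mod q)" by metis
  \<comment> \<open>Reducing the argument first makes \<pi> periodic as a function, not only up to
    congruence of its values.\<close>
  define idx where "idx = (\<lambda>x. idx0 (x mod q))"
  have rep_cong: "rep x = rep y" if "orb x = orb y" for x y using that by (simp add: rep_def)
  have rep_mod: "rep (x mod q) = rep x" for x
    by (rule rep_cong, rule orb_cong) (simp add: cong_def)
  have idx: "[x = u ^ idx x * rep x] (mod q)" for x
    using idx0[of "x mod q"] by (simp add: rep_mod idx_def cong_def)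
  define \<pi> where "\<pi> = (\<lambda>x. v ^ idx x * rep x mod q)"
  have \<pi>_mod: "\<pi> (j mod q) = \<pi> j" for j
    by (simp add: \<pi>_def rep_mod idx_def)
  have \<pi>_cong: "[\<pi> x = v ^ idx x * rep x] (mod q)" for x
    by (simp add: \<pi>_def)
  have step: "[\<pi> (u * j) = v * \<pi> j] (mod q)" for j
  proof -
    have r: "rep (u * j) = rep j" by (rule rep_cong, rule orb_step)
    have "[u ^ idx (u * j) * rep j = u * j] (mod q)"
      using idx[of "u * j"] r cong_sym by simp
    also have "[u * j = u * (u ^ idx j * rep j)] (mod q)"
      using idx[of j] by (rule cong_scalar_left)
    also have "u * (u ^ idx j * rep j) = u ^ Suc (idx j) * rep j" by (simp add: ac_simps)
    finally have "[v ^ idx (u * j) * rep j = v ^ Suc (idx j) * rep j] (mod q)"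
      using vu by (rule cong_power_power_mult')
    with \<pi>_cong[of "u * j"] have "[\<pi> (u * j) = v * (v ^ idx j * rep j)] (mod q)"
      unfolding r by (simp add: ac_simps cong_def)
    with cong_scalar_left[OF \<pi>_cong[of j], of v] show ?thesis
      using cong_sym cong_trans by blast
  qed
  have "inj_on \<pi> {..<q}"
  proof
    fix x y assume xy: "x \<in> {..<q}" "y \<in> {..<q}" "\<pi> x = \<pi> y"
    \<comment> \<open>As \<open>v\<close> is a power of \<open>u\<close>, \<pi> preserves each
      orbit. Equal images therefore share a representative, and the exponents can be compared over
      it.\<close>
    have "\<pi> z \<in> orb z" for z
    proof -
      have "[v ^ idx z * rep z = (u ^ t) ^ idx z * rep z] (mod q)"
        using vu by (intro cong_mult cong_pow cong_refl)
      with \<pi>_cong[of z] have "[\<pi> z = u ^ (t * idx z) * rep z] (mod q)"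
        using cong_trans by (simp add: power_mult) blast
      then have "\<pi> z \<in> orb (rep z)" by (auto simp: orb_def)
      then show ?thesis using orb_eq[OF rep] by simp
    qed
    then have "orb x = orb y" using xy(3) orb_eq by metis
    then have r: "rep x = rep y" by (rule rep_cong)
    have "[v ^ idx x * rep x = v ^ idx y * rep x] (mod q)"
      using xy(3) by (simp add: \<pi>_def r cong_def)
    then have "[u ^ idx x * rep x = u ^ idx y * rep x] (mod q)"
      using uv by (rule cong_power_power_mult')
    then have "[x = y] (mod q)"
      using idx[of x] idx[of y] by (simp add: r cong_def)
    then show "x = y" using xy by (simp add: cong_def)
  qed
  moreover have "\<pi> ` {..<q} \<subseteq> {..<q}" using q by (auto simp: \<pi>_def)
  ultimately have "bij_betw \<pi> {..<q} {..<q}" by (simp add: bij_betw_def endo_inj_surj)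
  then show thesis using \<pi>_mod step by (rule that)
qed

section \<open>Algebra isomorphism as an equivalence relation\<close>

lemma algebra_isomorphic_refl: "algebra_isomorphic K A A"
  unfolding algebra_isomorphic_def by (rule bexI[OF _ ring_iso_set_refl]) simp

lemma algebra_isomorphic_trans:
  assumes "algebra_isomorphic K A B" "algebra_isomorphic K B C"
  shows "algebra_isomorphic K A C"
proof -
  obtain f g where f: "f \<in> ring_iso A B" "\<forall>k\<in>K. \<forall>x\<in>carrier A. f (k \<odot>\<^bsub>A\<^esub> x) = k \<odot>\<^bsub>B\<^esub> f x"
    and g: "g \<in> ring_iso B C" "\<forall>k\<in>K. \<forall>x\<in>carrier B. g (k \<odot>\<^bsub>B\<^esub> x) = k \<odot>\<^bsub>C\<^esub> g x"
    using assms unfolding algebra_isomorphic_def by blast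
  show ?thesis
    unfolding algebra_isomorphic_def
    using f g ring_iso_memE(1)[OF f(1)]
    by (intro bexI[OF _ ring_iso_set_trans[OF f(1) g(1)]]) auto
qed

text \<open>The closure assumptions stand in for a ring structure on \<open>A\<close>: they put
  sums, products and multiples of preimages into the set on which \<open>f\<close> is
  injective.\<close>

lemma algebra_isomorphic_sym:
  assumes "algebra_isomorphic K A B"
    and closed: "\<And>x y. x \<in> carrier A \<Longrightarrow> y \<in> carrier A \<Longrightarrow> x \<otimes>\<^bsub>A\<^esub> y \<in> carrier A"
      "\<And>x y. x \<in> carrier A \<Longrightarrow> y \<in> carrier A \<Longrightarrow> x \<oplus>\<^bsub>A\<^esub> y \<in> carrier A"
      "\<one>\<^bsub>A\<^esub> \<in> carrier A"
      "\<And>k x. k \<in> K \<Longrightarrow> x \<in> carrier A \<Longrightarrow> k \<odot>\<^bsub>A\<^esub> x \<in> carrier A"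
  shows "algebra_isomorphic K B A"
proof -
  obtain f where f: "f \<in> ring_iso A B" "\<And>k x. k \<in> K \<Longrightarrow> x \<in> carrier A \<Longrightarrow> f (k \<odot>\<^bsub>A\<^esub> x) = k \<odot>\<^bsub>B\<^esub> f x"
    using assms(1) unfolding algebra_isomorphic_def by blast
  note h = ring_iso_memE[OF f(1)]
  define g where "g = inv_into (carrier A) f"
  have inj: "inj_on f (carrier A)" and surj: "f ` carrier A = carrier B"
    using h(5) by (auto simp: bij_betw_def)
  have g: "g y \<in> carrier A" "f (g y) = y" if "y \<in> carrier B" for y
    using that surj by (auto simp: g_def inv_into_into f_inv_into_f)
  have eqI: "g z = x" if "x \<in> carrier A" "f x = z" for x z
    using that inj by (auto simp: g_def)
  have "g \<in> ring_iso B A"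
  proof (rule ring_iso_memI)
    show "bij_betw g (carrier B) (carrier A)"
      unfolding g_def by (rule bij_betw_inv_into[OF h(5)])
  qed (auto intro!: eqI closed simp: g h)
  moreover have "g (k \<odot>\<^bsub>B\<^esub> y) = k \<odot>\<^bsub>A\<^esub> g y" if "k \<in> K" "y \<in> carrier B" for k y
    using that by (intro eqI closed) (auto simp: g f(2))
  ultimately show ?thesis unfolding algebra_isomorphic_def by blast
qed

text \<open>Functions on \<open>\<int>/q\<close> are represented by \<open>q\<close>-periodic functions on the natural numbers.\<close>

definition twisted_functions :: "('a, 'b) ring_scheme \<Rightarrow> ('a \<Rightarrow> 'a) \<Rightarrow> nat \<Rightarrow> nat \<Rightarrow> ('a, nat \<Rightarrow> 'a) module"
  where "twisted_functions L \<sigma> q u =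
    \<lparr>carrier = {f. (\<forall>j. f j \<in> carrier L) \<and> (\<forall>j. f (j mod q) = f j) \<and> (\<forall>j. \<sigma> (f (u * j)) = f j)},
     monoid.mult = (\<lambda>f g j. f j \<otimes>\<^bsub>L\<^esub> g j),
     monoid.one = (\<lambda>j. \<one>\<^bsub>L\<^esub>),
     ring.zero = (\<lambda>j. \<zero>\<^bsub>L\<^esub>),
     ring.add = (\<lambda>f g j. f j \<oplus>\<^bsub>L\<^esub> g j),
     module.smult = (\<lambda>k f j. k \<otimes>\<^bsub>L\<^esub> f j)\<rparr>"

lemma twisted_functions_simps [simp]:
  "f \<otimes>\<^bsub>twisted_functions L \<sigma> q u\<^esub> g = (\<lambda>j. f j \<otimes>\<^bsub>L\<^esub> g j)"
  "f \<oplus>\<^bsub>twisted_functions L \<sigma> q u\<^esub> g = (\<lambda>j. f j \<oplus>\<^bsub>L\<^esub> g j)"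
  "\<one>\<^bsub>twisted_functions L \<sigma> q u\<^esub> = (\<lambda>j. \<one>\<^bsub>L\<^esub>)"
  "\<zero>\<^bsub>twisted_functions L \<sigma> q u\<^esub> = (\<lambda>j. \<zero>\<^bsub>L\<^esub>)"
  "k \<odot>\<^bsub>twisted_functions L \<sigma> q u\<^esub> f = (\<lambda>j. k \<otimes>\<^bsub>L\<^esub> f j)"
  by (simp_all add: twisted_functions_def)

lemma carrier_twisted_functions:
  "f \<in> carrier (twisted_functions L \<sigma> q u) \<longleftrightarrow>
    (\<forall>j. f j \<in> carrier L) \<and> (\<forall>j. f (j mod q) = f j) \<and> (\<forall>j. \<sigma> (f (u * j)) = f j)"
  by (simp add: twisted_functions_def)

context cyclic_galois_extension
begin

lemma twisted_functions_closed:
  "f \<in> carrier (twisted_functions L \<sigma> q u) \<Longrightarrow> g \<in> carrier (twisted_functions L \<sigma> q u) \<Longrightarrow>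
    (\<lambda>j. f j \<otimes> g j) \<in> carrier (twisted_functions L \<sigma> q u)"
  "f \<in> carrier (twisted_functions L \<sigma> q u) \<Longrightarrow> g \<in> carrier (twisted_functions L \<sigma> q u) \<Longrightarrow>
    (\<lambda>j. f j \<oplus> g j) \<in> carrier (twisted_functions L \<sigma> q u)"
  "(\<lambda>j. \<one>) \<in> carrier (twisted_functions L \<sigma> q u)"
  "(\<lambda>j. \<zero>) \<in> carrier (twisted_functions L \<sigma> q u)"
  "k \<in> K \<Longrightarrow> f \<in> carrier (twisted_functions L \<sigma> q u) \<Longrightarrow>
    (\<lambda>j. k \<otimes> f j) \<in> carrier (twisted_functions L \<sigma> q u)"
  using K_subset by (auto simp: carrier_twisted_functions)

text \<open>Composition with the intertwining \<pi>: the values of \<open>f\<close> at \<pi>(u j)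
  and at v \<pi>(j) agree, so the twist by \<open>v\<close> becomes the twist by
  \<open>u\<close>.\<close>

lemma twisted_functions_isomorphic:
  assumes "[v = u ^ t] (mod q)" "[u = v ^ t'] (mod q)" "[u ^ Suc m = 1] (mod q)"
  shows "algebra_isomorphic K (twisted_functions L \<sigma> q v) (twisted_functions L \<sigma> q u)"
proof -
  obtain \<pi> where \<pi>: "bij_betw \<pi> {..<q} {..<q}" "\<And>j. \<pi> (j mod q) = \<pi> j"
    "\<And>j. [\<pi> (u * j) = v * \<pi> j] (mod q)"
    using intertwining_permutation[OF q_pos assms] by blast
  define \<Phi> where "\<Phi> = (\<lambda>(f :: nat \<Rightarrow> 'a) j. f (\<pi> j))"
  \<comment> \<open>An inverse of \<pi> extended periodically to all naturals, so that composition
    with it stays periodic.\<close>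
  define \<pi>' where "\<pi>' = (\<lambda>j. inv_into {..<q} \<pi> (j mod q))"
  have \<pi>'\<pi>: "\<pi>' (\<pi> j) = j mod q" for j
  proof -
    have "j mod q < q" using q_pos by simp
    then have "\<pi> (j mod q) < q" using \<pi>(1) by (auto simp: bij_betw_def)
    then show ?thesis
      using \<pi>(1) \<open>j mod q < q\<close> unfolding \<pi>'_def \<pi>(2)[of j, symmetric]
      by (simp add: bij_betw_inv_into_left)
  qed
  have \<pi>\<pi>': "\<pi> (\<pi>' j) = j mod q" for j
    unfolding \<pi>'_def using \<pi>(1) q_pos by (simp add: bij_betw_inv_into_right)
  have period: "f i = f j" if "f \<in> carrier (twisted_functions L \<sigma> q w)" "[i = j] (mod q)" for f i j w
    using that by (metis carrier_twisted_functions cong_def)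
  have closed: "\<Phi> f \<in> carrier (twisted_functions L \<sigma> q u)" if f: "f \<in> carrier (twisted_functions L \<sigma> q v)" for f
  proof -
    have "\<sigma> (f (\<pi> (u * j))) = f (\<pi> j)" for j
      using f period[OF f \<pi>(3)[of j]] by (simp add: carrier_twisted_functions)
    then show ?thesis
      using f \<pi>(2) by (simp add: \<Phi>_def carrier_twisted_functions)
  qed
  have "\<Phi> \<in> ring_iso (twisted_functions L \<sigma> q v) (twisted_functions L \<sigma> q u)"
  proof (rule ring_iso_memI)
    have "inj_on \<Phi> (carrier (twisted_functions L \<sigma> q v))"
    proof (rule inj_onI)
      fix f g assume fg: "f \<in> carrier (twisted_functions L \<sigma> q v)"
        "g \<in> carrier (twisted_functions L \<sigma> q v)" "\<Phi> f = \<Phi> g"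
      have "f j = g j" for j
        using fun_cong[OF fg(3), of "\<pi>' j"] fg(1,2) by (simp add: \<Phi>_def \<pi>\<pi>' carrier_twisted_functions)
      then show "f = g" by blast
    qed
    moreover have "\<Phi> ` carrier (twisted_functions L \<sigma> q v) = carrier (twisted_functions L \<sigma> q u)"
    proof
      show "\<Phi> ` carrier (twisted_functions L \<sigma> q v) \<subseteq> carrier (twisted_functions L \<sigma> q u)"
        using closed by blast
      show "carrier (twisted_functions L \<sigma> q u) \<subseteq> \<Phi> ` carrier (twisted_functions L \<sigma> q v)"
      proof
        fix g assume g: "g \<in> carrier (twisted_functions L \<sigma> q u)"
        have "\<sigma> (g (\<pi>' (v * j))) = g (\<pi>' j)" for j
        proof -
          have "[v * j = v * \<pi> (\<pi>' j)] (mod q)"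
            by (rule cong_scalar_left) (simp add: \<pi>\<pi>' cong_def)
          also have "[v * \<pi> (\<pi>' j) = \<pi> (u * \<pi>' j)] (mod q)"
            using \<pi>(3) by (rule cong_sym)
          finally have "\<pi>' (v * j) = \<pi>' (\<pi> (u * \<pi>' j))"
            by (simp add: \<pi>'_def cong_def)
          also have "\<dots> = u * \<pi>' j mod q" by (rule \<pi>'\<pi>)
          finally show ?thesis using g by (simp add: carrier_twisted_functions)
        qed
        then have "(\<lambda>j. g (\<pi>' j)) \<in> carrier (twisted_functions L \<sigma> q v)"
          using g by (simp add: carrier_twisted_functions \<pi>'_def)
        moreover have "\<Phi> (\<lambda>j. g (\<pi>' j)) = g"
          using g by (auto simp: \<Phi>_def \<pi>'\<pi> carrier_twisted_functions)
        ultimately show "g \<in> \<Phi> ` carrier (twisted_functions L \<sigma> q v)" by (metis image_eqI)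
      qed
    qed
    ultimately show "bij_betw \<Phi> (carrier (twisted_functions L \<sigma> q v)) (carrier (twisted_functions L \<sigma> q u))"
      by (simp add: bij_betw_def)
  qed (use closed in \<open>auto simp: \<Phi>_def\<close>)
  then show ?thesis
    unfolding algebra_isomorphic_def by (rule rev_bexI) (auto simp: \<Phi>_def)
qed

end

section \<open>Counting the factors isomorphic to K\<close>

text \<open>In a finite product of field extensions of \<open>K\<close>, these idempotents correspond to the factors
  isomorphic to \<open>K\<close>.\<close>

definition point_idempotents :: "'k set \<Rightarrow> ('k, 'a, 'm) module_scheme \<Rightarrow> 'a set" where
  "point_idempotents K A = {e \<in> carrier A. e \<otimes>\<^bsub>A\<^esub> e = e \<and> e \<noteq> \<zero>\<^bsub>A\<^esub> \<and>
     (\<forall>x\<in>carrier A. \<exists>k\<in>K. e \<otimes>\<^bsub>A\<^esub> x = k \<odot>\<^bsub>A\<^esub> e)}"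

context cyclic_galois_extension
begin

definition residue_indicator :: "nat \<Rightarrow> nat \<Rightarrow> 'a" where
  "residue_indicator j = (\<lambda>i. if i mod q = j then \<one> else \<zero>)"

text \<open>Multiplication by the unit \<open>u\<close> is injective, so the fixed point
  \<open>j\<close> has no other preimage and its indicator is invariant.\<close>

lemma residue_indicator_twisted:
  assumes "coprime u q" "j < q" "u * j mod q = j"
  shows "residue_indicator j \<in> carrier (twisted_functions L \<sigma> q u)"
proof -
  have "u * i mod q = j \<longleftrightarrow> i mod q = j" for i
    using cong_mult_lcancel_nat[OF assms(1), of i j] assms(2,3) by (simp add: cong_def)
  then show ?thesis
    by (auto simp: residue_indicator_def carrier_twisted_functions)
qed

text \<open>At a fixed point \<open>j\<close> every x(j) is \<sigma>-invariant, hence in K, so the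
  indicator qualifies. Conversely, for e(j) nonzero the condition forces x(j) into K for all
  \<open>x\<close>; test functions built by averaging over G then show that \<open>j\<close> is
  fixed, and testing with its indicator shows that \<open>e\<close> vanishes elsewhere.\<close>

lemma point_idempotents_twisted_functions:
  assumes "[u ^ q = 1] (mod q)"
  shows "point_idempotents K (twisted_functions L \<sigma> q u) = residue_indicator ` {j. j < q \<and> u * j mod q = j}"
proof -
  have cop: "coprime u q"
    unfolding coprime_iff_invertible_nat
    using assms q_pos by (intro exI[of _ "u ^ (q - 1)"]) (simp flip: power_Suc)
  show ?thesis
  proof (intro equalityI subsetI)
    fix e assume "e \<in> residue_indicator ` {j. j < q \<and> u * j mod q = j}"
    then obtain j where j: "j < q" "u * j mod q = j" "e = residue_indicator j" by blast
    have "\<exists>k\<in>K. (\<lambda>i. e i \<otimes> x i) = (\<lambda>i. k \<otimes> e i)" if x: "x \<in> carrier (twisted_functions L \<sigma> q u)" for x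
    proof
      have "\<sigma> (x j) = x j"
        using x j by (metis carrier_twisted_functions)
      then show "x j \<in> K" using x by (intro fixed_in_K) (auto simp: carrier_twisted_functions)
      have "x i = x j" if "i mod q = j" for i
        using x that by (auto simp: carrier_twisted_functions)
      then show "(\<lambda>i. e i \<otimes> x i) = (\<lambda>i. x j \<otimes> e i)"
        using x by (auto simp: j(3) residue_indicator_def carrier_twisted_functions fun_eq_iff)
    qed
    moreover have "e \<noteq> (\<lambda>i. \<zero>)"
      using j by (auto simp: residue_indicator_def fun_eq_iff intro!: exI[of _ j])
    moreover have "(\<lambda>i. e i \<otimes> e i) = e" by (auto simp: j(3) residue_indicator_def)
    moreover have "e \<in> carrier (twisted_functions L \<sigma> q u)"
      using residue_indicator_twisted[OF cop j(1,2)] j(3) by simp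
    ultimately show "e \<in> point_idempotents K (twisted_functions L \<sigma> q u)"
      by (simp add: point_idempotents_def)
  next
    fix e assume "e \<in> point_idempotents K (twisted_functions L \<sigma> q u)"
    then have e: "e \<in> carrier (twisted_functions L \<sigma> q u)" "(\<lambda>i. e i \<otimes> e i) = e" "e \<noteq> (\<lambda>i. \<zero>)"
      and eK: "\<And>x. x \<in> carrier (twisted_functions L \<sigma> q u) \<Longrightarrow> \<exists>k\<in>K. (\<lambda>i. e i \<otimes> x i) = (\<lambda>i. k \<otimes> e i)"
      by (auto simp: point_idempotents_def)
    obtain j0 where "e j0 \<noteq> \<zero>" using e(3) by auto
    define j where "j = j0 mod q"
    have ej: "e j \<noteq> \<zero>" "j < q"
      using \<open>e j0 \<noteq> \<zero>\<close> e(1) q_pos by (auto simp: j_def carrier_twisted_functions)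
    have ec: "e i \<in> carrier L" for i using e(1) by (simp add: carrier_twisted_functions)
    have ej1: "e j = \<one>"
      using fun_cong[OF e(2), of j] ej ec[of j] by (metis m_lcancel one_closed r_one)
    \<comment> \<open>\<open>x c\<close> is the average over the powers of \<sigma> of the function
      with value \<open>c\<close> at \<open>j\<close> and 0 elsewhere; \<open>F c i k\<close> is the
      contribution of \<sigma>^k at \<open>i\<close>.\<close>
    define F where "F = (\<lambda>c i k. if [u ^ k * i = j] (mod q) then (\<sigma> ^^ k) c else \<zero>)"
    define x where "x = (\<lambda>c i. \<Oplus>k\<in>{..<q}. F c i k)"
    have Fc: "F c i k \<in> carrier L" if "c \<in> carrier L" for c i k using that by (simp add: F_def)
    have xT: "x c \<in> carrier (twisted_functions L \<sigma> q u)" if c: "c \<in> carrier L" for c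
    proof -
      have "F c (i mod q) = F c i" for i
        by (simp add: F_def cong_def mod_mult_right_eq)
      then have "x c (i mod q) = x c i" for i by (simp add: x_def)
      moreover have "\<sigma> (x c (u * i)) = x c i" for i
      proof -
        have "\<sigma> (x c (u * i)) = (\<sigma> ^^ 1) (x c (u * i))" by simp
        also have "\<dots> = (\<Oplus>k\<in>{..<q}. (\<sigma> ^^ 1) (F c (u * i) k))"
          unfolding x_def using Fc c by (intro funpow_finsum) auto
        also have "\<dots> = (\<Oplus>k\<in>{..<q}. F c i (Suc k mod q))"
        proof (intro add.finprod_cong' refl)
          fix k assume "k \<in> {..<q}"
          \<comment> \<open>Both u^q = 1 modulo \<open>q\<close> and \<sigma>^q = 1, so the
            summation index may be shifted cyclically.\<close>
          have "F c i q = F c i 0"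
            using cong_scalar_right[OF assms, of i] funpow_period[OF c] by (auto simp: F_def cong_def)
          then have "F c i (Suc k mod q) = F c i (Suc k)"
            using \<open>k \<in> {..<q}\<close> by (auto simp: mod_Suc)
          then show "(\<sigma> ^^ 1) (F c (u * i) k) = F c i (Suc k mod q)"
            by (simp add: F_def ac_simps)
        qed (use Fc c in auto)
        also have "\<dots> = x c i"
          unfolding x_def using Fc c by (intro finsum_reindex_bij bij_betw_Suc_mod) auto
        finally show ?thesis .
      qed
      ultimately show ?thesis
        using Fc c by (auto simp: carrier_twisted_functions x_def)
    qed
    \<comment> \<open>At \<open>j\<close>, where \<open>e\<close> is 1, the idempotent condition
      makes x_c(j) an element of K. It is thus the image under \<sigma> both of itself and of x_c(u
      j), and \<sigma> is injective.\<close>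
    have eq: "x c (u * j) = x c j" if c: "c \<in> carrier L" for c
    proof -
      obtain k where k: "k \<in> K" "(\<lambda>i. e i \<otimes> x c i) = (\<lambda>i. k \<otimes> e i)"
        using eK[OF xT[OF c]] by blast
      have xc: "x c i \<in> carrier L" for i using xT[OF c] by (simp add: carrier_twisted_functions)
      have "x c j = k"
        using fun_cong[OF k(2), of j] xc[of j] k(1) K_subset by (auto simp: ej1)
      then have "\<sigma> (x c j) = x c j" using k(1) by simp
      moreover have "\<sigma> (x c (u * j)) = x c j" using xT[OF c] by (simp add: carrier_twisted_functions)
      ultimately show ?thesis using inj_onD[OF generator_inj] xc by metis
    qed
    define a where "a = (\<lambda>i k. if [u ^ k * i = j] (mod q) then \<one> else \<zero>)"
    have ac: "a i k \<in> carrier L" for i k by (simp add: a_def)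
    have xa: "x c i = (\<Oplus>k\<in>{..<q}. a i k \<otimes> (\<sigma> ^^ k) c)" if "c \<in> carrier L" for c i
      unfolding x_def using that by (intro add.finprod_cong') (auto simp: F_def a_def)
    \<comment> \<open>The equality holds for all \<open>c\<close>, so the coefficients of each
      \<sigma>^k agree. For k = 0 the coefficient at \<open>j\<close> is 1, and a coefficient 1 at u
      j means u j = j modulo \<open>q\<close>.\<close>
    have "a (u * j) 0 \<ominus> a j 0 = \<zero>"
    proof (rule dedekind_generator[where c = "\<lambda>k. a (u * j) k \<ominus> a j k"])
      fix c assume c: "c \<in> carrier L"
      have "(\<Oplus>k\<in>{..<q}. (a (u * j) k \<ominus> a j k) \<otimes> (\<sigma> ^^ k) c) =
          (\<Oplus>k\<in>{..<q}. a (u * j) k \<otimes> (\<sigma> ^^ k) c \<oplus> (\<ominus> \<one>) \<otimes> (a j k \<otimes> (\<sigma> ^^ k) c))"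
        using ac c by (intro add.finprod_cong') (auto simp: minus_eq l_distr l_minus)
      also have "\<dots> = x c (u * j) \<oplus> (\<ominus> \<one>) \<otimes> x c j"
        using ac c by (simp add: xa finsum_rdistr Pi_def)
      also have "\<dots> = \<zero>"
        using xT[OF c] by (simp add: eq[OF c] carrier_twisted_functions l_minus r_neg)
      finally show "(\<Oplus>k\<in>{..<q}. (a (u * j) k \<ominus> a j k) \<otimes> (\<sigma> ^^ k) c) = \<zero>" .
    qed (use ac q_pos in auto)
    then have "a (u * j) 0 = \<one>"
      using ac by (simp add: a_def split: if_splits)
    then have uj: "u * j mod q = j"
      using ej(2) by (simp add: a_def cong_def split: if_splits)
    \<comment> \<open>Evaluation at \<open>j\<close> gives k = 1, so \<open>e\<close> equals its
      product with the indicator.\<close>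
    obtain k where k: "k \<in> K" "(\<lambda>i. e i \<otimes> residue_indicator j i) = (\<lambda>i. k \<otimes> e i)"
      using eK[OF residue_indicator_twisted[OF cop ej(2) uj]] by blast
    have "k = \<one>"
      using fun_cong[OF k(2), of j] k(1) K_subset ej(2) by (auto simp: ej1 residue_indicator_def)
    have "e i = residue_indicator j i" for i
    proof (cases "i mod q = j")
      case True
      then show ?thesis using e(1) ej1 by (metis carrier_twisted_functions residue_indicator_def)
    next
      case False
      then show ?thesis
        using fun_cong[OF k(2), of i] ec[of i] by (simp add: \<open>k = \<one>\<close> residue_indicator_def)
    qed
    then show "e \<in> residue_indicator ` {j. j < q \<and> u * j mod q = j}"
      using uj ej(2) by blast
  qed
qed

lemma card_point_idempotents:
  assumes "[u ^ q = 1] (mod q)"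
  shows "card (point_idempotents K (twisted_functions L \<sigma> q u)) = card {j. j < q \<and> u * j mod q = j}"
proof -
  have "inj_on residue_indicator {j. j < q \<and> u * j mod q = j}"
  proof
    fix i j assume ij: "i \<in> {j. j < q \<and> u * j mod q = j}" "residue_indicator i = residue_indicator j"
    then have "residue_indicator j i = \<one>" by (metis (mono_tags, lifting) mem_Collect_eq mod_less residue_indicator_def)
    then show "i = j" using ij(1) by (auto simp: residue_indicator_def split: if_splits)
  qed
  then show ?thesis
    unfolding point_idempotents_twisted_functions[OF assms] by (rule card_image)
qed

text \<open>The defining conditions use only product, zero and scalars from K, so an isomorphism
  carries them over injectively.\<close>

lemma card_point_idempotents_le:
  assumes "algebra_isomorphic K (twisted_functions L \<sigma> q u) (twisted_functions L \<sigma> q v)"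
    and "finite (point_idempotents K (twisted_functions L \<sigma> q v))"
  shows "card (point_idempotents K (twisted_functions L \<sigma> q u)) \<le> card (point_idempotents K (twisted_functions L \<sigma> q v))"
proof -
  let ?A = "twisted_functions L \<sigma> q u" and ?B = "twisted_functions L \<sigma> q v"
  obtain \<phi> where \<phi>: "\<phi> \<in> ring_iso ?A ?B" "\<And>k x. k \<in> K \<Longrightarrow> x \<in> carrier ?A \<Longrightarrow> \<phi> (k \<odot>\<^bsub>?A\<^esub> x) = k \<odot>\<^bsub>?B\<^esub> \<phi> x"
    using assms(1) unfolding algebra_isomorphic_def by blast
  note h = ring_iso_memE[OF \<phi>(1)]
  have inj: "inj_on \<phi> (carrier ?A)" and surj: "\<phi> ` carrier ?A = carrier ?B"
    using h(5) by (auto simp: bij_betw_def)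
  have zero: "\<phi> \<zero>\<^bsub>?A\<^esub> = \<zero>\<^bsub>?B\<^esub>"
  proof -
    have zA: "\<zero>\<^bsub>?A\<^esub> \<in> carrier ?A" using twisted_functions_closed(4) by simp
    have "\<phi> \<zero>\<^bsub>?A\<^esub> i \<in> carrier L" for i
      using h(1)[OF zA] by (simp add: carrier_twisted_functions)
    moreover have "\<phi> \<zero>\<^bsub>?A\<^esub> i = \<phi> \<zero>\<^bsub>?A\<^esub> i \<oplus> \<phi> \<zero>\<^bsub>?A\<^esub> i" for i
      using fun_cong[OF h(3)[OF zA zA], of i] by simp
    ultimately show ?thesis by (auto simp: fun_eq_iff)
  qed
  have "\<phi> ` point_idempotents K ?A \<subseteq> point_idempotents K ?B"
  proof safe
    fix e assume e: "e \<in> point_idempotents K ?A"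
    then have eA: "e \<in> carrier ?A" "e \<otimes>\<^bsub>?A\<^esub> e = e" "e \<noteq> \<zero>\<^bsub>?A\<^esub>"
      and eK: "\<And>x. x \<in> carrier ?A \<Longrightarrow> \<exists>k\<in>K. e \<otimes>\<^bsub>?A\<^esub> x = k \<odot>\<^bsub>?A\<^esub> e"
      unfolding point_idempotents_def by blast+
    have "\<phi> e \<noteq> \<zero>\<^bsub>?B\<^esub>"
      using inj_onD[OF inj, of e "\<zero>\<^bsub>?A\<^esub>"] eA zero twisted_functions_closed(4) by auto
    moreover have "\<exists>k\<in>K. \<phi> e \<otimes>\<^bsub>?B\<^esub> y = k \<odot>\<^bsub>?B\<^esub> \<phi> e" if y: "y \<in> carrier ?B" for y
    proof -
      obtain x where x: "x \<in> carrier ?A" "y = \<phi> x" using y surj by blast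
      then show ?thesis using eK[OF x(1)] h(2)[OF eA(1) x(1)] \<phi>(2)[OF _ eA(1)] by metis
    qed
    ultimately show "\<phi> e \<in> point_idempotents K ?B"
      unfolding point_idempotents_def using h(1)[OF eA(1)] h(2)[OF eA(1) eA(1)] eA(2) by simp
  qed
  moreover have "inj_on \<phi> (point_idempotents K ?A)"
    using inj by (rule inj_on_subset) (auto simp: point_idempotents_def)
  ultimately show ?thesis using assms(2) by (metis card_image card_mono)
qed

lemma twisted_functions_isomorphic_imp_card_eq:
  assumes "algebra_isomorphic K (twisted_functions L \<sigma> q u) (twisted_functions L \<sigma> q v)"
    and "[u ^ q = 1] (mod q)" "[v ^ q = 1] (mod q)"
  shows "card {j. j < q \<and> u * j mod q = j} = card {j. j < q \<and> v * j mod q = j}"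
proof -
  have fin: "finite (point_idempotents K (twisted_functions L \<sigma> q w))" if "[w ^ q = 1] (mod q)" for w
    unfolding point_idempotents_twisted_functions[OF that] by simp
  have "algebra_isomorphic K (twisted_functions L \<sigma> q v) (twisted_functions L \<sigma> q u)"
    by (rule algebra_isomorphic_sym[OF assms(1)]) (simp_all add: twisted_functions_closed)
  then show ?thesis
    using card_point_idempotents_le[OF assms(1) fin] card_point_idempotents_le[OF _ fin, of v u] assms(2,3)
    by (simp add: card_point_idempotents)
qed

end

section \<open>The Fourier transform\<close>

lemma carrier_group_algebra: "carrier (group_algebra R A) = carrier A \<rightarrow>\<^sub>E carrier R"
  by (simp add: group_algebra_def)

lemma group_algebra_apply:
  assumes "c \<in> carrier A"
  shows "(x \<otimes>\<^bsub>group_algebra R A\<^esub> y) c =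
      (\<Oplus>\<^bsub>R\<^esub>q\<in>{(a, b). a \<in> carrier A \<and> b \<in> carrier A \<and> a \<otimes>\<^bsub>A\<^esub> b = c}. x (fst q) \<otimes>\<^bsub>R\<^esub> y (snd q))"
    and "(x \<oplus>\<^bsub>group_algebra R A\<^esub> y) c = x c \<oplus>\<^bsub>R\<^esub> y c"
    and "\<one>\<^bsub>group_algebra R A\<^esub> c = (if c = \<one>\<^bsub>A\<^esub> then \<one>\<^bsub>R\<^esub> else \<zero>\<^bsub>R\<^esub>)"
    and "(k \<odot>\<^bsub>group_algebra R A\<^esub> x) c = k \<otimes>\<^bsub>R\<^esub> x c"
  using assms by (simp_all add: group_algebra_def)

lemma (in ring) group_algebra_closed:
  assumes "x \<in> carrier (group_algebra R A)" "y \<in> carrier (group_algebra R A)"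
  shows "x \<otimes>\<^bsub>group_algebra R A\<^esub> y \<in> carrier (group_algebra R A)"
    and "x \<oplus>\<^bsub>group_algebra R A\<^esub> y \<in> carrier (group_algebra R A)"
    and "k \<in> carrier R \<Longrightarrow> k \<odot>\<^bsub>group_algebra R A\<^esub> x \<in> carrier (group_algebra R A)"
proof -
  have c: "x b \<in> carrier R" "y b \<in> carrier R" if "b \<in> carrier A" for b
    using assms that by (auto simp: carrier_group_algebra)
  show "x \<otimes>\<^bsub>group_algebra R A\<^esub> y \<in> carrier (group_algebra R A)"
    using c by (auto simp: group_algebra_def intro!: finsum_closed)
qed (use assms in \<open>auto simp: group_algebra_def\<close>)

lemma bij_betw_mult_mod:
  fixes u q :: nat
  assumes "coprime u q" "q > 0"
  shows "bij_betw (\<lambda>i. u * i mod q) {..<q} {..<q}"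
proof -
  have "inj_on (\<lambda>i. u * i mod q) {..<q}"
  proof
    fix i j assume "i \<in> {..<q}" "j \<in> {..<q}" "u * i mod q = u * j mod q"
    then show "i = j" using cong_mult_lcancel_nat[OF assms(1), of i j] by (simp add: cong_def)
  qed
  moreover have "(\<lambda>i. u * i mod q) ` {..<q} \<subseteq> {..<q}" using assms(2) by auto
  ultimately show ?thesis by (simp add: bij_betw_def endo_inj_surj)
qed

locale cyclic_kummer_extension = cyclic_galois_extension +
  fixes \<zeta> :: 'a
  assumes primitive_root: "primitive_root_of_unity (L\<lparr>carrier := K\<rparr>) q \<zeta>"
begin

lemma root_K: "\<zeta> \<in> K"
  using primitive_root by (simp add: primitive_root_of_unity_def)

lemma root_closed [simp]: "\<zeta> \<in> carrier L"
  using root_K K_subset by blast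

lemma root_pow_q: "\<zeta> [^] q = \<one>"
  using primitive_root by (simp add: primitive_root_of_unity_def nat_pow_carrier_update)

lemma root_pow_neq_one: "0 < j \<Longrightarrow> j < q \<Longrightarrow> \<zeta> [^] j \<noteq> \<one>" for j :: nat
  using primitive_root by (simp add: primitive_root_of_unity_def nat_pow_carrier_update)

lemma root_pow_mod: "\<zeta> [^] (j mod q) = \<zeta> [^] j" for j :: nat
proof -
  have "\<zeta> [^] j = \<zeta> [^] (q * (j div q) + j mod q)" by simp
  also have "\<dots> = (\<zeta> [^] q) [^] (j div q) \<otimes> \<zeta> [^] (j mod q)"
    by (simp only: nat_pow_mult[symmetric] nat_pow_pow[symmetric] root_closed)
  also have "\<dots> = \<zeta> [^] (j mod q)" by (simp add: root_pow_q)
  finally show ?thesis by simp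
qed

lemma root_pow_cong: "[i = j] (mod q) \<Longrightarrow> \<zeta> [^] i = \<zeta> [^] j" for i j :: nat
  by (metis cong_def root_pow_mod)

lemma root_pow_eq_one_iff: "\<zeta> [^] j = \<one> \<longleftrightarrow> q dvd j" for j :: nat
proof -
  have "\<zeta> [^] (j mod q) = \<one> \<longleftrightarrow> j mod q = 0"
    using root_pow_neq_one[of "j mod q"] q_pos by (cases "j mod q = 0") auto
  then show ?thesis by (simp add: root_pow_mod dvd_eq_mod_eq_0)
qed

lemma root_pow_K: "\<zeta> [^] j \<in> K" for j :: nat
  by (induction j) (use subfield_K root_K in \<open>auto simp: subringE(3,6) subfieldE(1)\<close>)

text \<open>Orthogonality of characters: multiplying the sum by \<zeta>^m only shifts its terms
  cyclically, so the sum vanishes unless \<zeta>^m = 1.\<close>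

lemma sum_root_pow:
  "(\<Oplus>i\<in>{..<q}. \<zeta> [^] (m * i)) = (if q dvd m then add_pow L q \<one> else \<zero>)" for m :: nat
proof (cases "q dvd m")
  case True
  then have "\<zeta> [^] (m * i) = \<one>" for i by (simp add: root_pow_eq_one_iff)
  then show ?thesis using True by (simp add: add.finprod_const)
next
  case False
  define S where "S = (\<Oplus>i\<in>{..<q}. \<zeta> [^] (m * i))"
  have S: "S \<in> carrier L" by (simp add: S_def)
  have "\<zeta> [^] m \<otimes> S = (\<Oplus>i\<in>{..<q}. \<zeta> [^] (m * (Suc i mod q)))"
    unfolding S_def
  proof (subst finsum_rdistr, simp, simp, simp, intro add.finprod_cong' refl)
    fix i
    have "\<zeta> [^] m \<otimes> \<zeta> [^] (m * i) = \<zeta> [^] (m * Suc i)" by (simp add: nat_pow_mult)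
    also have "\<dots> = \<zeta> [^] (m * (Suc i mod q))"
      by (rule root_pow_cong) (simp add: cong_def mod_mult_right_eq)
    finally show "\<zeta> [^] m \<otimes> \<zeta> [^] (m * i) = \<zeta> [^] (m * (Suc i mod q))" .
  qed auto
  also have "\<dots> = S"
    unfolding S_def by (rule finsum_reindex_bij[OF bij_betw_Suc_mod]) simp
  finally have "(\<zeta> [^] m \<ominus> \<one>) \<otimes> S = \<zero>"
    using S by (simp add: minus_eq l_distr l_minus r_neg)
  moreover have "\<zeta> [^] m \<ominus> \<one> \<noteq> \<zero>"
    using False by (simp add: root_pow_eq_one_iff)
  ultimately have "S = \<zero>" using S integral[of "\<zeta> [^] m \<ominus> \<one>" S] by auto
  then show ?thesis using False by (simp add: S_def)
qed

text \<open>Common core of both inversion formulas. After exchanging the sums, orthogonality leaves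
  only the index \<open>k0\<close>. The exponents \<open>s\<close> and \<open>t\<close> are free
  because the inverse sign sits on the outer sum in one use and on the inner sum in the
  other.\<close>

lemma root_pow_inversion:
  assumes "\<And>k. k < q \<Longrightarrow> g k \<in> carrier L" "k0 < q"
    and "\<And>k. k < q \<Longrightarrow> q dvd s + t k \<longleftrightarrow> k = k0"
  shows "(\<Oplus>i\<in>{..<q}. \<zeta> [^] (s * i) \<otimes> (\<Oplus>k\<in>{..<q}. \<zeta> [^] (t k * i) \<otimes> g k)) = add_pow L q \<one> \<otimes> g k0"
proof -
  have "(\<Oplus>i\<in>{..<q}. \<zeta> [^] (s * i) \<otimes> (\<Oplus>k\<in>{..<q}. \<zeta> [^] (t k * i) \<otimes> g k)) =
      (\<Oplus>i\<in>{..<q}. \<Oplus>k\<in>{..<q}. \<zeta> [^] ((s + t k) * i) \<otimes> g k)"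
  proof (intro add.finprod_cong' refl)
    fix i assume "i \<in> {..<q}"
    have "\<zeta> [^] (s * i) \<otimes> (\<Oplus>k\<in>{..<q}. \<zeta> [^] (t k * i) \<otimes> g k) =
        (\<Oplus>k\<in>{..<q}. \<zeta> [^] (s * i) \<otimes> (\<zeta> [^] (t k * i) \<otimes> g k))"
      using assms(1) by (intro finsum_rdistr) auto
    also have "\<dots> = (\<Oplus>k\<in>{..<q}. \<zeta> [^] ((s + t k) * i) \<otimes> g k)"
      using assms(1)
      by (intro add.finprod_cong') (auto simp: add_mult_distrib nat_pow_mult[symmetric] m_assoc)
    finally show "\<zeta> [^] (s * i) \<otimes> (\<Oplus>k\<in>{..<q}. \<zeta> [^] (t k * i) \<otimes> g k) =
        (\<Oplus>k\<in>{..<q}. \<zeta> [^] ((s + t k) * i) \<otimes> g k)" .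
  qed (use assms(1) in auto)
  also have "\<dots> = (\<Oplus>k\<in>{..<q}. \<Oplus>i\<in>{..<q}. \<zeta> [^] ((s + t k) * i) \<otimes> g k)"
    using assms(1) by (intro finsum_swap) auto
  also have "\<dots> = (\<Oplus>k\<in>{..<q}. (\<Oplus>i\<in>{..<q}. \<zeta> [^] ((s + t k) * i)) \<otimes> g k)"
    using assms(1) by (intro add.finprod_cong') (auto simp: finsum_ldistr)
  also have "\<dots> = (\<Oplus>k\<in>{..<q}. if k0 = k then add_pow L q \<one> \<otimes> g k else \<zero>)"
    using assms(1,3) by (intro add.finprod_cong') (auto simp: sum_root_pow)
  also have "\<dots> = add_pow L q \<one> \<otimes> g k0"
    using assms(1,2) by (intro finsum_singleton) auto
  finally show ?thesis .
qed

text \<open>The value at \<open>j\<close> of the character \<eta> \<mapsto> \<zeta>^j on the group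
  algebra element with coefficients \<open>g\<close>. Only the arguments below \<open>q\<close> of
  \<open>g\<close> enter.\<close>

definition dft :: "(nat \<Rightarrow> 'a) \<Rightarrow> nat \<Rightarrow> 'a" where
  "dft g j = (\<Oplus>i\<in>{..<q}. \<zeta> [^] (i * j) \<otimes> g i)"

lemma dft_closed: "(\<And>i. g i \<in> carrier L) \<Longrightarrow> dft g j \<in> carrier L"
  by (simp add: dft_def)

lemma dft_cong_arg: "[j = j'] (mod q) \<Longrightarrow> dft g j = dft g j'"
proof -
  assume "[j = j'] (mod q)"
  then have "\<zeta> [^] (i * j) = \<zeta> [^] (i * j')" for i by (intro root_pow_cong cong_scalar_left)
  then show ?thesis by (simp add: dft_def)
qed

text \<open>With natural number exponents, \<open>q - 1\<close> plays the role of \<open>-1\<close>.\<close>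

lemma dvd_inverse_index_iff:
  assumes "i < q" "k < q"
  shows "q dvd (q - 1) * i + k \<longleftrightarrow> k = i"
proof -
  have "(q - 1) * i + k + i = q * i + k"
    using q_pos by (cases q) auto
  then have "q dvd (q - 1) * i + k \<longleftrightarrow> [q * i + k = i] (mod q)"
    by (metis (no_types, lifting) add.commute add_0 cong_0_iff cong_add_rcancel_nat)
  also have "\<dots> \<longleftrightarrow> k = i" using assms by (simp add: cong_def)
  finally show ?thesis .
qed

lemma dft_inj:
  assumes "\<And>i. g i \<in> carrier L" "\<And>i. h i \<in> carrier L"
    and "\<And>j. dft g j = dft h j" "i < q"
  shows "g i = h i"
proof -
  have inv: "(\<Oplus>j\<in>{..<q}. \<zeta> [^] ((q - 1) * i * j) \<otimes> dft f j) = add_pow L q \<one> \<otimes> f i"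
    if "\<And>i. f i \<in> carrier L" for f
    unfolding dft_def using that assms(4) dvd_inverse_index_iff
    by (intro root_pow_inversion) auto
  have "add_pow L q \<one> \<otimes> g i = add_pow L q \<one> \<otimes> h i"
    using inv[of g] inv[of h] assms(1,2,3) by simp
  then show ?thesis
    using of_nat_neq_zero[OF q_pos] assms(1,2) by (simp add: m_lcancel)
qed

text \<open>The inverse transform, scaled by 1/q, which exists in characteristic zero.\<close>

lemma dft_surj:
  assumes "\<And>j. f j \<in> carrier L" "\<And>j. f (j mod q) = f j"
  obtains g where "\<And>i. g i \<in> carrier L" "dft g = f"
proof
  define Q where "Q = inv (add_pow L q \<one>)"
  have Q: "Q \<in> carrier L" "Q \<otimes> add_pow L q \<one> = \<one>"
    using of_nat_neq_zero[OF q_pos] by (auto simp: Q_def field_Units)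
  define g where "g = (\<lambda>i. Q \<otimes> (\<Oplus>j\<in>{..<q}. \<zeta> [^] ((q - 1) * j * i) \<otimes> f j))"
  show g: "g i \<in> carrier L" for i using Q assms by (simp add: g_def)
  have "dft g j = f j" if j: "j < q" for j
  proof -
    have "dft g j = (\<Oplus>i\<in>{..<q}. Q \<otimes> (\<zeta> [^] (j * i) \<otimes> (\<Oplus>k\<in>{..<q}. \<zeta> [^] ((q - 1) * k * i) \<otimes> f k)))"
      unfolding dft_def g_def using Q assms by (intro add.finprod_cong') (auto simp: m_lcomm mult.commute)
    also have "\<dots> = Q \<otimes> (\<Oplus>i\<in>{..<q}. \<zeta> [^] (j * i) \<otimes> (\<Oplus>k\<in>{..<q}. \<zeta> [^] ((q - 1) * k * i) \<otimes> f k))"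
      using Q assms by (subst finsum_rdistr) auto
    also have "(\<Oplus>i\<in>{..<q}. \<zeta> [^] (j * i) \<otimes> (\<Oplus>k\<in>{..<q}. \<zeta> [^] ((q - 1) * k * i) \<otimes> f k)) = add_pow L q \<one> \<otimes> f j"
      using assms(1) j dvd_inverse_index_iff[of _ j]
      by (intro root_pow_inversion) (auto simp: add.commute)
    finally show ?thesis using Q assms(1) by (simp add: m_assoc[symmetric])
  qed
  then have "dft g j = f j" for j
    using dft_cong_arg[of j "j mod q" g] assms(2)[of j] q_pos by (simp add: cong_def)
  then show "dft g = f" by blast
qed

text \<open>\<sigma> passes through the transform because \<zeta> lies in K.\<close>

lemma dft_generator:
  assumes "\<And>i. g i \<in> carrier L"
  shows "\<sigma> (dft g j) = dft (\<lambda>i. \<sigma> (g i)) j"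
proof -
  have "\<sigma> (dft g j) = (\<Oplus>i\<in>{..<q}. (\<sigma> ^^ 1) (\<zeta> [^] (i * j) \<otimes> g i))"
    unfolding dft_def using funpow_finsum[of "{..<q}" "\<lambda>i. \<zeta> [^] (i * j) \<otimes> g i" 1] assms by simp
  also have "\<dots> = dft (\<lambda>i. \<sigma> (g i)) j"
    unfolding dft_def using assms
    by (intro add.finprod_cong') (auto simp: root_pow_K)
  finally show ?thesis .
qed

text \<open>Substituting u i for i moves a dilation of the coefficients to the inverse dilation of
  the characters. Hence \<open>twisted_functions\<close> has \<open>u\<close> inside \<sigma>,
  opposite to the condition on coefficients.\<close>

lemma dft_dilation:
  assumes "\<And>i. g i \<in> carrier L" "\<And>i. g (i mod q) = g i" "coprime u q"
  shows "dft (\<lambda>i. g (u * i)) (u * j) = dft g j"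
proof -
  have "\<zeta> [^] (i * (u * j)) = \<zeta> [^] ((u * i mod q) * j)" for i
    by (rule root_pow_cong) (simp add: cong_def mod_mult_right_eq ac_simps)
  then have "dft (\<lambda>i. g (u * i)) (u * j) = (\<Oplus>i\<in>{..<q}. \<zeta> [^] ((u * i mod q) * j) \<otimes> g (u * i mod q))"
    unfolding dft_def using assms(1,2) by simp
  also have "\<dots> = dft g j"
    unfolding dft_def using assms(1)
    by (intro finsum_reindex_bij[OF bij_betw_mult_mod[OF assms(3) q_pos]]) simp
  finally show ?thesis .
qed

end

section \<open>Diagonalizing the fixed algebra of a cyclic permutation group\<close>

text \<open>\<open>a i\<close> stands for the image of \<eta>^i under \<alpha>_s. Only the group
  law, the period and the conjugation action enter; regularity of the permutation group has been
  abstracted away.\<close>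

locale cyclic_hopf_form = cyclic_kummer_extension +
  fixes a :: "nat \<Rightarrow> ('a \<Rightarrow> 'a) \<Rightarrow> ('a \<Rightarrow> 'a)" and u :: nat
  assumes a_Bij: "a i \<in> Bij (carrier (galois_group L K))"
    and a_add: "a i \<otimes>\<^bsub>BijGroup (carrier (galois_group L K))\<^esub> a j = a (i + j)"
    and a_eq_iff: "a i = a j \<longleftrightarrow> [i = j] (mod q)"
    and a_conj: "conj_action (galois_group L K) (\<sigma> [^]\<^bsub>galois_group L K\<^esub> k) (a i) = a (u ^ k * i)"
    and u_pow: "[u ^ q = 1] (mod q)"
begin

abbreviation "A \<equiv> range a"
abbreviation "LA \<equiv> group_algebra L (BijGroup (carrier (galois_group L K))\<lparr>carrier := A\<rparr>)"

lemma coprime_u: "coprime u q"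
  unfolding coprime_iff_invertible_nat
  using u_pow q_pos by (intro exI[of _ "u ^ (q - 1)"]) (simp flip: power_Suc)

lemma a_mod: "a (i mod q) = a i"
  by (simp add: a_eq_iff)

lemma range_a: "A = a ` {..<q}"
proof -
  have "a i \<in> a ` {..<q}" for i
    using a_mod[of i] q_pos by (metis image_eqI lessThan_iff mod_less_divisor)
  then show ?thesis by auto
qed

lemma one_eq: "\<one>\<^bsub>BijGroup (carrier (galois_group L K))\<^esub> = a 0"
proof -
  interpret B: group "BijGroup (carrier (galois_group L K))" by (rule group_BijGroup)
  have "a 0 \<in> carrier (BijGroup (carrier (galois_group L K)))"
    using a_Bij by (simp add: BijGroup_def)
  then show ?thesis using a_add[of 0 0] B.l_cancel_one' by (metis add_0)
qed

lemma mem_LA: "x \<in> carrier LA \<longleftrightarrow> (\<forall>i. x (a i) \<in> carrier L) \<and> x \<in> extensional A"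
  by (auto simp: carrier_group_algebra PiE_def)

lemma LA_eqI:
  assumes "x \<in> carrier LA" "y \<in> carrier LA" "\<And>i. i < q \<Longrightarrow> x (a i) = y (a i)"
  shows "x = y"
proof (rule extensionalityI)
  fix c assume "c \<in> A"
  then show "x c = y c" using assms(3) unfolding range_a by auto
qed (use assms mem_LA in auto)

lemma LA_mult_apply:
  assumes "x \<in> carrier LA" "y \<in> carrier LA" "i < q"
  shows "(x \<otimes>\<^bsub>LA\<^esub> y) (a i) =
    (\<Oplus>z\<in>{(k, l). k < q \<and> l < q \<and> (k + l) mod q = i}. x (a (fst z)) \<otimes> y (a (snd z)))"
proof -
  let ?R = "{(k, l). k < q \<and> l < q \<and> (k + l) mod q = i}"
  have inj: "inj_on (map_prod a a) ?R"
    by (auto simp: inj_on_def a_eq_iff cong_def)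
  have "{(c, d). c \<in> A \<and> d \<in> A \<and> c \<otimes>\<^bsub>BijGroup (carrier (galois_group L K))\<^esub> d = a i} = map_prod a a ` ?R"
    (is "?P = _")
  proof (intro equalityI subsetI)
    fix z assume "z \<in> ?P"
    then obtain k l where "k < q" "l < q" "z = (a k, a l)" "a k \<otimes>\<^bsub>BijGroup (carrier (galois_group L K))\<^esub> a l = a i"
      unfolding range_a by auto
    then show "z \<in> map_prod a a ` ?R"
      using assms(3) by (auto simp: a_add a_eq_iff cong_def)
  qed (use assms(3) in \<open>auto simp: a_add a_eq_iff cong_def\<close>)
  then have "(x \<otimes>\<^bsub>LA\<^esub> y) (a i) = (\<Oplus>z\<in>map_prod a a ` ?R. x (fst z) \<otimes> y (snd z))"
    by (simp add: group_algebra_apply)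
  also have "\<dots> = (\<Oplus>z\<in>?R. x (fst (map_prod a a z)) \<otimes> y (snd (map_prod a a z)))"
    by (rule finsum_reindex[OF _ inj]) (use assms mem_LA in auto)
  finally show ?thesis by simp
qed

definition fourier :: "((('a \<Rightarrow> 'a) \<Rightarrow> 'a \<Rightarrow> 'a) \<Rightarrow> 'a) \<Rightarrow> nat \<Rightarrow> 'a" where
  "fourier x = dft (\<lambda>i. x (a i))"

text \<open>Convolution becomes the pointwise product because each j defines a multiplicative
  character.\<close>

lemma fourier_mult:
  assumes "x \<in> carrier LA" "y \<in> carrier LA"
  shows "fourier (x \<otimes>\<^bsub>LA\<^esub> y) j = fourier x j \<otimes> fourier y j"
proof -
  let ?R = "\<lambda>i. {(k, l). k < q \<and> l < q \<and> (k + l) mod q = i}"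
  define f where "f = (\<lambda>k l. (\<zeta> [^] (k * j) \<otimes> x (a k)) \<otimes> (\<zeta> [^] (l * j) \<otimes> y (a l)))"
  have c: "x (a k) \<in> carrier L" "y (a k) \<in> carrier L" for k
    using assms by (auto simp: mem_LA)
  have fc: "f k l \<in> carrier L" for k l using c by (simp add: f_def)
  have finR: "finite (?R i)" for i
    by (rule finite_subset[of _ "{..<q} \<times> {..<q}"]) auto
  have "fourier (x \<otimes>\<^bsub>LA\<^esub> y) j = (\<Oplus>i\<in>{..<q}. \<Oplus>z\<in>?R i. f (fst z) (snd z))"
    unfolding fourier_def dft_def
  proof (intro add.finprod_cong' refl)
    fix i assume "i \<in> {..<q}"
    then have "\<zeta> [^] (i * j) \<otimes> (x \<otimes>\<^bsub>LA\<^esub> y) (a i) =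
        \<zeta> [^] (i * j) \<otimes> (\<Oplus>z\<in>?R i. x (a (fst z)) \<otimes> y (a (snd z)))"
      by (simp add: LA_mult_apply[OF assms])
    also have "\<dots> = (\<Oplus>z\<in>?R i. \<zeta> [^] (i * j) \<otimes> (x (a (fst z)) \<otimes> y (a (snd z))))"
      using c finR by (intro finsum_rdistr) auto
    also have "\<dots> = (\<Oplus>z\<in>?R i. f (fst z) (snd z))"
    proof (intro add.finprod_cong' refl)
      fix z assume "z \<in> ?R i"
      then have "\<zeta> [^] (i * j) = \<zeta> [^] ((fst z + snd z) * j)"
        by (intro root_pow_cong) (auto simp: cong_def mod_mult_left_eq)
      also have "\<dots> = \<zeta> [^] (fst z * j) \<otimes> \<zeta> [^] (snd z * j)"
        by (simp add: add_mult_distrib nat_pow_mult)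
      finally show "\<zeta> [^] (i * j) \<otimes> (x (a (fst z)) \<otimes> y (a (snd z))) = f (fst z) (snd z)"
        using c[of "fst z"] c[of "snd z"] by (simp add: f_def m_ac)
    qed (use fc in auto)
    finally show "\<zeta> [^] (i * j) \<otimes> (x \<otimes>\<^bsub>LA\<^esub> y) (a i) = (\<Oplus>z\<in>?R i. f (fst z) (snd z))" .
  qed (use fc in auto)
  \<comment> \<open>The pairs grouped by the residue of their sum partition the full square of
    indices, over which the double sum factors.\<close>
  also have "\<dots> = (\<Oplus>z\<in>(\<Union>i\<in>{..<q}. ?R i). f (fst z) (snd z))"
    using fc finR by (intro add.finprod_UN_disjoint[symmetric]) (auto simp: pairwise_def disjnt_def)
  also have "(\<Union>i\<in>{..<q}. ?R i) = {..<q} \<times> {..<q}"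
    using q_pos by auto
  also have "(\<Oplus>z\<in>{..<q} \<times> {..<q}. f (fst z) (snd z)) = (\<Oplus>k\<in>{..<q}. \<Oplus>l\<in>{..<q}. f k l)"
    using fc by (intro finsum_Sigma) auto
  also have "\<dots> = (\<Oplus>k\<in>{..<q}. (\<zeta> [^] (k * j) \<otimes> x (a k)) \<otimes> fourier y j)"
    using c unfolding f_def fourier_def dft_def
    by (intro add.finprod_cong') (auto simp: finsum_rdistr)
  also have "\<dots> = fourier x j \<otimes> fourier y j"
    using c unfolding fourier_def dft_def by (subst finsum_ldistr) auto
  finally show ?thesis .
qed

lemma fourier_add:
  assumes "x \<in> carrier LA" "y \<in> carrier LA"
  shows "fourier (x \<oplus>\<^bsub>LA\<^esub> y) j = fourier x j \<oplus> fourier y j"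
proof -
  have c: "x (a k) \<in> carrier L" "y (a k) \<in> carrier L" for k
    using assms by (auto simp: mem_LA)
  have "fourier (x \<oplus>\<^bsub>LA\<^esub> y) j = (\<Oplus>i\<in>{..<q}. \<zeta> [^] (i * j) \<otimes> x (a i) \<oplus> \<zeta> [^] (i * j) \<otimes> y (a i))"
    unfolding fourier_def dft_def using c
    by (intro add.finprod_cong') (auto simp: group_algebra_apply r_distr)
  also have "\<dots> = fourier x j \<oplus> fourier y j"
    unfolding fourier_def dft_def using c by (intro finsum_addf) auto
  finally show ?thesis .
qed

lemma fourier_smult:
  assumes "x \<in> carrier LA" "k \<in> carrier L"
  shows "fourier (k \<odot>\<^bsub>LA\<^esub> x) j = k \<otimes> fourier x j"
proof -
  have c: "x (a k) \<in> carrier L" for k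
    using assms by (auto simp: mem_LA)
  have "fourier (k \<odot>\<^bsub>LA\<^esub> x) j = (\<Oplus>i\<in>{..<q}. k \<otimes> (\<zeta> [^] (i * j) \<otimes> x (a i)))"
    unfolding fourier_def dft_def using c assms(2)
    by (intro add.finprod_cong') (auto simp: group_algebra_apply m_lcomm)
  also have "\<dots> = k \<otimes> fourier x j"
    unfolding fourier_def dft_def using c assms(2) by (subst finsum_rdistr) auto
  finally show ?thesis .
qed

lemma fourier_one: "fourier \<one>\<^bsub>LA\<^esub> j = \<one>"
proof -
  have one: "\<one>\<^bsub>LA\<^esub> (a i) = (if a i = a 0 then \<one> else \<zero>)" for i
    by (subst group_algebra_apply(3)) (simp_all add: one_eq)
  have "fourier \<one>\<^bsub>LA\<^esub> j = (\<Oplus>i\<in>{..<q}. if 0 = i then \<zeta> [^] (i * j) else \<zero>)"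
    unfolding fourier_def dft_def
    by (intro add.finprod_cong') (auto simp: one a_eq_iff cong_def)
  also have "\<dots> = \<zeta> [^] (0 * j)"
    using q_pos by (intro finsum_singleton) auto
  finally show ?thesis by simp
qed

text \<open>Invariance under G reduces to invariance under \<sigma>, since every element of G is the
  inverse of some power of \<sigma>.\<close>

lemma mem_fixed_algebra:
  "x \<in> carrier (fixed_algebra L K A) \<longleftrightarrow> x \<in> carrier LA \<and> (\<forall>i. \<sigma> (x (a i)) = x (a (u * i)))"
proof -
  interpret G: group "galois_group L K" by (rule group_galois_group)
  have "(\<forall>g\<in>carrier (galois_group L K). galois_action L K A g x = x) \<longleftrightarrow>
      (\<forall>i. \<sigma> (x (a i)) = x (a (u * i)))" if x: "x \<in> carrier LA"
  proof -
    have xc: "x (a i) \<in> carrier L" for i using x by (simp add: mem_LA)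
    \<comment> \<open>The action of g conjugates by the inverse of g. Taking g to be the inverse of
      \<sigma>^k turns this into conjugation by \<sigma>^k, to which \<open>a_conj\<close>
      applies.\<close>
    have fix_iff: "galois_action L K A (inv\<^bsub>galois_group L K\<^esub> (\<sigma> [^]\<^bsub>galois_group L K\<^esub> k)) x = x \<longleftrightarrow>
        (\<forall>i. (\<sigma> ^^ k) (x (a i)) = x (a (u ^ k * i)))" for k :: nat
    proof -
      let ?g = "\<sigma> [^]\<^bsub>galois_group L K\<^esub> k"
      have g: "?g \<in> carrier (galois_group L K)" using generator(1) by simp
      have "galois_action L K A (inv\<^bsub>galois_group L K\<^esub> ?g) x = x \<longleftrightarrow>
          (\<forall>i. (inv\<^bsub>galois_group L K\<^esub> ?g) (x (a (u ^ k * i))) = x (a i))"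
      proof
        assume *: "galois_action L K A (inv\<^bsub>galois_group L K\<^esub> ?g) x = x"
        show "\<forall>i. (inv\<^bsub>galois_group L K\<^esub> ?g) (x (a (u ^ k * i))) = x (a i)"
        proof
          fix i
          show "(inv\<^bsub>galois_group L K\<^esub> ?g) (x (a (u ^ k * i))) = x (a i)"
            using fun_cong[OF *, of "a i"] g by (simp add: galois_action_def a_conj)
        qed
      next
        assume *: "\<forall>i. (inv\<^bsub>galois_group L K\<^esub> ?g) (x (a (u ^ k * i))) = x (a i)"
        show "galois_action L K A (inv\<^bsub>galois_group L K\<^esub> ?g) x = x"
        proof (rule extensionalityI[of _ A])
          show "galois_action L K A (inv\<^bsub>galois_group L K\<^esub> ?g) x \<in> extensional A"
            by (simp add: galois_action_def)
          show "x \<in> extensional A" using x mem_LA by blast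
          fix c assume "c \<in> A"
          then obtain i where "c = a i" by blast
          then show "galois_action L K A (inv\<^bsub>galois_group L K\<^esub> ?g) x c = x c"
            using * g by (simp add: galois_action_def a_conj)
        qed
      qed
      also have "\<dots> \<longleftrightarrow> (\<forall>i. (\<sigma> ^^ k) (x (a i)) = x (a (u ^ k * i)))"
      proof -
        have ap: "?g y = (\<sigma> ^^ k) y" if "y \<in> carrier L" for y
          using pow_galois_group[OF generator(1)] that by simp
        have inv1: "(inv\<^bsub>galois_group L K\<^esub> ?g) (?g y) = y" if "y \<in> carrier L" for y
          using galois_group_mult_apply[OF G.inv_closed[OF g] g that] g that
          by (simp add: galois_group_one_apply)
        have inv2: "?g ((inv\<^bsub>galois_group L K\<^esub> ?g) y) = y" if "y \<in> carrier L" for y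
          using galois_group_mult_apply[OF g G.inv_closed[OF g] that] g that
          by (simp add: galois_group_one_apply)
        show ?thesis using ap inv1 inv2 xc by metis
      qed
      finally show ?thesis .
    qed
    show ?thesis
    proof
      assume "\<forall>g\<in>carrier (galois_group L K). galois_action L K A g x = x"
      then have "galois_action L K A (inv\<^bsub>galois_group L K\<^esub> (\<sigma> [^]\<^bsub>galois_group L K\<^esub> (1::nat))) x = x"
        using generator(1) by simp
      then show "\<forall>i. \<sigma> (x (a i)) = x (a (u * i))" unfolding fix_iff by simp
    next
      assume *: "\<forall>i. \<sigma> (x (a i)) = x (a (u * i))"
      have pow: "(\<sigma> ^^ k) (x (a i)) = x (a (u ^ k * i))" for k i
        by (induction k arbitrary: i) (use * in \<open>auto simp: mult.assoc\<close>)
      show "\<forall>g\<in>carrier (galois_group L K). galois_action L K A g x = x"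
      proof
        fix g assume g: "g \<in> carrier (galois_group L K)"
        then obtain k :: nat where "inv\<^bsub>galois_group L K\<^esub> g = \<sigma> [^]\<^bsub>galois_group L K\<^esub> k"
          using carrier_galois_group_eq G.inv_closed[OF g] by blast
        then have "g = inv\<^bsub>galois_group L K\<^esub> (\<sigma> [^]\<^bsub>galois_group L K\<^esub> k)"
          using g by (metis G.inv_inv)
        then show "galois_action L K A g x = x" using pow fix_iff by metis
      qed
    qed
  qed
  then show ?thesis by (auto simp: fixed_algebra_def Let_def)
qed

text \<open>By \<open>dil\<close> and \<open>gen\<close>, the twist condition compares the
  transforms of \<sigma> x(a_i) and of x(a_(u i)) at the points u j. As \<open>u\<close> is a unit
  these are all points, and the transform is injective.\<close>

lemma fourier_twisted_iff:
  assumes "x \<in> carrier LA"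
  shows "fourier x \<in> carrier (twisted_functions L \<sigma> q u) \<longleftrightarrow> x \<in> carrier (fixed_algebra L K A)"
proof -
  have c: "x (a i) \<in> carrier L" for i using assms by (simp add: mem_LA)
  have dil: "dft (\<lambda>i. x (a (u * i))) (u * j) = fourier x j" for j
    unfolding fourier_def by (rule dft_dilation) (simp_all add: c a_mod coprime_u)
  have gen: "\<sigma> (fourier x j) = dft (\<lambda>i. \<sigma> (x (a i))) j" for j
    unfolding fourier_def by (rule dft_generator) (rule c)
  have "fourier x \<in> carrier (twisted_functions L \<sigma> q u) \<longleftrightarrow> (\<forall>j. \<sigma> (fourier x (u * j)) = fourier x j)"
    unfolding carrier_twisted_functions
    using c dft_cong_arg[of "j mod q" j for j] by (auto simp: fourier_def dft_closed cong_def)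
  also have "\<dots> \<longleftrightarrow> (\<forall>j. dft (\<lambda>i. \<sigma> (x (a i))) (u * j) = dft (\<lambda>i. x (a (u * i))) (u * j))"
    by (simp add: gen dil)
  also have "\<dots> \<longleftrightarrow> (\<forall>j. dft (\<lambda>i. \<sigma> (x (a i))) j = dft (\<lambda>i. x (a (u * i))) j)"
  proof safe
    fix j
    assume *: "\<forall>j. dft (\<lambda>i. \<sigma> (x (a i))) (u * j) = dft (\<lambda>i. x (a (u * i))) (u * j)"
    \<comment> \<open>u^(q-1) serves as inverse of \<open>u\<close>, so an arbitrary
      \<open>j\<close> is a multiple of \<open>u\<close> modulo \<open>q\<close>.\<close>
    have "[u * (u ^ (q - 1) * j) = j] (mod q)"
      using cong_scalar_right[OF u_pow, of j] q_pos by (simp add: mult.assoc[symmetric] flip: power_Suc)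
    then show "dft (\<lambda>i. \<sigma> (x (a i))) j = dft (\<lambda>i. x (a (u * i))) j"
      using *[rule_format, of "u ^ (q - 1) * j"] dft_cong_arg by metis
  qed auto
  also have "\<dots> \<longleftrightarrow> (\<forall>i. \<sigma> (x (a i)) = x (a (u * i)))"
  proof safe
    fix i
    assume *: "\<forall>j. dft (\<lambda>i. \<sigma> (x (a i))) j = dft (\<lambda>i. x (a (u * i))) j"
    have "\<sigma> (x (a (i mod q))) = x (a (u * (i mod q)))"
      by (rule dft_inj[where g = "\<lambda>i. \<sigma> (x (a i))"]) (use * c q_pos in auto)
    moreover have "a (u * (i mod q)) = a (u * i)"
      by (simp add: a_eq_iff cong_def mod_mult_right_eq)
    ultimately show "\<sigma> (x (a i)) = x (a (u * i))" by (simp add: a_mod)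
  qed auto
  finally show ?thesis using assms by (simp add: mem_fixed_algebra)
qed

lemma fixed_algebra_ops:
  "monoid.mult (fixed_algebra L K A) = monoid.mult LA" "ring.add (fixed_algebra L K A) = ring.add LA"
  "monoid.one (fixed_algebra L K A) = monoid.one LA" "module.smult (fixed_algebra L K A) = module.smult LA"
  by (simp_all add: fixed_algebra_def Let_def)

text \<open>Read off on the transform side, where the operations are pointwise, instead of
  manipulating convolutions under the Galois action.\<close>

lemma fixed_algebra_closed:
  assumes "x \<in> carrier (fixed_algebra L K A)" "y \<in> carrier (fixed_algebra L K A)"
  shows "x \<otimes>\<^bsub>fixed_algebra L K A\<^esub> y \<in> carrier (fixed_algebra L K A)"
    "x \<oplus>\<^bsub>fixed_algebra L K A\<^esub> y \<in> carrier (fixed_algebra L K A)"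
    "k \<in> K \<Longrightarrow> k \<odot>\<^bsub>fixed_algebra L K A\<^esub> x \<in> carrier (fixed_algebra L K A)"
proof -
  have LA: "x \<in> carrier LA" "y \<in> carrier LA" using assms mem_fixed_algebra by auto
  have T: "fourier x \<in> carrier (twisted_functions L \<sigma> q u)" "fourier y \<in> carrier (twisted_functions L \<sigma> q u)"
    using assms LA fourier_twisted_iff by auto
  note cl = group_algebra_closed[OF LA]
  show "x \<otimes>\<^bsub>fixed_algebra L K A\<^esub> y \<in> carrier (fixed_algebra L K A)"
    using fourier_twisted_iff[OF cl(1)] twisted_functions_closed(1)[OF T]
    by (simp add: fixed_algebra_ops fourier_mult[OF LA, abs_def])
  show "x \<oplus>\<^bsub>fixed_algebra L K A\<^esub> y \<in> carrier (fixed_algebra L K A)"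
    using fourier_twisted_iff[OF cl(2)] twisted_functions_closed(2)[OF T]
    by (simp add: fixed_algebra_ops fourier_add[OF LA, abs_def])
  show "k \<odot>\<^bsub>fixed_algebra L K A\<^esub> x \<in> carrier (fixed_algebra L K A)" if "k \<in> K"
  proof -
    have k: "k \<in> carrier L" using that K_subset by blast
    show ?thesis
      using fourier_twisted_iff[OF cl(3)[OF k]] twisted_functions_closed(5)[OF that T(1)]
      by (simp add: fixed_algebra_ops fourier_smult[OF LA(1) k, abs_def])
  qed
qed

lemma fixed_algebra_one_closed: "\<one>\<^bsub>fixed_algebra L K A\<^esub> \<in> carrier (fixed_algebra L K A)"
proof -
  have one: "\<one>\<^bsub>LA\<^esub> \<in> carrier LA" by (auto simp: group_algebra_def)
  have "fourier \<one>\<^bsub>LA\<^esub> = (\<lambda>j. \<one>)" using fourier_one by blast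
  then show ?thesis
    using fourier_twisted_iff[OF one] twisted_functions_closed(3) by (simp add: fixed_algebra_ops)
qed

lemma fixed_algebra_isomorphic_twisted_functions:
  "algebra_isomorphic K (fixed_algebra L K A) (twisted_functions L \<sigma> q u)"
proof -
  have LA: "x \<in> carrier LA" if "x \<in> carrier (fixed_algebra L K A)" for x
    using that mem_fixed_algebra by blast
  have "fourier \<in> ring_iso (fixed_algebra L K A) (twisted_functions L \<sigma> q u)"
  proof (rule ring_iso_memI)
    have "inj_on fourier (carrier (fixed_algebra L K A))"
    proof
      fix x y assume xy: "x \<in> carrier (fixed_algebra L K A)" "y \<in> carrier (fixed_algebra L K A)"
        "fourier x = fourier y"
      show "x = y"
      proof (rule LA_eqI[OF LA[OF xy(1)] LA[OF xy(2)]])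
        fix i assume "i < q"
        show "x (a i) = y (a i)"
          using xy(3) LA[OF xy(1)] LA[OF xy(2)] \<open>i < q\<close>
          by (intro dft_inj[where g = "\<lambda>i. x (a i)"]) (auto simp: mem_LA fourier_def)
      qed
    qed
    moreover have "fourier ` carrier (fixed_algebra L K A) = carrier (twisted_functions L \<sigma> q u)"
    proof (intro equalityI subsetI)
      fix f assume f: "f \<in> carrier (twisted_functions L \<sigma> q u)"
      obtain g where g: "\<And>i. g i \<in> carrier L" "dft g = f"
        using dft_surj[of f] f unfolding carrier_twisted_functions by metis
      \<comment> \<open>Only the values of \<open>g\<close> below \<open>q\<close> matter for its
        transform, and on these indices \<open>a\<close> is injective.\<close>
      define x where "x = (\<lambda>c\<in>A. g (inv_into {..<q} a c))"
      have inj: "inj_on a {..<q}" by (auto simp: inj_on_def a_eq_iff cong_def)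
      have xa: "x (a i) = g i" if "i < q" for i
        using that inj by (simp add: x_def)
      have x: "x \<in> carrier LA" using g(1) by (simp add: mem_LA x_def)
      have "fourier x j = f j" for j
      proof -
        have "fourier x j = dft g j"
          unfolding fourier_def dft_def using g(1) by (intro add.finprod_cong') (auto simp: xa)
        then show ?thesis using g(2) by simp
      qed
      then have "fourier x = f" by blast
      then show "f \<in> fourier ` carrier (fixed_algebra L K A)"
        using fourier_twisted_iff[OF x] f by blast
    qed (use LA fourier_twisted_iff in auto)
    ultimately show "bij_betw fourier (carrier (fixed_algebra L K A)) (carrier (twisted_functions L \<sigma> q u))"
      by (simp add: bij_betw_def)
  qed (use LA fourier_twisted_iff fourier_one in
      \<open>auto simp: fixed_algebra_ops fourier_mult fourier_add fun_eq_iff\<close>)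
  moreover have "fourier (k \<odot>\<^bsub>fixed_algebra L K A\<^esub> x) = k \<odot>\<^bsub>twisted_functions L \<sigma> q u\<^esub> fourier x"
    if "k \<in> K" "x \<in> carrier (fixed_algebra L K A)" for k x
    using that LA K_subset fourier_smult[of x k] by (auto simp: fixed_algebra_ops fun_eq_iff)
  ultimately show ?thesis unfolding algebra_isomorphic_def by blast
qed

lemma twisted_functions_isomorphic_fixed_algebra:
  "algebra_isomorphic K (twisted_functions L \<sigma> q u) (fixed_algebra L K A)"
  by (rule algebra_isomorphic_sym[OF fixed_algebra_isomorphic_twisted_functions])
    (simp_all add: fixed_algebra_closed fixed_algebra_one_closed)

end

section \<open>Powers of a one-unit\<close>

lemma card_multiples_lessThan: "l > 0 \<Longrightarrow> card {j. j < m * l \<and> l dvd j} = m" for l m :: nat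
proof -
  assume l: "l > 0"
  have "{j. j < m * l \<and> l dvd j} = (\<lambda>i. l * i) ` {..<m}"
    using l by (auto simp: dvd_def image_iff mult.commute)
  then show ?thesis using l by (simp add: card_image inj_on_def)
qed

lemma mult_mod_fixed_iff:
  fixes u q j :: nat
  assumes "u > 0" "j < q"
  shows "u * j mod q = j \<longleftrightarrow> q dvd (u - 1) * j"
proof -
  have "u * j = (u - 1) * j + j" using assms(1) by (cases u) auto
  then have "u * j mod q = j \<longleftrightarrow> [(u - 1) * j + j = 0 + j] (mod q)"
    using assms(2) by (simp add: cong_def)
  also have "\<dots> \<longleftrightarrow> q dvd (u - 1) * j"
    unfolding cong_add_rcancel_nat by (simp add: cong_0_iff)
  finally show ?thesis .
qed

locale one_unit_generator =
  fixes p n d :: nat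
  assumes prime_p: "Factorial_Ring.prime p" and odd_p: "odd p" and n_pos: "n \<ge> 1"
    and d_cong: "[d = 1] (mod p)"
begin

lemma p_gt_1: "p > 1" using prime_p by (rule prime_gt_1_nat)

lemma d_pos: "d > 0"
proof (rule ccontr)
  assume "\<not> d > 0"
  with d_cong p_gt_1 show False by (simp add: cong_def)
qed

lemma p_dvd: "p dvd d - 1"
  using d_cong d_pos by (metis cong_to_1_nat)

text \<open>d - 1 contributes one factor p and the geometric sum of length p^(n-1) contributes n - 1
  more. Exponents of \<open>d\<close> therefore matter only modulo p^(n-1), the bound on r and
  s.\<close>

lemma power_unit_order: "[d ^ (p ^ (n - 1)) = 1] (mod p ^ n)"
proof -
  have "p ^ (n - 1) dvd (\<Sum>i<p ^ (n - 1). d ^ i)"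
    using prime_power_dvd_geometric_sum_iff[OF prime_p odd_p d_cong] by simp
  with p_dvd have "p * p ^ (n - 1) dvd d ^ (p ^ (n - 1)) - 1"
    unfolding power_minus_one_geometric_sum[OF d_pos] by (rule mult_dvd_mono)
  then have "p ^ n dvd d ^ (p ^ (n - 1)) - 1" using n_pos by (simp flip: power_Suc)
  then show ?thesis using d_pos by (simp add: cong_altdef_nat cong_sym)
qed

lemma power_cong_exponent:
  assumes "[i = j] (mod p ^ (n - 1))"
  shows "[d ^ i = d ^ j] (mod p ^ n)"
proof -
  have "[d ^ i = d ^ (i mod p ^ (n - 1))] (mod p ^ n)" for i
  proof -
    have "d ^ i = (d ^ (p ^ (n - 1))) ^ (i div p ^ (n - 1)) * d ^ (i mod p ^ (n - 1))"
      by (simp flip: power_mult power_add)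
    also have "[\<dots> = 1 ^ (i div p ^ (n - 1)) * d ^ (i mod p ^ (n - 1))] (mod p ^ n)"
      by (intro cong_mult cong_pow power_unit_order cong_refl)
    finally show ?thesis by simp
  qed
  from this[of i] this[of j] show ?thesis using assms by (simp add: cong_def)
qed

lemma unit_power_q: "[(d ^ s) ^ (p ^ n) = 1] (mod p ^ n)"
proof -
  have "[s * p ^ n = 0] (mod p ^ (n - 1))"
    unfolding cong_0_iff by (simp add: le_imp_power_dvd)
  from power_cong_exponent[OF this] show ?thesis by (simp flip: power_mult)
qed

text \<open>With r = p^v r' and s = p^v s', the prime-to-p part r' has an inverse \<open>x\<close>
  modulo p^(n-1), and t = x s' turns r into s.\<close>

lemma unit_power_conjugate:
  assumes "r > 0" "s > 0" "multiplicity p r = multiplicity p s"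
  obtains t where "[d ^ s = (d ^ r) ^ t] (mod p ^ n)"
proof -
  obtain r' where r': "r = p ^ multiplicity p r * r'" "\<not> p dvd r'"
    using multiplicity_decompose'[of r p] assms(1) prime_p
    by (metis neq0_conv not_prime_unit)
  obtain s' where s': "s = p ^ multiplicity p s * s'"
    using multiplicity_dvd[of p s] by blast
  have cop: "coprime r' (p ^ (n - 1))"
    using r'(2) prime_p by (metis coprime_commute coprime_power_right_iff prime_imp_coprime)
  obtain x where x: "[r' * x = 1] (mod p ^ (n - 1))"
    using cong_solve_coprime_nat[OF cop] by auto
  have "[r * (x * s') = s] (mod p ^ (n - 1))"
  proof -
    have "[p ^ multiplicity p r * s' * (r' * x) = p ^ multiplicity p r * s' * 1] (mod p ^ (n - 1))"
      using x by (rule cong_scalar_left)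
    moreover have "p ^ multiplicity p r * s' * (r' * x) = r * (x * s')"
      by (subst (2) r'(1)) (simp add: ac_simps)
    moreover have "p ^ multiplicity p r * s' * 1 = s"
      using s' assms(3) by simp
    ultimately show ?thesis by simp
  qed
  from power_cong_exponent[OF cong_sym[OF this]] have "[d ^ s = (d ^ r) ^ (x * s')] (mod p ^ n)"
    by (simp flip: power_mult)
  then show thesis by (rule that)
qed

text \<open>The value \<open>n - 1\<close> at \<open>0\<close> makes the count of fixed points uniform in \<open>s\<close>.\<close>

definition truncated_valuation :: "nat \<Rightarrow> nat" where
  "truncated_valuation s = (if s = 0 then n - 1 else multiplicity p s)"

lemma truncated_valuation_less:
  assumes "s < p ^ (n - 1)" "s > 0"
  shows "truncated_valuation s < n - 1"
proof -
  have "p ^ multiplicity p s \<le> s"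
    using assms(2) by (intro dvd_imp_le multiplicity_dvd)
  with assms(1) have "p ^ multiplicity p s < p ^ (n - 1)" by simp
  then show ?thesis
    using p_gt_1 assms(2) by (simp add: truncated_valuation_def)
qed

text \<open>Nonzero arguments below p^(n-1) have valuation less than n - 1, so n - 1 can replace
  infinity without a collision.\<close>

lemma truncated_valuation_eq_iff:
  assumes "r < p ^ (n - 1)" "s < p ^ (n - 1)"
  shows "truncated_valuation r = truncated_valuation s \<longleftrightarrow> vp p r = vp p s"
proof -
  have "truncated_valuation 0 = n - 1" by (simp add: truncated_valuation_def)
  then show ?thesis
    using truncated_valuation_less[OF assms(1)] truncated_valuation_less[OF assms(2)]
    by (cases "r = 0"; cases "s = 0") (auto simp: vp_def truncated_valuation_def)
qed

text \<open>For s > 0 of valuation w, d^s - 1 has valuation exactly w + 1, so \<open>j\<close> is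
  fixed exactly when p^(n-w-1) divides it; p^(w+1) residues do.\<close>

lemma card_fixed_residues:
  assumes nd: "\<not> p ^ 2 dvd d - 1" and s: "s < p ^ (n - 1)"
  shows "card {j. j < p ^ n \<and> d ^ s * j mod p ^ n = j} = p ^ Suc (truncated_valuation s)"
proof (cases "s = 0")
  case True
  have "{j. j < p ^ n \<and> d ^ s * j mod p ^ n = j} = {..<p ^ n}" using True by auto
  then show ?thesis using True n_pos by (simp add: truncated_valuation_def flip: power_Suc)
next
  case False
  define w where "w = multiplicity p s"
  have w: "w < n - 1" using truncated_valuation_less[OF s] False by (simp add: w_def truncated_valuation_def)
  obtain c where c: "d - 1 = p * c" using p_dvd by blast
  have pc: "\<not> p dvd c" using nd unfolding c power2_eq_square by auto
  \<comment> \<open>\<open>c\<close> is prime to p, so d - 1 supplies one factor p and the geometric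
    sum supplies those of \<open>s\<close>.\<close>
  have iff: "p ^ Suc k dvd d ^ s - 1 \<longleftrightarrow> p ^ k dvd s" for k
  proof -
    have "p ^ Suc k dvd d ^ s - 1 \<longleftrightarrow> p ^ k dvd c * (\<Sum>i<s. d ^ i)"
      unfolding power_minus_one_geometric_sum[OF d_pos] c using p_gt_1 by (simp add: mult.assoc)
    also have "\<dots> \<longleftrightarrow> p ^ k dvd (\<Sum>i<s. d ^ i)"
      using pc prime_p by (intro coprime_dvd_mult_right_iff) (metis coprime_power_left_iff prime_imp_coprime)
    also have "\<dots> \<longleftrightarrow> p ^ k dvd s"
      by (rule prime_power_dvd_geometric_sum_iff[OF prime_p odd_p d_cong])
    finally show ?thesis .
  qed
  have "p ^ Suc w dvd d ^ s - 1" unfolding iff by (simp add: w_def multiplicity_dvd)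
  then obtain e where e: "d ^ s - 1 = p ^ Suc w * e" by blast
  have "\<not> p ^ Suc w dvd s"
    using False p_gt_1 by (simp add: w_def power_dvd_iff_le_multiplicity del: power_Suc)
  then have "\<not> p ^ Suc (Suc w) dvd d ^ s - 1" unfolding iff .
  then have pe: "\<not> p dvd e" unfolding e by (auto simp: mult.commute mult_dvd_mono)
  define l where "l = p ^ (n - Suc w)"
  have q: "p ^ n = p ^ Suc w * l" using w by (simp add: l_def flip: power_add del: power_Suc)
  have "d ^ s * j mod p ^ n = j \<longleftrightarrow> l dvd j" if "j < p ^ n" for j
  proof -
    have "d ^ s * j mod p ^ n = j \<longleftrightarrow> p ^ n dvd (d ^ s - 1) * j"
      using that d_pos by (intro mult_mod_fixed_iff) auto
    also have "\<dots> \<longleftrightarrow> l dvd e * j"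
      unfolding e q using p_gt_1 by (simp add: mult.assoc)
    also have "\<dots> \<longleftrightarrow> l dvd j"
      unfolding l_def using pe prime_p by (intro coprime_dvd_mult_right_iff) (metis coprime_power_left_iff prime_imp_coprime)
    finally show ?thesis .
  qed
  then have "{j. j < p ^ n \<and> d ^ s * j mod p ^ n = j} = {j. j < p ^ Suc w * l \<and> l dvd j}"
    unfolding q by auto
  then show ?thesis
    using card_multiples_lessThan[of l "p ^ Suc w"] p_gt_1 False
    by (simp add: truncated_valuation_def w_def l_def)
qed

end

section \<open>Regular embeddings of cyclic groups\<close>

text \<open>Justifies the definite description in \<open>beta\<close>. Existence: exponents of the
  same element differ by a multiple of the order of \<sigma>, which \<tau> respects. Uniqueness: the
  value at \<sigma> determines all values, and extensionality those off the carrier.\<close>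

lemma (in group) the_cyclic_hom_pow:
  fixes H (structure)
  assumes "group H" "\<sigma> \<in> carrier G" "carrier G = {\<sigma> [^] k | k::nat. True}"
    and "\<tau> \<in> carrier H" "\<tau> [^]\<^bsub>H\<^esub> ord \<sigma> = \<one>\<^bsub>H\<^esub>"
  defines "h \<equiv> (THE h. h \<in> hom G H \<and> h \<in> extensional (carrier G) \<and> h \<sigma> = \<tau>)"
  shows "h (\<sigma> [^] (k::nat)) = \<tau> [^]\<^bsub>H\<^esub> k"
proof -
  interpret H: group H by fact
  have pow_hom: "f (\<sigma> [^] k) = \<tau> [^]\<^bsub>H\<^esub> k" if "f \<in> hom G H" "f \<sigma> = \<tau>" for f and k :: nat
    using hom_nat_pow[OF that(1) assms(2) group_axioms assms(1)] that(2) by simp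
  define f where "f = (\<lambda>g\<in>carrier G. \<tau> [^]\<^bsub>H\<^esub> (SOME k::nat. \<sigma> [^] k = g))"
  have f_pow: "f (\<sigma> [^] k) = \<tau> [^]\<^bsub>H\<^esub> k" for k :: nat
  proof -
    define l where "l = (SOME l::nat. \<sigma> [^] l = \<sigma> [^] k)"
    have "\<sigma> [^] l = \<sigma> [^] k" unfolding l_def by (rule someI) simp
    then have "int (ord \<sigma>) dvd int k - int l"
      using int_pow_eq[OF assms(2), of "int l" "int k"] by (simp add: int_pow_int)
    moreover have "int (H.ord \<tau>) dvd int (ord \<sigma>)"
      using assms(5) H.pow_eq_id[OF assms(4)] by simp
    ultimately have "int (H.ord \<tau>) dvd int k - int l" by (rule dvd_trans[rotated])
    then have "\<tau> [^]\<^bsub>H\<^esub> l = \<tau> [^]\<^bsub>H\<^esub> k"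
      using H.int_pow_eq[OF assms(4), of "int l" "int k"] by (simp add: int_pow_int)
    then show ?thesis using assms(2) by (simp add: f_def l_def)
  qed
  have f: "f \<in> hom G H \<and> f \<in> extensional (carrier G) \<and> f \<sigma> = \<tau>"
  proof (intro conjI)
    show "f \<in> hom G H"
    proof (rule homI)
      fix x assume "x \<in> carrier G"
      then show "f x \<in> carrier H" using assms(3,4) f_pow by auto
    next
      fix x y assume "x \<in> carrier G" "y \<in> carrier G"
      then obtain i j :: nat where "x = \<sigma> [^] i" "y = \<sigma> [^] j" using assms(3) by auto
      then show "f (x \<otimes> y) = f x \<otimes>\<^bsub>H\<^esub> f y"
        using assms(2,4) by (simp add: nat_pow_mult f_pow H.nat_pow_mult)
    qed
    show "f \<in> extensional (carrier G)" by (simp add: f_def)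
    show "f \<sigma> = \<tau>" using f_pow[of 1] assms(2,4) by simp
  qed
  have "h = f"
    unfolding h_def
  proof (rule the_equality)
    show "f \<in> hom G H \<and> f \<in> extensional (carrier G) \<and> f \<sigma> = \<tau>" by (rule f)
  next
    fix g assume g: "g \<in> hom G H \<and> g \<in> extensional (carrier G) \<and> g \<sigma> = \<tau>"
    show "g = f"
    proof (rule extensionalityI[of _ "carrier G"])
      fix x assume "x \<in> carrier G"
      then obtain k :: nat where "x = \<sigma> [^] k" using assms(3) by auto
      then show "g x = f x" using pow_hom[of g k] g f_pow by simp
    qed (use f g in auto)
  qed
  then show ?thesis by (simp add: f_pow)
qed

lemma left_regular_Bij:
  assumes "group G" "g \<in> carrier G"
  shows "left_regular G g \<in> Bij (carrier G)"
proof -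
  interpret G: group G by fact
  have "bij_betw (\<lambda>x. g \<otimes>\<^bsub>G\<^esub> x) (carrier G) (carrier G)"
    by (rule bij_betw_byWitness[where f' = "\<lambda>x. inv\<^bsub>G\<^esub> g \<otimes>\<^bsub>G\<^esub> x"])
      (use assms(2) in \<open>auto simp: G.m_assoc[symmetric]\<close>)
  then have "bij_betw (left_regular G g) (carrier G) (carrier G)"
    by (rule bij_betw_cong[THEN iffD1, rotated]) (simp add: left_regular_def)
  then show ?thesis by (simp add: Bij_def left_regular_def)
qed

text \<open>Conjugation is checked as a commutation with left translation, so no inverse permutation
  has to be evaluated.\<close>

lemma conj_action_eqI:
  assumes "group G" "g \<in> carrier G" "\<mu> \<in> Bij (carrier G)" "\<mu>' \<in> Bij (carrier G)"
    and "\<And>x. x \<in> carrier G \<Longrightarrow> g \<otimes>\<^bsub>G\<^esub> \<mu> x = \<mu>' (g \<otimes>\<^bsub>G\<^esub> x)"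
  shows "conj_action G g \<mu> = \<mu>'"
proof -
  interpret G: group G by fact
  interpret B: group "BijGroup (carrier G)" by (rule group_BijGroup)
  let ?l = "left_regular G g"
  have l: "?l \<in> Bij (carrier G)" by (rule left_regular_Bij[OF assms(1,2)])
  have "?l \<otimes>\<^bsub>BijGroup (carrier G)\<^esub> \<mu> = \<mu>' \<otimes>\<^bsub>BijGroup (carrier G)\<^esub> ?l"
    unfolding mult_BijGroup[OF l assms(3)] mult_BijGroup[OF assms(4) l]
  proof (rule extensionalityI[of _ "carrier G"])
    fix x assume x: "x \<in> carrier G"
    then have "\<mu> x \<in> carrier G" using assms(3) Bij_imp_funcset by blast
    then show "compose (carrier G) ?l \<mu> x = compose (carrier G) \<mu>' ?l x"
      using x assms(2,5) by (simp add: compose_def left_regular_def)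
  qed auto
  moreover have "?l \<in> carrier (BijGroup (carrier G))" "\<mu>' \<in> carrier (BijGroup (carrier G))"
    using l assms(4) by (simp_all only: carrier_BijGroup)
  ultimately show ?thesis
    unfolding conj_action_def by (simp add: B.m_assoc)
qed

text \<open>\<open>e\<close> is the exponent by which \<delta>^s acts on \<eta>; in the application
  it is d^s.\<close>

locale cyclic_regular_embedding =
  G: group G + N: group N for G :: "('g, 'b) monoid_scheme" and N :: "('n, 'c) monoid_scheme" +
  fixes \<sigma> :: 'g and \<eta> :: 'n and \<delta> :: "'n \<Rightarrow> 'n" and p n s e :: nat
  assumes prime_p: "Factorial_Ring.prime p" and odd_p: "odd p"
    and e_cong: "[e = 1] (mod p)" and e_pow: "[e ^ (p ^ n) = 1] (mod p ^ n)"
    and \<sigma>: "\<sigma> \<in> carrier G" "carrier G = {\<sigma> [^]\<^bsub>G\<^esub> k | k::nat. True}" "G.ord \<sigma> = p ^ n"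
    and \<eta>: "\<eta> \<in> carrier N" "carrier N = {\<eta> [^]\<^bsub>N\<^esub> k | k::nat. True}" "N.ord \<eta> = p ^ n"
    and \<delta>: "\<delta> [^]\<^bsub>AutoGroup N\<^esub> s \<in> auto N" "(\<delta> [^]\<^bsub>AutoGroup N\<^esub> s) \<eta> = \<eta> [^]\<^bsub>N\<^esub> e"
begin

definition "\<epsilon> = \<delta> [^]\<^bsub>AutoGroup N\<^esub> s"
text \<open>The prescribed value of \<beta>_s at \<sigma>.\<close>

definition "\<tau> = right_regular N \<eta> \<otimes>\<^bsub>BijGroup (carrier N)\<^esub> \<epsilon>"
definition "b = b_map G \<sigma> N \<eta> \<delta> s"
definition "\<alpha> = alpha G \<sigma> N \<eta> \<delta> s"

lemma \<epsilon>_Bij: "\<epsilon> \<in> Bij (carrier N)" and \<epsilon>_hom: "\<epsilon> \<in> hom N N"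
  using \<delta>(1) by (auto simp: \<epsilon>_def auto_def)

lemma \<epsilon>_closed [simp]: "x \<in> carrier N \<Longrightarrow> \<epsilon> x \<in> carrier N"
  using \<epsilon>_hom by (auto simp: hom_def)

lemma \<epsilon>_int_pow: "\<epsilon> (\<eta> [^]\<^bsub>N\<^esub> (i::int)) = \<eta> [^]\<^bsub>N\<^esub> (int e * i)"
proof -
  have "\<epsilon> (\<eta> [^]\<^bsub>N\<^esub> i) = (\<epsilon> \<eta>) [^]\<^bsub>N\<^esub> i"
    using hom_int_pow[OF \<epsilon>_hom \<eta>(1) N.group_axioms N.group_axioms] by simp
  also have "\<dots> = \<eta> [^]\<^bsub>N\<^esub> (int e * i)"
    using \<delta>(2) \<eta>(1) N.int_pow_pow by (simp add: \<epsilon>_def flip: int_pow_int)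
  finally show ?thesis .
qed

lemma right_regular_Bij: "right_regular N \<eta> \<in> Bij (carrier N)"
proof -
  have "bij_betw (\<lambda>x. x \<otimes>\<^bsub>N\<^esub> inv\<^bsub>N\<^esub> \<eta>) (carrier N) (carrier N)"
    by (rule bij_betw_byWitness[where f' = "\<lambda>x. x \<otimes>\<^bsub>N\<^esub> \<eta>"])
      (use \<eta>(1) in \<open>auto simp: N.m_assoc\<close>)
  then have "bij_betw (right_regular N \<eta>) (carrier N) (carrier N)"
    by (rule bij_betw_cong[THEN iffD1, rotated]) (simp add: right_regular_def)
  then show ?thesis by (simp add: Bij_def right_regular_def)
qed

lemma \<tau>_Bij: "\<tau> \<in> Bij (carrier N)"
  unfolding \<tau>_def mult_BijGroup[OF right_regular_Bij \<epsilon>_Bij]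
  by (rule compose_Bij[OF right_regular_Bij \<epsilon>_Bij])

lemma \<tau>_apply: "x \<in> carrier N \<Longrightarrow> \<tau> x = \<epsilon> x \<otimes>\<^bsub>N\<^esub> inv\<^bsub>N\<^esub> \<eta>"
  unfolding \<tau>_def mult_BijGroup_apply[OF right_regular_Bij \<epsilon>_Bij] by (simp add: right_regular_def)

lemma \<tau>_closed [simp]: "x \<in> carrier N \<Longrightarrow> \<tau> x \<in> carrier N"
  using \<eta>(1) by (simp add: \<tau>_apply)

lemma funpow_\<tau>_closed [simp]: "x \<in> carrier N \<Longrightarrow> (\<tau> ^^ k) x \<in> carrier N"
  by (induction k) auto

lemma funpow_\<epsilon>_closed [simp]: "x \<in> carrier N \<Longrightarrow> (\<epsilon> ^^ k) x \<in> carrier N"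
  by (induction k) auto

lemma \<tau>_int_pow: "\<tau> (\<eta> [^]\<^bsub>N\<^esub> (i::int)) = \<eta> [^]\<^bsub>N\<^esub> (int e * i - 1)"
  using \<eta>(1) by (simp add: \<tau>_apply \<epsilon>_int_pow N.int_pow_diff)

text \<open>On exponents \<tau> is the affine map i \<mapsto> e i - 1, and the translations
  accumulate to a geometric sum. Integer exponents accommodate the sign.\<close>

lemma funpow_\<tau>_int_pow:
  "(\<tau> ^^ k) (\<eta> [^]\<^bsub>N\<^esub> (i::int)) = \<eta> [^]\<^bsub>N\<^esub> (int (e ^ k) * i - int (\<Sum>j<k. e ^ j))"
proof (induction k)
  case (Suc k)
  have "(\<tau> ^^ Suc k) (\<eta> [^]\<^bsub>N\<^esub> i) = \<tau> (\<eta> [^]\<^bsub>N\<^esub> (int (e ^ k) * i - int (\<Sum>j<k. e ^ j)))"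
    using Suc by simp
  also have "\<dots> = \<eta> [^]\<^bsub>N\<^esub> (int e * (int (e ^ k) * i - int (\<Sum>j<k. e ^ j)) - 1)"
    by (rule \<tau>_int_pow)
  also have "int e * (int (e ^ k) * i - int (\<Sum>j<k. e ^ j)) - 1 = int (e ^ Suc k) * i - int (\<Sum>j<Suc k. e ^ j)"
    unfolding sum.lessThan_Suc_shift by (simp add: algebra_simps sum_distrib_left)
  finally show ?case .
qed simp

lemma carrier_N_int_pow: "x \<in> carrier N \<Longrightarrow> \<exists>i::int. x = \<eta> [^]\<^bsub>N\<^esub> i"
proof -
  assume "x \<in> carrier N"
  then obtain k :: nat where "x = \<eta> [^]\<^bsub>N\<^esub> k" unfolding \<eta>(2) by blast
  then show ?thesis by (metis int_pow_int)
qed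

text \<open>Both parts of the affine map become trivial: e^q = 1 modulo q, and the sum of length q
  is divisible by q. This is what the existence of \<beta>_s needs.\<close>

lemma \<tau>_pow_q: "\<tau> [^]\<^bsub>BijGroup (carrier N)\<^esub> (p ^ n) = \<one>\<^bsub>BijGroup (carrier N)\<^esub>"
proof -
  have "(\<tau> ^^ (p ^ n)) x = x" if x: "x \<in> carrier N" for x
  proof -
    obtain i :: int where i: "x = \<eta> [^]\<^bsub>N\<^esub> i" using carrier_N_int_pow[OF x] by blast
    have 1: "int (p ^ n) dvd int (e ^ (p ^ n)) - 1"
      using e_pow by (metis cong_iff_dvd_diff cong_int_iff of_nat_1)
    have 2: "int (p ^ n) dvd int (\<Sum>j<p ^ n. e ^ j)"
      unfolding of_nat_dvd_iff prime_power_dvd_geometric_sum_iff[OF prime_p odd_p e_cong] by simp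
    have "i - (int (e ^ (p ^ n)) * i - int (\<Sum>j<p ^ n. e ^ j)) =
        int (\<Sum>j<p ^ n. e ^ j) - (int (e ^ (p ^ n)) - 1) * i"
      by (simp only: left_diff_distrib mult_1_left)
    then have "int (p ^ n) dvd i - (int (e ^ (p ^ n)) * i - int (\<Sum>j<p ^ n. e ^ j))"
      using 1 2 by (metis dvd_diff dvd_mult2)
    then show ?thesis
      unfolding i funpow_\<tau>_int_pow N.int_pow_eq[OF \<eta>(1)] \<eta>(3) by simp
  qed
  then have "restrict (\<tau> ^^ (p ^ n)) (carrier N) = (\<lambda>x\<in>carrier N. x)"
    by (rule restrict_ext)
  then show ?thesis
    unfolding nat_pow_BijGroup[OF \<tau>_Bij] by (simp add: BijGroup_def)
qed

lemma b_pow: "b (\<sigma> [^]\<^bsub>G\<^esub> k) = (\<tau> ^^ k) \<one>\<^bsub>N\<^esub>" for k :: nat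
proof -
  have \<tau>: "\<tau> \<in> carrier (BijGroup (carrier N))" using \<tau>_Bij by (simp only: carrier_BijGroup)
  have "beta G \<sigma> N \<eta> \<delta> s (\<sigma> [^]\<^bsub>G\<^esub> k) = \<tau> [^]\<^bsub>BijGroup (carrier N)\<^esub> k"
    unfolding beta_def \<epsilon>_def[symmetric] \<tau>_def[symmetric]
    using \<tau>_pow_q \<sigma>(3)
    by (intro G.the_cyclic_hom_pow group_BijGroup \<sigma>(1,2) \<tau>) simp
  then show ?thesis
    unfolding nat_pow_BijGroup[OF \<tau>_Bij] by (simp add: b_def b_map_def)
qed

lemma b_pow_int: "b (\<sigma> [^]\<^bsub>G\<^esub> k) = \<eta> [^]\<^bsub>N\<^esub> (- int (\<Sum>j<k. e ^ j))" for k :: nat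
  using funpow_\<tau>_int_pow[of k 0] by (simp add: b_pow)

lemma b_closed [simp]: "g \<in> carrier G \<Longrightarrow> b g \<in> carrier N"
proof -
  assume "g \<in> carrier G"
  then obtain k :: nat where "g = \<sigma> [^]\<^bsub>G\<^esub> k" unfolding \<sigma>(2) by blast
  then show ?thesis by (simp add: b_pow)
qed

lemma b_mult: "g \<in> carrier G \<Longrightarrow> b (\<sigma> [^]\<^bsub>G\<^esub> k \<otimes>\<^bsub>G\<^esub> g) = (\<tau> ^^ k) (b g)" for k :: nat
proof -
  assume "g \<in> carrier G"
  then obtain l :: nat where "g = \<sigma> [^]\<^bsub>G\<^esub> l" unfolding \<sigma>(2) by blast
  then show ?thesis using \<sigma>(1) by (simp add: G.nat_pow_mult b_pow funpow_add)
qed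

lemma coprime_e: "coprime e p"
  using cong_imp_coprime[OF cong_sym[OF e_cong]] by simp

text \<open>Equal values at \<sigma>^k and \<sigma>^(k+m) mean that q divides e^k times the
  geometric sum of length m. As \<open>e\<close> is prime to p, q divides m.\<close>

lemma b_inj: "inj_on b (carrier G)"
proof -
  have le: "\<sigma> [^]\<^bsub>G\<^esub> k = \<sigma> [^]\<^bsub>G\<^esub> l" if kl: "k \<le> l" "b (\<sigma> [^]\<^bsub>G\<^esub> k) = b (\<sigma> [^]\<^bsub>G\<^esub> l)" for k l :: nat
  proof -
    obtain m where m: "l = k + m" using kl(1) le_Suc_ex by blast
    have "int (p ^ n) dvd - int (\<Sum>j<l. e ^ j) - (- int (\<Sum>j<k. e ^ j))"
      using kl(2) unfolding b_pow_int N.int_pow_eq[OF \<eta>(1)] \<eta>(3) .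
    also have "- int (\<Sum>j<l. e ^ j) - (- int (\<Sum>j<k. e ^ j)) = - int (e ^ k * (\<Sum>j<m. e ^ j))"
      unfolding m geometric_sum_add by simp
    finally have "p ^ n dvd e ^ k * (\<Sum>j<m. e ^ j)"
      by (simp only: dvd_minus_iff of_nat_dvd_iff)
    then have "p ^ n dvd (\<Sum>j<m. e ^ j)"
      using coprime_e by (subst (asm) coprime_dvd_mult_right_iff) (auto simp: coprime_commute)
    then have "p ^ n dvd m"
      unfolding prime_power_dvd_geometric_sum_iff[OF prime_p odd_p e_cong] .
    then have "\<sigma> [^]\<^bsub>G\<^esub> m = \<one>\<^bsub>G\<^esub>" using G.pow_eq_id[OF \<sigma>(1)] \<sigma>(3) by simp
    then show ?thesis using \<sigma>(1) by (simp add: m G.nat_pow_mult[symmetric])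
  qed
  show ?thesis
  proof
    fix x y assume "x \<in> carrier G" "y \<in> carrier G" "b x = b y"
    then obtain k l :: nat where "x = \<sigma> [^]\<^bsub>G\<^esub> k" "y = \<sigma> [^]\<^bsub>G\<^esub> l" "b x = b y" unfolding \<sigma>(2) by blast
    then show "x = y" using le[of k l] le[of l k] by (metis nat_le_linear)
  qed
qed

lemma card_carriers: "card (carrier G) = p ^ n" "card (carrier N) = p ^ n"
proof -
  have p: "p ^ n \<noteq> 0" using prime_gt_1_nat[OF prime_p] by simp
  show "card (carrier G) = p ^ n"
  proof -
    have "generate G {\<sigma>} = {\<sigma> [^]\<^bsub>G\<^esub> k | k. k \<in> (UNIV :: nat set)}"
      by (rule G.generate_pow_nat[OF \<sigma>(1)]) (use \<sigma>(3) p in simp)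
    then have "generate G {\<sigma>} = carrier G" unfolding \<sigma>(2) by simp
    then show ?thesis using G.generate_pow_card[OF \<sigma>(1)] \<sigma>(3) by simp
  qed
  show "card (carrier N) = p ^ n"
  proof -
    have "generate N {\<eta>} = {\<eta> [^]\<^bsub>N\<^esub> k | k. k \<in> (UNIV :: nat set)}"
      by (rule N.generate_pow_nat[OF \<eta>(1)]) (use \<eta>(3) p in simp)
    then have "generate N {\<eta>} = carrier N" unfolding \<eta>(2) by simp
    then show ?thesis using N.generate_pow_card[OF \<eta>(1)] \<eta>(3) by simp
  qed
qed

lemma b_bij: "bij_betw b (carrier G) (carrier N)"
proof -
  have "finite (carrier N)"
    using card_carriers(2) prime_gt_1_nat[OF prime_p] by (intro card_ge_0_finite) simp
  moreover have "b ` carrier G \<subseteq> carrier N" by auto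
  moreover have "card (b ` carrier G) = card (carrier N)"
    using card_image[OF b_inj] card_carriers by simp
  ultimately have "b ` carrier G = carrier N" by (rule card_subset_eq)
  then show ?thesis using b_inj by (simp add: bij_betw_def)
qed

lemma b_\<alpha>:
  assumes "\<nu> \<in> carrier N" "g \<in> carrier G"
  shows "\<alpha> \<nu> g \<in> carrier G" "b (\<alpha> \<nu> g) = \<nu> \<otimes>\<^bsub>N\<^esub> b g"
proof -
  have eq: "\<alpha> \<nu> g = inv_into (carrier G) b (\<nu> \<otimes>\<^bsub>N\<^esub> b g)"
    using assms by (simp add: \<alpha>_def alpha_def b_def[symmetric] left_regular_def)
  have mem: "\<nu> \<otimes>\<^bsub>N\<^esub> b g \<in> b ` carrier G"
    using assms bij_betw_imp_surj_on[OF b_bij] by simp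
  show "\<alpha> \<nu> g \<in> carrier G" "b (\<alpha> \<nu> g) = \<nu> \<otimes>\<^bsub>N\<^esub> b g"
    unfolding eq using mem by (auto intro: inv_into_into f_inv_into_f)
qed

lemma \<alpha>_eqI:
  assumes "\<nu> \<in> carrier N" "g \<in> carrier G" "h \<in> carrier G" "b h = \<nu> \<otimes>\<^bsub>N\<^esub> b g"
  shows "\<alpha> \<nu> g = h"
  using inj_onD[OF b_inj] b_\<alpha>[OF assms(1,2)] assms(3,4) by metis

lemma \<alpha>_mult_apply:
  assumes "\<mu> \<in> carrier N" "\<nu> \<in> carrier N" "g \<in> carrier G"
  shows "\<alpha> \<mu> (\<alpha> \<nu> g) = \<alpha> (\<mu> \<otimes>\<^bsub>N\<^esub> \<nu>) g"
  using assms by (intro \<alpha>_eqI[symmetric]) (auto simp: b_\<alpha> N.m_assoc)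

lemma \<alpha>_one_apply: "g \<in> carrier G \<Longrightarrow> \<alpha> \<one>\<^bsub>N\<^esub> g = g"
  by (intro \<alpha>_eqI) auto

lemma \<alpha>_Bij:
  assumes "\<nu> \<in> carrier N"
  shows "\<alpha> \<nu> \<in> Bij (carrier G)"
proof -
  have "bij_betw (\<alpha> \<nu>) (carrier G) (carrier G)"
    by (rule bij_betw_byWitness[where f' = "\<alpha> (inv\<^bsub>N\<^esub> \<nu>)"])
      (use assms in \<open>auto simp: \<alpha>_mult_apply \<alpha>_one_apply b_\<alpha>\<close>)
  moreover have "\<alpha> \<nu> \<in> extensional (carrier G)" by (simp add: \<alpha>_def alpha_def)
  ultimately show ?thesis by (simp add: Bij_def)
qed

lemma \<alpha>_mult:
  assumes "\<mu> \<in> carrier N" "\<nu> \<in> carrier N"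
  shows "\<alpha> \<mu> \<otimes>\<^bsub>BijGroup (carrier G)\<^esub> \<alpha> \<nu> = \<alpha> (\<mu> \<otimes>\<^bsub>N\<^esub> \<nu>)"
proof -
  have "compose (carrier G) (\<alpha> \<mu>) (\<alpha> \<nu>) = \<alpha> (\<mu> \<otimes>\<^bsub>N\<^esub> \<nu>)"
  proof (rule extensionalityI[of _ "carrier G"])
    show "\<alpha> (\<mu> \<otimes>\<^bsub>N\<^esub> \<nu>) \<in> extensional (carrier G)" by (simp add: \<alpha>_def alpha_def)
  qed (use assms in \<open>auto simp: compose_def \<alpha>_mult_apply\<close>)
  then show ?thesis unfolding mult_BijGroup[OF \<alpha>_Bij[OF assms(1)] \<alpha>_Bij[OF assms(2)]] .
qed

lemma \<alpha>_inj: "inj_on \<alpha> (carrier N)"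
proof
  fix \<mu> \<nu> assume *: "\<mu> \<in> carrier N" "\<nu> \<in> carrier N" "\<alpha> \<mu> = \<alpha> \<nu>"
  have "\<mu> \<otimes>\<^bsub>N\<^esub> b \<one>\<^bsub>G\<^esub> = b (\<alpha> \<mu> \<one>\<^bsub>G\<^esub>)"
    by (rule b_\<alpha>(2)[OF *(1) G.one_closed, symmetric])
  also have "\<dots> = \<nu> \<otimes>\<^bsub>N\<^esub> b \<one>\<^bsub>G\<^esub>"
    unfolding *(3) by (rule b_\<alpha>(2)[OF *(2) G.one_closed])
  finally show "\<mu> = \<nu>" using *(1,2) N.r_cancel[of "b \<one>\<^bsub>G\<^esub>" \<mu> \<nu>] by simp
qed

text \<open>\<tau> is an automorphism followed by a translation, so left factors feel only the
  automorphism.\<close>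

lemma funpow_\<tau>_mult:
  assumes "\<nu> \<in> carrier N" "x \<in> carrier N"
  shows "(\<tau> ^^ k) (\<nu> \<otimes>\<^bsub>N\<^esub> x) = (\<epsilon> ^^ k) \<nu> \<otimes>\<^bsub>N\<^esub> (\<tau> ^^ k) x"
proof (induction k)
  case (Suc k)
  then show ?case
    using assms \<eta>(1) hom_mult[OF \<epsilon>_hom] by (simp add: \<tau>_apply N.m_assoc)
qed simp

text \<open>Under \<open>b\<close>, left translation by \<sigma> becomes \<tau>, and conjugating
  left translation by \<nu> with \<tau> gives left translation by the image of \<nu> under
  \<epsilon>.\<close>

lemma conj_action_\<alpha>:
  fixes k :: nat
  assumes "\<nu> \<in> carrier N"
  shows "conj_action G (\<sigma> [^]\<^bsub>G\<^esub> k) (\<alpha> \<nu>) = \<alpha> ((\<epsilon> ^^ k) \<nu>)"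
proof (rule conj_action_eqI)
  fix x assume x: "x \<in> carrier G"
  show "\<sigma> [^]\<^bsub>G\<^esub> k \<otimes>\<^bsub>G\<^esub> \<alpha> \<nu> x = \<alpha> ((\<epsilon> ^^ k) \<nu>) (\<sigma> [^]\<^bsub>G\<^esub> k \<otimes>\<^bsub>G\<^esub> x)"
    using assms x \<sigma>(1) by (intro \<alpha>_eqI[symmetric]) (auto simp: b_mult b_\<alpha> funpow_\<tau>_mult)
qed (use assms \<sigma>(1) G.group_axioms in \<open>auto intro: \<alpha>_Bij\<close>)

lemma funpow_\<epsilon>_pow: "(\<epsilon> ^^ k) (\<eta> [^]\<^bsub>N\<^esub> i) = \<eta> [^]\<^bsub>N\<^esub> (e ^ k * i)" for i :: nat
proof (induction k)
  case (Suc k)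
  then show ?case using \<epsilon>_int_pow[of "int (e ^ k * i)"]
    by (simp add: int_pow_int mult.assoc flip: of_nat_mult of_nat_power)
qed simp

text \<open>The first four facts match the assumptions of \<open>cyclic_hopf_form\<close>; the last
  identifies its range with the group in \<open>hopf_alg\<close>.\<close>

lemma \<alpha>_pow_facts:
  fixes i j k :: nat
  shows "\<alpha> (\<eta> [^]\<^bsub>N\<^esub> i) \<in> Bij (carrier G)"
    and "\<alpha> (\<eta> [^]\<^bsub>N\<^esub> i) \<otimes>\<^bsub>BijGroup (carrier G)\<^esub> \<alpha> (\<eta> [^]\<^bsub>N\<^esub> j) = \<alpha> (\<eta> [^]\<^bsub>N\<^esub> (i + j))"
    and "\<alpha> (\<eta> [^]\<^bsub>N\<^esub> i) = \<alpha> (\<eta> [^]\<^bsub>N\<^esub> j) \<longleftrightarrow> [i = j] (mod p ^ n)"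
    and "conj_action G (\<sigma> [^]\<^bsub>G\<^esub> k) (\<alpha> (\<eta> [^]\<^bsub>N\<^esub> i)) = \<alpha> (\<eta> [^]\<^bsub>N\<^esub> (e ^ k * i))"
    and "range (\<lambda>i::nat. \<alpha> (\<eta> [^]\<^bsub>N\<^esub> i)) = \<alpha> ` carrier N"
proof -
  show "\<alpha> (\<eta> [^]\<^bsub>N\<^esub> i) \<in> Bij (carrier G)" using \<eta>(1) by (intro \<alpha>_Bij) simp
  show "\<alpha> (\<eta> [^]\<^bsub>N\<^esub> i) \<otimes>\<^bsub>BijGroup (carrier G)\<^esub> \<alpha> (\<eta> [^]\<^bsub>N\<^esub> j) = \<alpha> (\<eta> [^]\<^bsub>N\<^esub> (i + j))"
    using \<eta>(1) by (simp add: \<alpha>_mult N.nat_pow_mult)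
  have "\<alpha> (\<eta> [^]\<^bsub>N\<^esub> i) = \<alpha> (\<eta> [^]\<^bsub>N\<^esub> j) \<longleftrightarrow> \<eta> [^]\<^bsub>N\<^esub> int i = \<eta> [^]\<^bsub>N\<^esub> int j"
    using inj_on_eq_iff[OF \<alpha>_inj] \<eta>(1) by (simp add: int_pow_int)
  also have "\<dots> \<longleftrightarrow> [i = j] (mod p ^ n)"
    unfolding N.int_pow_eq[OF \<eta>(1)] \<eta>(3) by (metis cong_iff_dvd_diff cong_int_iff cong_sym)
  finally show "\<alpha> (\<eta> [^]\<^bsub>N\<^esub> i) = \<alpha> (\<eta> [^]\<^bsub>N\<^esub> j) \<longleftrightarrow> [i = j] (mod p ^ n)" .
  show "conj_action G (\<sigma> [^]\<^bsub>G\<^esub> k) (\<alpha> (\<eta> [^]\<^bsub>N\<^esub> i)) = \<alpha> (\<eta> [^]\<^bsub>N\<^esub> (e ^ k * i))"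
    using \<eta>(1) by (simp add: conj_action_\<alpha> funpow_\<epsilon>_pow)
  show "range (\<lambda>i::nat. \<alpha> (\<eta> [^]\<^bsub>N\<^esub> i)) = \<alpha> ` carrier N"
    unfolding \<eta>(2) by auto
qed

end

section \<open>The isomorphism criterion\<close>

lemma auto_pow_generator:
  assumes "group N" "\<eta> \<in> carrier N" "\<gamma> \<in> carrier (AutoGroup N)" "\<gamma> \<eta> = \<eta> [^]\<^bsub>N\<^esub> (g::nat)"
  shows "(\<gamma> [^]\<^bsub>AutoGroup N\<^esub> (k::nat)) \<eta> = \<eta> [^]\<^bsub>N\<^esub> (g ^ k)"
proof -
  interpret N: group N by fact
  have \<gamma>: "\<gamma> \<in> Bij (carrier N)" "\<gamma> \<in> hom N N"
    using assms(3) by (auto simp: AutoGroup_def auto_def)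
  have "(\<gamma> ^^ k) \<eta> = \<eta> [^]\<^bsub>N\<^esub> (g ^ k)"
  proof (induction k)
    case (Suc k)
    have "\<gamma> (\<eta> [^]\<^bsub>N\<^esub> (g ^ k)) = \<gamma> \<eta> [^]\<^bsub>N\<^esub> (g ^ k)"
      using hom_nat_pow[OF \<gamma>(2) assms(2,1,1)] .
    with Suc show ?case using assms(2,4) by (simp add: N.nat_pow_pow)
  qed (use assms(2) in simp)
  then show ?thesis
    using assms(2) unfolding AutoGroup_def nat_pow_carrier_update nat_pow_BijGroup[OF \<gamma>(1)] by simp
qed

text \<open>Used for m = 1 + p, to produce an automorphism that has to be a power of the given
  generator.\<close>

lemma power_auto:
  assumes "group N" "\<eta> \<in> carrier N" "carrier N = {\<eta> [^]\<^bsub>N\<^esub> k | k::nat. True}"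
    and "coprime m (group.ord N \<eta>)" "finite (carrier N)"
  shows "(\<lambda>x\<in>carrier N. x [^]\<^bsub>N\<^esub> (m::nat)) \<in> auto N"
proof -
  interpret N: group N by fact
  have comm: "x \<otimes>\<^bsub>N\<^esub> y = y \<otimes>\<^bsub>N\<^esub> x" if "x \<in> carrier N" "y \<in> carrier N" for x y
    using that unfolding assms(3) by (auto simp: N.nat_pow_mult assms(2) add.commute)
  let ?f = "\<lambda>x\<in>carrier N. x [^]\<^bsub>N\<^esub> m"
  have "inj_on ?f (carrier N)"
  proof
    fix x y assume "x \<in> carrier N" "y \<in> carrier N" and eq: "?f x = ?f y"
    then obtain i j :: nat where ij: "x = \<eta> [^]\<^bsub>N\<^esub> i" "y = \<eta> [^]\<^bsub>N\<^esub> j" unfolding assms(3) by auto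
    then have "\<eta> [^]\<^bsub>N\<^esub> (i * m) = \<eta> [^]\<^bsub>N\<^esub> (j * m)"
      using eq assms(2) by (simp add: N.nat_pow_pow)
    then have "int (N.ord \<eta>) dvd (int j - int i) * int m"
      using N.int_pow_eq[OF assms(2), of "int (i * m)" "int (j * m)"]
      unfolding int_pow_int by (simp add: left_diff_distrib)
    moreover have "coprime (int (N.ord \<eta>)) (int m)"
      using assms(4) by (simp add: coprime_commute)
    ultimately have "int (N.ord \<eta>) dvd int j - int i"
      by (simp add: coprime_dvd_mult_left_iff)
    then show "x = y"
      using N.int_pow_eq[OF assms(2), of "int i" "int j"] by (simp add: ij int_pow_int)
  qed
  moreover have "?f ` carrier N \<subseteq> carrier N" by auto
  ultimately have "bij_betw ?f (carrier N) (carrier N)"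
    using endo_inj_surj[OF assms(5)] by (simp add: bij_betw_def)
  moreover have "?f \<in> hom N N"
  proof (rule homI)
    fix x y assume "x \<in> carrier N" "y \<in> carrier N"
    then show "?f (x \<otimes>\<^bsub>N\<^esub> y) = ?f x \<otimes>\<^bsub>N\<^esub> ?f y"
      using N.pow_mult_distrib[OF comm] by simp
  qed simp
  ultimately show ?thesis by (simp add: auto_def Bij_def)
qed

text \<open>This is where the choice of \<gamma> as a generator matters. If g^(p-1) were 1 modulo
  p^2, the same would hold for every power of g, but 1 + p is such a power modulo p^n and violates
  it.\<close>

lemma aut_generator_exponent:
  fixes p n :: nat
  assumes "Factorial_Ring.prime p" "odd p" "n \<ge> 1"
    and "group N" "finite (carrier N)" "\<eta> \<in> carrier N" "carrier N = {\<eta> [^]\<^bsub>N\<^esub> k | k::nat. True}"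
    and "group.ord N \<eta> = p ^ n"
    and "\<gamma> \<in> carrier (AutoGroup N)" "generate (AutoGroup N) {\<gamma>} = carrier (AutoGroup N)"
  obtains g where "\<gamma> \<eta> = \<eta> [^]\<^bsub>N\<^esub> (g::nat)" "\<not> p dvd g" "n \<ge> 2 \<Longrightarrow> \<not> p ^ 2 dvd g ^ (p - 1) - 1"
proof -
  interpret N: group N by fact
  interpret Aut: group "AutoGroup N" by (rule N.AutoGroup)
  have p1: "p > 1" using assms(1) by (rule prime_gt_1_nat)
  have \<gamma>: "\<gamma> \<in> Bij (carrier N)" "\<gamma> \<in> hom N N"
    using assms(9) by (auto simp: AutoGroup_def auto_def)
  have "\<gamma> \<eta> \<in> carrier N" using \<gamma>(2) assms(6) by (auto simp: hom_def)
  then obtain g :: nat where g: "\<gamma> \<eta> = \<eta> [^]\<^bsub>N\<^esub> g" unfolding assms(7) by blast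
  have nat_eq: "\<eta> [^]\<^bsub>N\<^esub> i = \<eta> [^]\<^bsub>N\<^esub> j \<longleftrightarrow> [i = j] (mod p ^ n)" for i j :: nat
    using N.int_pow_eq[OF assms(6), of "int i" "int j"] unfolding int_pow_int assms(8)
    by (metis cong_iff_dvd_diff cong_int_iff cong_sym)
  \<comment> \<open>Otherwise \<gamma> would send the nontrivial element \<eta>^(p^(n-1)) to the
    identity.\<close>
  have "\<not> p dvd g"
  proof
    assume "p dvd g"
    then obtain h where h: "g = p * h" by blast
    have pn: "p ^ n = p * p ^ (n - 1)" using assms(3) by (simp flip: power_Suc)
    have "\<gamma> (\<eta> [^]\<^bsub>N\<^esub> (p ^ (n - 1))) = \<eta> [^]\<^bsub>N\<^esub> (p ^ n * h)"
      using hom_nat_pow[OF \<gamma>(2) assms(6,4,4)] assms(6)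
      by (simp add: g N.nat_pow_pow h pn ac_simps)
    also have "\<dots> = \<one>\<^bsub>N\<^esub>"
      using nat_eq[of "p ^ n * h" 0] by (simp add: cong_def)
    also have "\<dots> = \<gamma> \<one>\<^bsub>N\<^esub>"
      using hom_one[OF \<gamma>(2) assms(4,4)] by simp
    finally have "\<eta> [^]\<^bsub>N\<^esub> (p ^ (n - 1)) = \<one>\<^bsub>N\<^esub>"
      using inj_onD[of \<gamma> "carrier N"] \<gamma>(1) assms(6) by (auto simp: Bij_def bij_betw_def)
    then have "p ^ n dvd p ^ (n - 1)"
      using nat_eq[of "p ^ (n - 1)" 0] by (simp add: cong_0_iff)
    then show False using p1 assms(3) power_dvd_imp_le[of p n "n - 1"] by simp
  qed
  moreover have "\<not> p ^ 2 dvd g ^ (p - 1) - 1" if n2: "n \<ge> 2"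
  proof
    assume "p ^ 2 dvd g ^ (p - 1) - 1"
    moreover have "g ^ (p - 1) \<ge> 1" using \<open>\<not> p dvd g\<close> by (cases g) auto
    ultimately have d1: "[g ^ (p - 1) = 1] (mod p ^ 2)" by (simp add: cong_altdef_nat cong_sym)
    \<comment> \<open>1 + p is a unit of order p modulo p^2, so its power p - 1 is not 1
      there.\<close>
    have "coprime (1 + p) p" by simp
    then have "coprime (1 + p) (N.ord \<eta>)" unfolding assms(8) by (simp only: coprime_power_right_iff) simp
    from power_auto[OF assms(4,6,7) this assms(5)]
    have "(\<lambda>x\<in>carrier N. x [^]\<^bsub>N\<^esub> (1 + p)) \<in> generate (AutoGroup N) {\<gamma>}"
      unfolding assms(10) by (simp add: AutoGroup_def)
    moreover have "finite (carrier (AutoGroup N))"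
    proof (rule finite_subset)
      show "carrier (AutoGroup N) \<subseteq> carrier N \<rightarrow>\<^sub>E carrier N"
        by (auto simp: AutoGroup_def auto_def Bij_def PiE_def hom_def)
      show "finite (carrier N \<rightarrow>\<^sub>E carrier N)" using assms(5) by (intro finite_PiE)
    qed
    ultimately obtain k :: nat where k: "(\<lambda>x\<in>carrier N. x [^]\<^bsub>N\<^esub> (1 + p)) = \<gamma> [^]\<^bsub>AutoGroup N\<^esub> k"
      using Aut.generate_pow_on_finite_carrier[OF _ assms(9)] by blast
    have "\<eta> [^]\<^bsub>N\<^esub> (1 + p) = \<eta> [^]\<^bsub>N\<^esub> (g ^ k)"
      using fun_cong[OF k, of \<eta>] assms(6) auto_pow_generator[OF assms(4,6,9) g] by simp
    then have "[1 + p = g ^ k] (mod p ^ n)" by (simp only: nat_eq)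
    then have "[1 + p = g ^ k] (mod p ^ 2)"
      by (rule cong_dvd_modulus_nat) (simp add: n2 le_imp_power_dvd)
    then have "[(1 + p) ^ (p - 1) = (g ^ (p - 1)) ^ k] (mod p ^ 2)"
      using cong_pow[of "1 + p" "g ^ k" "p ^ 2" "p - 1"]
      by (simp only: power_mult[symmetric] mult.commute[of k])
    also have "[(g ^ (p - 1)) ^ k = 1 ^ k] (mod p ^ 2)" using d1 by (rule cong_pow)
    \<comment> \<open>One more factor 1 + p raises the exponent to p, where the geometric sum shows
      the power to be 1; together this says 1 + p = 1 modulo p^2.\<close>
    finally have "[(1 + p) ^ (p - 1) * (1 + p) = 1 ^ k * (1 + p)] (mod p ^ 2)"
      by (rule cong_scalar_right)
    then have "[(1 + p) ^ p = 1 + p] (mod p ^ 2)"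
      using p1 by (simp only: power_minus_mult power_one mult_1_left)
    moreover have "[(1 + p) ^ p = 1] (mod p ^ 2)"
    proof -
      have c: "[1 + p = 1] (mod p)" by (simp only: cong_def mod_add_self2)
      have "p dvd (\<Sum>i<p. (1 + p) ^ i)"
        using prime_power_dvd_geometric_sum_iff[OF assms(1,2) c, of 1 p] by simp
      then have "p ^ 2 dvd (1 + p) ^ p - 1"
        using power_minus_one_geometric_sum[of "1 + p" p] by (simp add: power2_eq_square)
      then show ?thesis by (simp add: cong_altdef_nat cong_sym)
    qed
    ultimately have "[p + 1 = 0 + 1] (mod p ^ 2)"
      by (simp add: cong_def)
    then have "p ^ 2 dvd p" unfolding cong_add_rcancel_nat by (simp add: cong_0_iff)
    then show False using p1 by (simp add: power2_eq_square)
  qed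
  ultimately show thesis using that[OF g] by blast
qed

theorem theorem4p5:
  fixes p n r s :: nat
    and L :: "('a, 'b) ring_scheme" and K :: "'a set" and \<sigma> :: "'a \<Rightarrow> 'a" and \<zeta> :: 'a
    and N :: "('n, 'c) monoid_scheme" and \<eta> :: 'n and \<gamma> \<delta> :: "'n \<Rightarrow> 'n"
  assumes "Factorial_Ring.prime p" and "odd p" and "n \<ge> 1"
    and "galois_extension L K"
    and "char_zero (L\<lparr>carrier := K\<rparr>)"
    and "primitive_root_of_unity (L\<lparr>carrier := K\<rparr>) (p ^ n) \<zeta>"
    and "ring.dimension L (p ^ n) K (carrier L)"
    and "\<sigma> \<in> carrier (galois_group L K)"
    and "generate (galois_group L K) {\<sigma>} = carrier (galois_group L K)"
    and "group N" and "order N = p ^ n"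
    and "\<eta> \<in> carrier N" and "generate N {\<eta>} = carrier N"
    and "\<gamma> \<in> carrier (AutoGroup N)"
    and "generate (AutoGroup N) {\<gamma>} = carrier (AutoGroup N)"
    and "\<delta> = \<gamma> [^]\<^bsub>AutoGroup N\<^esub> (p - 1)"
    and "r < p ^ (n - 1)" and "s < p ^ (n - 1)"
  shows "algebra_isomorphic K (hopf_alg L K \<sigma> N \<eta> \<delta> r) (hopf_alg L K \<sigma> N \<eta> \<delta> s)
           \<longleftrightarrow> vp p r = vp p s"
proof (cases "r = s")
  case True
  then show ?thesis by (simp add: algebra_isomorphic_refl)
next
  case False
  \<comment> \<open>For n = 1 the bound p^0 leaves only r = s = 0. From n = 2 on, the statement
    modulo p^2 about the generator is available.\<close>
  have "n \<ge> 2"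
  proof (rule ccontr)
    assume "\<not> n \<ge> 2"
    with assms(3) have "n = 1" by simp
    with assms(17,18) False show False by simp
  qed
  interpret field L using assms(4) by (simp add: galois_extension_def)
  interpret cyclic_kummer_extension L K \<sigma> "p ^ n" \<zeta>
    by unfold_locales (use assms in auto)
  interpret N: group N by fact
  interpret Aut: group "AutoGroup N" by (rule N.AutoGroup)
  interpret G: group "galois_group L K" by (rule group_galois_group)
  have "finite (carrier N)"
    using assms(11) q_pos by (intro card_ge_0_finite) (simp add: order_def)
  have ord\<eta>: "N.ord \<eta> = p ^ n"
    using N.generate_pow_card[OF assms(12)] assms(11,13) by (simp add: order_def)
  have carN: "carrier N = {\<eta> [^]\<^bsub>N\<^esub> k | k::nat. True}"
    using N.generate_pow_on_finite_carrier[OF \<open>finite (carrier N)\<close> assms(12)] assms(13) by simp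
  obtain g where g: "\<gamma> \<eta> = \<eta> [^]\<^bsub>N\<^esub> (g::nat)" "\<not> p dvd g" "\<not> p ^ 2 dvd g ^ (p - 1) - 1"
    using aut_generator_exponent[OF assms(1-3,10) \<open>finite (carrier N)\<close> assms(12) carN ord\<eta> assms(14,15)]
      \<open>n \<ge> 2\<close> by metis
  define d where "d = g ^ (p - 1)"
  interpret one_unit_generator p n d
    by unfold_locales (use assms(1-3) g(2) fermat_theorem in \<open>auto simp: d_def\<close>)
  \<comment> \<open>Both directions are recorded so that transitivity alone moves an isomorphism
    between the Hopf algebras and the function algebras.\<close>
  have iso: "algebra_isomorphic K (hopf_alg L K \<sigma> N \<eta> \<delta> k) (twisted_functions L \<sigma> (p ^ n) (d ^ k))"
    "algebra_isomorphic K (twisted_functions L \<sigma> (p ^ n) (d ^ k)) (hopf_alg L K \<sigma> N \<eta> \<delta> k)" for k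
  proof -
    have pow: "\<delta> [^]\<^bsub>AutoGroup N\<^esub> k = \<gamma> [^]\<^bsub>AutoGroup N\<^esub> ((p - 1) * k)"
      unfolding assms(16) by (rule Aut.nat_pow_pow[OF assms(14)])
    interpret E: cyclic_regular_embedding "galois_group L K" N \<sigma> \<eta> \<delta> p n k "d ^ k"
    proof unfold_locales
      show "[d ^ k = 1] (mod p)" using cong_pow[OF d_cong, of k] by simp
      show "\<delta> [^]\<^bsub>AutoGroup N\<^esub> k \<in> auto N"
        using Aut.nat_pow_closed[OF assms(14), of "(p - 1) * k"] unfolding pow by (simp add: AutoGroup_def)
      show "(\<delta> [^]\<^bsub>AutoGroup N\<^esub> k) \<eta> = \<eta> [^]\<^bsub>N\<^esub> (d ^ k)"
        unfolding pow auto_pow_generator[OF assms(10,12,14) g(1)] by (simp add: d_def power_mult)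
    qed (use assms(1,2,8,12) unit_power_q carN ord\<eta> ord_generator carrier_galois_group_eq in auto)
    interpret F: cyclic_hopf_form L K \<sigma> "p ^ n" \<zeta> "\<lambda>i. E.\<alpha> (\<eta> [^]\<^bsub>N\<^esub> i)" "d ^ k"
      by unfold_locales (use E.\<alpha>_pow_facts unit_power_q in auto)
    have "hopf_alg L K \<sigma> N \<eta> \<delta> k = fixed_algebra L K (range (\<lambda>i::nat. E.\<alpha> (\<eta> [^]\<^bsub>N\<^esub> i)))"
      unfolding E.\<alpha>_pow_facts(5) by (simp add: hopf_alg_def E.\<alpha>_def)
    then show "algebra_isomorphic K (hopf_alg L K \<sigma> N \<eta> \<delta> k) (twisted_functions L \<sigma> (p ^ n) (d ^ k))"
      "algebra_isomorphic K (twisted_functions L \<sigma> (p ^ n) (d ^ k)) (hopf_alg L K \<sigma> N \<eta> \<delta> k)"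
      using F.fixed_algebra_isomorphic_twisted_functions F.twisted_functions_isomorphic_fixed_algebra
      by simp_all
  qed
  have "algebra_isomorphic K (hopf_alg L K \<sigma> N \<eta> \<delta> r) (hopf_alg L K \<sigma> N \<eta> \<delta> s) \<longleftrightarrow>
      algebra_isomorphic K (twisted_functions L \<sigma> (p ^ n) (d ^ r)) (twisted_functions L \<sigma> (p ^ n) (d ^ s))"
    using iso[of r] iso[of s] algebra_isomorphic_trans by metis
  also have "\<dots> \<longleftrightarrow> vp p r = vp p s"
  proof
    assume "algebra_isomorphic K (twisted_functions L \<sigma> (p ^ n) (d ^ r)) (twisted_functions L \<sigma> (p ^ n) (d ^ s))"
    from twisted_functions_isomorphic_imp_card_eq[OF this unit_power_q unit_power_q]
    have "p ^ Suc (truncated_valuation r) = p ^ Suc (truncated_valuation s)"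
      unfolding card_fixed_residues[OF g(3)[folded d_def] assms(17)]
        card_fixed_residues[OF g(3)[folded d_def] assms(18)] .
    then have "truncated_valuation r = truncated_valuation s"
      unfolding power_inject_exp[OF p_gt_1] by simp
    then show "vp p r = vp p s" using truncated_valuation_eq_iff[OF assms(17,18)] by blast
  next
    assume "vp p r = vp p s"
    \<comment> \<open>Equal valuations of distinct numbers exclude 0, since only 0 has infinite
      valuation.\<close>
    then have rs: "r > 0" "s > 0" "multiplicity p r = multiplicity p s"
      using False by (auto simp: vp_def split: if_splits)
    obtain t where t: "[d ^ s = (d ^ r) ^ t] (mod p ^ n)"
      using unit_power_conjugate[OF rs] by blast
    obtain t' where t': "[d ^ r = (d ^ s) ^ t'] (mod p ^ n)"
      using unit_power_conjugate[OF rs(2,1) rs(3)[symmetric]] by blast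
    \<comment> \<open>The exponent is p^n, written as a successor so that the predecessor power can
      act as inverse.\<close>
    have "[(d ^ s) ^ Suc (p ^ n - 1) = 1] (mod p ^ n)"
      using unit_power_q[of s] q_pos by (simp del: power_Suc)
    then show "algebra_isomorphic K (twisted_functions L \<sigma> (p ^ n) (d ^ r)) (twisted_functions L \<sigma> (p ^ n) (d ^ s))"
      by (rule twisted_functions_isomorphic[OF t' t])
  qed
  finally show ?thesis .
qed

end
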